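(* Let $K$ be a commutative locally compact hypergroup and let $\alpha\in\widehat{K}$. Then $UC(K)$ is $\alpha$-amenable if and only if $K$ is $\alpha$-amenable (i.e. if and only if $L^\infty(K)$ is $\alpha$-amenable).
   Context: A locally compact hypergroup (in the sense of Jewett) is denoted $(K,\omega,\sim)$, with convolution $\omega:K\times K\to M^1(K)$ (probability measures on $K$) and involution $x\mapsto\tilde x$; it is commutative if $\omega(x,y)=\omega(y,x)$ for all $x,y$. A commutative hypergroup has a Haar measure $m$, unique up to a multiplicative constant, and $L^\infty(K)$ is the space of (classes of) essentially bounded Borel measurable complex functions. Translation is $T_xf(y)=\int_K f(t)\,d\omega(x,y)(t)$. Character space: $\widehat K=\{\alpha\in C^b(K):\alpha\neq 0,\ \int_K\alpha\,d\omega(x,y)=\alpha(x)\alpha(y)\text{ and }\alpha(\tilde x)=\overline{\alpha(x)}\ \forall x,y\in K\}$, where $C^b(K)$ is the space of bounded continuous complex functions with the sup norm. $UC(K)=\{f\in C^b(K): x\mapsto T_xf \text{ is continuous from } K \text{ to } (C^b(K),\|\cdot\|_\infty)\}$. It is a norm closed, conjugation closed, translation invariant subspace of $C^b(K)$ containing $\widehat K$. $\alpha$-amenability: let $\alpha\in\widehat K$ and let $X$ be a subspace of $L^\infty(K)$ with $\alpha\in X$ which is closed under complex conjugation and translation invariant. $X$ is called $\alpha$-amenable if there is $m_\alpha\in X^*$ (bounded linear functional, called an $\alpha$-mean) with (i) $m_\alpha(\alpha)=1$ and (ii) $m_\alpha(T_xf)=\alpha(x)m_\alpha(f)$ for all $f\in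 X$, $x\in K$. $K$ is called $\alpha$-amenable if $X=L^\infty(K)$ is $\alpha$-amenable. *)

theory Defs
  imports "HOL-Probability.Probability"
begin

text \<open>The underlying space \<open>K\<close> of a hypergroup is a type \<open>'a\<close> of class \<open>t2_space\<close>;
  complex functions on \<open>K\<close> are plain functions. The space \<open>C\<^sup>b(K)\<close> is the library set
  \<^term>\<open>bcontfun\<close>, and its sup norm is the norm of the type \<open>'a \<Rightarrow>\<^sub>C complex\<close>.\<close>

definition Cc :: "('a::topological_space \<Rightarrow> complex) set" where
  "Cc = {f. continuous_on UNIV f \<and> compact (closure {x. f x \<noteq> 0})}"

definition radon_measure :: "'a::t2_space measure \<Rightarrow> bool" where
  "radon_measure \<mu> \<longleftrightarrow>
     sets \<mu> = sets borel \<and>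
     (\<forall>C. compact C \<longrightarrow> emeasure \<mu> C < \<infinity>) \<and>
     (\<forall>B \<in> sets borel. emeasure \<mu> B = (INF U\<in>{U. open U \<and> B \<subseteq> U}. emeasure \<mu> U)) \<and>
     (\<forall>U. open U \<longrightarrow> emeasure \<mu> U = (SUP C\<in>{C. compact C \<and> C \<subseteq> U}. emeasure \<mu> C))"

definition msupp :: "'a::topological_space measure \<Rightarrow> 'a set" where
  "msupp \<mu> = {x. \<forall>U. open U \<and> x \<in> U \<longrightarrow> emeasure \<mu> U \<noteq> 0}"

text \<open>The Michael topology on the nonempty compact subsets of \<open>K\<close>. Taking \<open>U = V = UNIV\<close>
  shows that its carrier consists of exactly these sets.\<close>

definition michael_topology :: "'a::topological_space set topology" where
  "michael_topology = topology_generated_by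
     {{C. compact C \<and> C \<noteq> {} \<and> C \<inter> U \<noteq> {} \<and> C \<subseteq> V} | U V. open U \<and> open V}"

text \<open>Hypergroups in the sense of Jewett. The topology on the set \<open>M\<^sup>1(K)\<close> of Radon probability
  measures is Jewett's cone topology, the coarsest one making \<open>\<mu> \<mapsto> \<integral>f d\<mu>\<close> continuous for
  \<open>f \<in> C\<^sub>c(K) \<union> {1}\<close>; the function \<open>1\<close> imposes no condition on probability measures.
  The convolution \<open>\<mu> * \<nu>\<close> is the regular measure with
  \<open>\<integral>f d(\<mu> * \<nu>) = \<integral>\<integral>\<integral>f d\<omega>(s,t) d\<mu>(s) d\<nu>(t)\<close> for \<open>f \<in> C\<^sub>c(K)\<close>, so that \<open>conv_assoc\<close> is the
  identity \<open>\<epsilon>\<^sub>x * \<omega>(y,z) = \<omega>(x,y) * \<epsilon>\<^sub>z\<close>.\<close>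

locale hypergroup =
  fixes \<omega> :: "'a::t2_space \<Rightarrow> 'a \<Rightarrow> 'a measure"
    and invol :: "'a \<Rightarrow> 'a"
  assumes locally_compact: "locally_compact_space (euclidean :: 'a topology)"
    and conv_prob: "prob_space (\<omega> x y)"
    and conv_radon: "radon_measure (\<omega> x y)"
    and conv_continuous:
      "f \<in> Cc \<Longrightarrow> continuous_on UNIV (\<lambda>(x, y). LINT t|\<omega> x y. f t)"
    and conv_assoc:
      "f \<in> Cc \<Longrightarrow>
        (LINT t|\<omega> y z. LINT s|\<omega> x t. f s) = (LINT t|\<omega> x y. LINT s|\<omega> t z. f s)"
    and supp_compact: "compact (msupp (\<omega> x y))"
    and supp_continuous:
      "continuous_map euclidean michael_topology (\<lambda>(x, y). msupp (\<omega> x y))"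
    and invol_continuous: "continuous_on UNIV invol"
    and invol_invol: "invol (invol x) = x"
    and invol_conv: "distr (\<omega> x y) borel invol = \<omega> (invol y) (invol x)"
    and identity:
      "\<exists>e. (\<forall>x. \<omega> e x = return borel x \<and> \<omega> x e = return borel x) \<and>
           (\<forall>x y. e \<in> msupp (\<omega> x (invol y)) \<longleftrightarrow> x = y)"

locale commutative_hypergroup = hypergroup +
  assumes conv_commute: "\<omega> x y = \<omega> y x"

definition translate ::
    "('a::topological_space \<Rightarrow> 'a \<Rightarrow> 'a measure) \<Rightarrow> 'a \<Rightarrow> ('a \<Rightarrow> complex) \<Rightarrow> 'a \<Rightarrow> complex" where
  "translate \<omega> x f = (\<lambda>y. LINT t|\<omega> x y. f t)"

definition haar_measure ::
    "('a::t2_space \<Rightarrow> 'a \<Rightarrow> 'a measure) \<Rightarrow> 'a measure \<Rightarrow> bool" where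
  "haar_measure \<omega> m \<longleftrightarrow>
     radon_measure m \<and> emeasure m UNIV \<noteq> 0 \<and>
     (\<forall>f\<in>Cc. \<forall>x. (LINT y|m. translate \<omega> x f y) = (LINT y|m. f y))"

definition characters ::
    "('a::topological_space \<Rightarrow> 'a \<Rightarrow> 'a measure) \<Rightarrow> ('a \<Rightarrow> 'a) \<Rightarrow> ('a \<Rightarrow> complex) set" where
  "characters \<omega> invol = {\<alpha> \<in> bcontfun. \<alpha> \<noteq> (\<lambda>_. 0) \<and>
     (\<forall>x y. (LINT t|\<omega> x y. \<alpha> t) = \<alpha> x * \<alpha> y) \<and> (\<forall>x. \<alpha> (invol x) = cnj (\<alpha> x))}"

text \<open>The membership \<open>translate \<omega> x f \<in> bcontfun\<close> holds for every \<open>f \<in> C\<^sup>b(K)\<close>; it is recorded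
  because \<^term>\<open>Bcontfun\<close> is meaningful on \<^term>\<open>bcontfun\<close> only.\<close>

definition UC ::
    "('a::topological_space \<Rightarrow> 'a \<Rightarrow> 'a measure) \<Rightarrow> ('a \<Rightarrow> complex) set" where
  "UC \<omega> = {f \<in> bcontfun. (\<forall>x. translate \<omega> x f \<in> bcontfun) \<and>
     continuous_on UNIV (\<lambda>x. Bcontfun (translate \<omega> x f))}"

text \<open>As usual for Haar measures that need not be \<open>\<sigma>\<close>-finite, \<open>essentially\<close> means up to locally
  null sets, so that \<open>L\<^sup>\<infinity>(K)\<close> is the dual of \<open>L\<^sup>1(K)\<close>. If \<open>K\<close> is \<open>\<sigma>\<close>-compact, the locally null
  Borel sets are the null Borel sets. An element of \<open>L\<^sup>\<infinity>(K)\<close> is represented by any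
  member of its class; \<open>Linf_norm\<close> is the norm of the class.\<close>

definition locally_null :: "'a::topological_space measure \<Rightarrow> 'a set \<Rightarrow> bool" where
  "locally_null m N \<longleftrightarrow> (\<forall>C. compact C \<longrightarrow> emeasure m (N \<inter> C) = 0)"

definition Linf :: "'a::topological_space measure \<Rightarrow> ('a \<Rightarrow> complex) set" where
  "Linf m = {f \<in> borel_measurable borel. \<exists>c. locally_null m {x. c < norm (f x)}}"

definition Linf_norm :: "'a::topological_space measure \<Rightarrow> ('a \<Rightarrow> complex) \<Rightarrow> real" where
  "Linf_norm m f = Inf {c. 0 \<le> c \<and> locally_null m {x. c < norm (f x)}}"

text \<open>Bounded linear functionals on a subspace \<open>X\<close> of \<open>L\<^sup>\<infinity>(K)\<close>, given on representatives:
  the bound by \<^term>\<open>Linf_norm\<close> forces the value to depend on the class only.\<close>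

definition bounded_functional_on ::
    "'a::topological_space measure \<Rightarrow> ('a \<Rightarrow> complex) set \<Rightarrow> (('a \<Rightarrow> complex) \<Rightarrow> complex) \<Rightarrow> bool" where
  "bounded_functional_on m X \<phi> \<longleftrightarrow>
     (\<forall>f\<in>X. \<forall>g\<in>X. \<phi> (\<lambda>x. f x + g x) = \<phi> f + \<phi> g) \<and>
     (\<forall>c. \<forall>f\<in>X. \<phi> (\<lambda>x. c * f x) = c * \<phi> f) \<and>
     (\<exists>B. \<forall>f\<in>X. norm (\<phi> f) \<le> B * Linf_norm m f)"

text \<open>To be used for translation invariant subspaces \<open>X\<close> of \<open>L\<^sup>\<infinity>(K)\<close> containing \<open>\<alpha>\<close>.\<close>

definition alpha_amenable ::
    "('a::topological_space \<Rightarrow> 'a \<Rightarrow> 'a measure) \<Rightarrow> 'a measure \<Rightarrow> ('a \<Rightarrow> complex) \<Rightarrow>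
     ('a \<Rightarrow> complex) set \<Rightarrow> bool" where
  "alpha_amenable \<omega> m \<alpha> X \<longleftrightarrow>
     (\<exists>\<phi>. bounded_functional_on m X \<phi> \<and> \<phi> \<alpha> = 1 \<and>
          (\<forall>f\<in>X. \<forall>x. \<phi> (translate \<omega> x f) = \<alpha> x * \<phi> f))"

end

theory Submission
  imports Defs
begin

text \<open>Every \<open>f \<in> L\<^sup>\<infinity>(K)\<close> is smoothed by a function \<open>h \<in> C\<^sub>c(K)\<close> with \<open>\<integral>\<alpha> h dm = 1\<close>: the function
  \<open>F\<^sub>f(x) = \<integral>f (T\<^bsub>invol x\<^esub> h) dm\<close> lies in \<open>UC(K)\<close>, because \<open>x \<mapsto> T\<^bsub>invol x\<^esub> h\<close> is continuous into
  \<open>L\<^sup>1(K)\<close>. The map \<open>f \<mapsto> F\<^sub>f\<close> is bounded, commutes with translations and fixes \<open>\<alpha>\<close>, so an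
  \<open>\<alpha>\<close>-mean \<open>\<phi>\<close> on \<open>UC(K)\<close> yields the \<open>\<alpha>\<close>-mean \<open>f \<mapsto> \<phi>(F\<^sub>f)\<close> on \<open>L\<^sup>\<infinity>(K)\<close>; the converse is
  restriction. All of this rests on \<open>\<integral>(T\<^sub>x f) g dm = \<integral>f (T\<^bsub>invol x\<^esub> g) dm\<close>. For \<open>f, g \<in> C\<^sub>c(K)\<close> it
  follows from Fubini's theorem after convolving with a symmetric approximate unit. It passes to
  indicator functions of open sets by \<open>\<tau>\<close>-additivity of Radon measures, and then to Borel
  functions.\<close>

text \<open>Haar invariance is assumed for single functions of \<open>Cc\<close> only, and T_x(f g)
  is in general not T_x f times T_x g, so the substitution that gives the adjoint formula on a group
  has no analogue. What survives is associativity: in the kernel k(y,z) of convolution with a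
  symmetric u, translating by x in y equals translating by \<open>invol x\<close> in z. For smoothed
  functions the formula is thus an interchange of integrals, and continuity of supports at the unit
  controls the error when u shrinks.

  K need be neither second countable nor sigma-compact, so product measurability and countable
  limits cannot be relied on; compact rectangles and directed suprema replace them. Moreover an
  element of \<open>Linf m\<close> is bounded only off a locally null set, which an individual
  \<open>\<omega> x y\<close> may charge. The function is therefore truncated, and the adjoint
  formula, read as an identity of measures, shows that this changes its translates only on a locally
  null set.

  Commutativity makes T_x F_f the smoothing of f by a translate of h, so that uniform continuity of
  F_f reduces to L1 continuity of translates of h.\<close>

section \<open>Urysohn functions, supports and Radon measures\<close>

definition Cc_real :: "('a::topological_space \<Rightarrow> real) set" where
  "Cc_real = {f. continuous_on UNIV f \<and> compact (closure {x. f x \<noteq> 0})}"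

lemma compact_closure_subset:
  fixes A :: "'a::t2_space set"
  assumes "compact L" "A \<subseteq> L"
  shows "compact (closure A)"
  by (metis assms closed_closure closure_minimal compact_Int_closed compact_imp_closed inf.absorb_iff2)

text \<open>Local compactness places \<open>C\<close> in an open \<open>V\<close> inside a compact
  \<open>L\<close>. Making the function vanish off \<open>U \<inter> V\<close>, not merely off
  \<open>U\<close>, gives it compact support.\<close>

lemma Urysohn_Cc:
  fixes C U :: "'a::t2_space set"
  assumes lc: "locally_compact_space (euclidean :: 'a topology)"
    and "compact C" "open U" "C \<subseteq> U"
  obtains f where "f \<in> Cc_real" "\<And>x. 0 \<le> f x" "\<And>x. f x \<le> 1" "\<And>x. x \<in> C \<Longrightarrow> f x = 1"
    "\<And>x. f x \<noteq> 0 \<Longrightarrow> x \<in> U"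
proof -
  have H: "Hausdorff_space (euclidean :: 'a topology)"
    unfolding Hausdorff_space_def
  proof (intro allI impI)
    fix x y :: 'a assume "x \<in> topspace euclidean \<and> y \<in> topspace euclidean \<and> x \<noteq> y"
    then obtain U V where "open U" "open V" "x \<in> U" "y \<in> V" "U \<inter> V = {}"
      using hausdorff[of x y] by blast
    then show "\<exists>U V. openin euclidean U \<and> openin euclidean V \<and> x \<in> U \<and> y \<in> V \<and> disjnt U V"
      by (intro exI[of _ U] exI[of _ V]) (simp add: disjnt_def)
  qed
  have "\<exists>V L. openin euclidean V \<and> compactin euclidean L \<and> closedin euclidean L \<and> C \<subseteq> V \<and> V \<subseteq> L"
    using locally_compact_space_compact_closed_compact[OF disjI1[OF H]] lc assms(2) by simp
  then obtain V L where VL: "open V" "compact L" "C \<subseteq> V" "V \<subseteq> L"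
    by auto
  have cr: "completely_regular_space (euclidean :: 'a topology)"
    by (rule iffD2[OF completely_regular_eq_regular_space[OF lc]
          locally_compact_Hausdorff_imp_regular_space[OF lc H]])
  have "disjnt C (- (U \<inter> V))" using assms(4) VL(3) by (auto simp: disjnt_def)
  moreover have "closed (- (U \<inter> V))" using assms(3) VL(1) by auto
  ultimately obtain f where f: "continuous_map euclidean (subtopology euclidean {0..1::real}) f"
      "f ` (- (U \<inter> V)) \<subseteq> {0}" "f ` C \<subseteq> {1}"
    by (rule_tac Urysohn_completely_regular_compact_closed[OF zero_le_one cr, of C "- (U \<inter> V)"])
      (use assms(2) closed_closedin in \<open>auto simp only: compactin_euclidean_iff\<close>)
  have c: "continuous_on UNIV f" and r: "\<And>x. f x \<in> {0..1}"
    using f(1) by (auto simp: continuous_map_in_subtopology)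
  have s: "f x \<noteq> 0 \<Longrightarrow> x \<in> U \<inter> V" for x using f(2) by blast
  have "{x. f x \<noteq> 0} \<subseteq> L" using s VL(4) by blast
  then have "compact (closure {x. f x \<noteq> 0})" using compact_closure_subset VL(2) by blast
  then show thesis using that[of f] c r s f(3) by (auto simp: Cc_real_def)
qed

lemma radon_sets: "radon_measure \<mu> \<Longrightarrow> sets \<mu> = sets borel"
  by (simp add: radon_measure_def)

lemma radon_space: "radon_measure \<mu> \<Longrightarrow> space \<mu> = UNIV"
  using sets_eq_imp_space_eq[OF radon_sets] by simp

lemma radon_compact_finite: "radon_measure \<mu> \<Longrightarrow> compact C \<Longrightarrow> emeasure \<mu> C < \<infinity>"
  by (simp add: radon_measure_def)

lemma radon_inner_open:
  "radon_measure \<mu> \<Longrightarrow> open U \<Longrightarrow> emeasure \<mu> U = (SUP C\<in>{C. compact C \<and> C \<subseteq> U}. emeasure \<mu> C)"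
  unfolding radon_measure_def by blast

text \<open>The null neighbourhoods may be uncountably many. A compact subset of \<open>W\<close> is
  covered by finitely many of them, hence null, and inner regularity passes this on to
  \<open>W\<close>.\<close>

lemma radon_null_open:
  assumes r: "radon_measure \<mu>" and "open W" "\<And>x. x \<in> W \<Longrightarrow> \<exists>U. open U \<and> x \<in> U \<and> emeasure \<mu> U = 0"
  shows "emeasure \<mu> W = 0"
proof -
  have "emeasure \<mu> C = 0" if C: "compact C" "C \<subseteq> W" for C
  proof -
    obtain U where U: "\<And>x. x \<in> C \<Longrightarrow> open (U x) \<and> x \<in> U x \<and> emeasure \<mu> (U x) = 0"
      using assms(3) C(2) by (metis subsetD)
    obtain F where F: "F \<subseteq> C" "finite F" "C \<subseteq> (\<Union>x\<in>F. U x)"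
      using compactE_image[of C C U] C(1) U by blast
    have "(\<Union>x\<in>F. U x) \<in> null_sets \<mu>"
    proof (rule null_sets_UN')
      fix x assume "x \<in> F"
      then show "U x \<in> null_sets \<mu>" using U F(1) radon_sets[OF r] by (auto simp: null_sets_def)
    qed (use F countable_finite in auto)
    moreover have "C \<in> sets \<mu>" using radon_sets[OF r] borel_compact[OF C(1)] by simp
    ultimately show ?thesis using F(3) by (meson null_setsD1 null_sets_subset)
  qed
  then have "(SUP C\<in>{C. compact C \<and> C \<subseteq> W}. emeasure \<mu> C) \<le> 0"
    by (intro SUP_least) simp
  then show ?thesis using radon_inner_open[OF r assms(2)] by simp
qed

lemma open_Compl_msupp: "open (- msupp \<mu>)"
proof (rule Topological_Spaces.openI)
  fix x assume "x \<in> - msupp \<mu>"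
  then obtain U where "open U" "x \<in> U" "emeasure \<mu> U = 0" by (auto simp: msupp_def)
  then show "\<exists>T. open T \<and> x \<in> T \<and> T \<subseteq> - msupp \<mu>" by (auto simp: msupp_def)
qed

lemma radon_AE_msupp:
  assumes "radon_measure \<mu>"
  shows "AE x in \<mu>. x \<in> msupp \<mu>"
proof -
  have "emeasure \<mu> (- msupp \<mu>) = 0"
    by (rule radon_null_open[OF assms open_Compl_msupp]) (auto simp: msupp_def)
  moreover have "- msupp \<mu> \<in> sets \<mu>"
    using radon_sets[OF assms] open_Compl_msupp by (metis borel_open)
  ultimately have "- msupp \<mu> \<in> null_sets \<mu>" by auto
  from AE_not_in[OF this] show ?thesis by auto
qed

text \<open>A Urysohn function fits between any compact \<open>C \<subseteq> U\<close> and
  \<open>U\<close>. Measures of open sets are thus determined by integrals of functions in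
  \<open>Cc\<close>, the only functions about which the hypergroup axioms speak.\<close>

lemma emeasure_open_eq_SUP_Cc:
  fixes \<mu> :: "'a::t2_space measure"
  assumes lc: "locally_compact_space (euclidean :: 'a topology)"
    and r: "radon_measure \<mu>" and U: "open U"
  shows "emeasure \<mu> U =
    (SUP f\<in>{f :: 'a \<Rightarrow> real. f \<in> Cc_real \<and> (\<forall>x. 0 \<le> f x \<and> f x \<le> 1 \<and> (f x \<noteq> 0 \<longrightarrow> x \<in> U))}. \<integral>\<^sup>+x. ennreal (f x) \<partial>\<mu>)"
    (is "_ = (SUP f\<in>?F. _)")
proof (rule antisym)
  show "emeasure \<mu> U \<le> (SUP f\<in>?F. \<integral>\<^sup>+x. ennreal (f x) \<partial>\<mu>)"
    unfolding radon_inner_open[OF r U]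
  proof (rule SUP_least, clarify)
    fix C assume C: "compact C" "C \<subseteq> U"
    obtain f where f: "f \<in> Cc_real" "\<And>x. 0 \<le> f x" "\<And>x. f x \<le> 1" "\<And>x. x \<in> C \<Longrightarrow> f x = 1"
      "\<And>x. f x \<noteq> 0 \<Longrightarrow> x \<in> U" by (rule Urysohn_Cc[OF lc C(1) U C(2)]) blast
    have "emeasure \<mu> C = (\<integral>\<^sup>+x. indicator C x \<partial>\<mu>)"
      using borel_compact[OF C(1)] radon_sets[OF r] by simp
    also have "\<dots> \<le> (\<integral>\<^sup>+x. ennreal (f x) \<partial>\<mu>)"
      by (intro nn_integral_mono) (auto simp: indicator_def f(4))
    also have "\<dots> \<le> (SUP f\<in>?F. \<integral>\<^sup>+x. ennreal (f x) \<partial>\<mu>)"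
      by (rule SUP_upper) (use f in auto)
    finally show "emeasure \<mu> C \<le> (SUP f\<in>?F. \<integral>\<^sup>+x. ennreal (f x) \<partial>\<mu>)" .
  qed
  show "(SUP f\<in>?F. \<integral>\<^sup>+x. ennreal (f x) \<partial>\<mu>) \<le> emeasure \<mu> U"
  proof (rule SUP_least, clarify)
    fix f :: "'a \<Rightarrow> real" assume f: "\<forall>x. 0 \<le> f x \<and> f x \<le> 1 \<and> (f x \<noteq> 0 \<longrightarrow> x \<in> U)"
    have "(\<integral>\<^sup>+x. ennreal (f x) \<partial>\<mu>) \<le> (\<integral>\<^sup>+x. indicator U x \<partial>\<mu>)"
      by (intro nn_integral_mono) (use f in \<open>auto simp: indicator_def\<close>)
    also have "\<dots> = emeasure \<mu> U" using U radon_sets[OF r] by simp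
    finally show "(\<integral>\<^sup>+x. ennreal (f x) \<partial>\<mu>) \<le> emeasure \<mu> U" .
  qed
qed

section \<open>Tau-additivity of Radon measures\<close>

text \<open>The sum rounds \<open>p\<close> down to a multiple of \<open>e\<close>, capped at
  \<open>real N * e\<close>. The levels start at \<open>k = 1\<close> and are compared strictly, so
  up to one layer of height \<open>e\<close> is lost.\<close>

lemma layer_sum:
  fixes p e :: real
  assumes "0 \<le> p" "0 < e"
  defines "s \<equiv> \<lambda>N. \<Sum>k=1..N. e * (if real k * e < p then 1 else 0)"
  shows "s N \<le> p" "p \<le> real N * e + e \<Longrightarrow> p \<le> e + s N"
proof -
  \<comment> \<open>The third conjunct strengthens the induction: while
    \<open>real N * e < p\<close>, every level has been counted and the sum is exactly
    \<open>real N * e\<close>.\<close>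
  have "s N \<le> p \<and> (p \<le> real N * e + e \<longrightarrow> p \<le> e + s N) \<and> (real N * e < p \<longrightarrow> s N = real N * e)"
  proof (induction N)
    case 0 then show ?case using assms by (simp add: s_def)
  next
    case (Suc N)
    have S: "s (Suc N) = s N + e * (if real (Suc N) * e < p then 1 else 0)"
      unfolding s_def by simp
    show ?case
    proof (cases "real (Suc N) * e < p")
      case True
      then have "real N * e < p" using \<open>0 < e\<close> by (simp add: distrib_right)
      then have "s N = real N * e" using Suc by blast
      then show ?thesis using S True by (simp add: distrib_right)
    next
      case False
      then show ?thesis using S Suc by (simp add: distrib_right)
    qed
  qed
  then show "s N \<le> p" "p \<le> real N * e + e \<Longrightarrow> p \<le> e + s N" by auto
qed

text \<open>Suprema and sums commute because one index dominates two given ones for all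
  \<open>k\<close> in \<open>J\<close> simultaneously; the binary case then carries the
  induction.\<close>

lemma SUP_sum_directed_ennreal:
  fixes f :: "'i \<Rightarrow> 'k \<Rightarrow> ennreal"
  assumes "I \<noteq> {}" "finite J"
    and dir: "\<And>i j. i \<in> I \<Longrightarrow> j \<in> I \<Longrightarrow> \<exists>h\<in>I. \<forall>k\<in>J. f i k \<le> f h k \<and> f j k \<le> f h k"
  shows "(\<Sum>k\<in>J. SUP i\<in>I. f i k) = (SUP i\<in>I. \<Sum>k\<in>J. f i k)"
  using assms(2) dir
proof (induction J rule: finite_induct)
  case empty then show ?case using assms(1) by simp
next
  case (insert a J)
  have IH: "(\<Sum>k\<in>J. SUP i\<in>I. f i k) = (SUP i\<in>I. \<Sum>k\<in>J. f i k)"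
    by (rule insert.IH) (metis insert.prems insertI2)
  have "(SUP i\<in>I. f i a + (\<Sum>k\<in>J. f i k)) = (SUP i\<in>I. f i a) + (SUP i\<in>I. \<Sum>k\<in>J. f i k)"
  proof (rule SUP_add_directed_ennreal)
    fix i j assume "i \<in> I" "j \<in> I"
    then obtain h where h: "h \<in> I" "\<forall>k\<in>insert a J. f i k \<le> f h k \<and> f j k \<le> f h k"
      using insert.prems by blast
    then show "\<exists>k\<in>I. f i a + (\<Sum>k\<in>J. f j k) \<le> f k a + sum (f k) J"
      by (intro bexI[of _ h] add_mono sum_mono) auto
  qed
  then show ?case using insert IH by simp
qed

text \<open>Even for uncountable \<open>F\<close> the strict superlevel sets of the supremum are
  unions of open sets, so it is lower semicontinuous.\<close>

lemma borel_measurable_SUP_continuous: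
  fixes F :: "('a::topological_space \<Rightarrow> real) set"
  assumes "\<And>f. f \<in> F \<Longrightarrow> continuous_on UNIV f"
  shows "(\<lambda>x. SUP f\<in>F. ennreal (f x)) \<in> borel_measurable borel"
proof (rule borel_measurableI_greater)
  fix a :: ennreal
  have "{x \<in> space borel. a < (SUP f\<in>F. ennreal (f x))} = (\<Union>f\<in>F. {x. a < ennreal (f x)})"
    by (auto simp: less_SUP_iff)
  moreover have "open {x. a < ennreal (f x)}" if "f \<in> F" for f
    by (intro open_Collect_less continuous_intros assms that continuous_on_ennreal)
  ultimately show "{x \<in> space borel. a < (SUP f\<in>F. ennreal (f x))} \<in> sets borel"
    by (metis (mono_tags, lifting) borel_open open_UN)
qed

text \<open>Radon measures are \<open>\<tau>\<close>-additive: inner regularity on the open level sets of the supremum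
  replaces the countability that monotone convergence needs.\<close>

lemma radon_SUP_directed_levels:
  assumes r: "radon_measure m" and "F \<noteq> {}" and c: "\<And>f. f \<in> F \<Longrightarrow> continuous_on UNIV f"
    and dir: "\<And>f g. f \<in> F \<Longrightarrow> g \<in> F \<Longrightarrow> \<exists>h\<in>F. \<forall>x. f x \<le> h x \<and> g x \<le> (h x::real)"
  shows "emeasure m (\<Union>f\<in>F. {x. t < f x}) = (SUP f\<in>F. emeasure m {x. t < f x})"
proof (rule antisym)
  have op: "open {x. t < f x}" if "f \<in> F" for f
    by (intro open_Collect_less continuous_intros c that)
  then have opU: "open (\<Union>f\<in>F. {x. t < f x})" by blast
  show "emeasure m (\<Union>f\<in>F. {x. t < f x}) \<le> (SUP f\<in>F. emeasure m {x. t < f x})"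
    unfolding radon_inner_open[OF r opU]
  proof (rule SUP_least, clarify)
    fix C assume C: "compact C" "C \<subseteq> (\<Union>f\<in>F. {x. t < f x})"
    obtain G where G: "G \<subseteq> F" "finite G" "C \<subseteq> (\<Union>f\<in>G. {x. t < f x})"
      using compactE_image[OF C(1), of F "\<lambda>f. {x. t < f x}"] C(2) op by blast
    \<comment> \<open>Directedness replaces the finite subcover by the level set of a single member
      of \<open>F\<close>.\<close>
    have "\<exists>h\<in>F. \<forall>f\<in>G. \<forall>x. f x \<le> h x" using G(2,1)
    proof (induction G rule: finite_induct)
      case empty then show ?case using assms(2) by blast
    next
      case (insert f G)
      then obtain h where h: "h \<in> F" "\<forall>f\<in>G. \<forall>x. f x \<le> h x" by auto
      then obtain k where "k \<in> F" "\<forall>x. f x \<le> k x \<and> h x \<le> k x" using dir insert.prems by blast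
      then have "\<forall>f'\<in>insert f G. \<forall>x. f' x \<le> k x" using h(2) by (auto intro: order_trans)
      then show ?case using \<open>k \<in> F\<close> by blast
    qed
    then obtain h where h: "h \<in> F" "\<forall>f\<in>G. \<forall>x. f x \<le> h x" by blast
    have "C \<subseteq> {x. t < h x}"
    proof
      fix x assume "x \<in> C"
      then obtain f where "f \<in> G" "t < f x" using G(3) by blast
      then show "x \<in> {x. t < h x}" using h(2) by (auto intro: less_le_trans)
    qed
    then have "emeasure m C \<le> emeasure m {x. t < h x}"
      using op[OF h(1)] radon_sets[OF r] by (intro emeasure_mono) auto
    then show "emeasure m C \<le> (SUP f\<in>F. emeasure m {x. t < f x})"
      using h(1) by (metis SUP_upper2)
  qed
  show "(SUP f\<in>F. emeasure m {x. t < f x}) \<le> emeasure m (\<Union>f\<in>F. {x. t < f x})"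
    using radon_sets[OF r] opU by (intro SUP_least emeasure_mono) auto
qed

text \<open>The supremum is cut into horizontal layers, each an open level set to which
  \<open>radon_SUP_directed_levels\<close> applies. The common bound \<open>M\<close> keeps the
  number of layers finite, and the common compact \<open>D\<close> has finite measure, so the
  rounding error \<open>e * m D\<close> can be made small.\<close>

lemma nn_integral_SUP_directed:
  fixes m :: "'a::t2_space measure"
  assumes r: "radon_measure m" and ne: "F \<noteq> {}"
    and c: "\<And>f. f \<in> F \<Longrightarrow> continuous_on UNIV f"
    and dir: "\<And>f g. f \<in> F \<Longrightarrow> g \<in> F \<Longrightarrow> \<exists>h\<in>F. \<forall>x. f x \<le> h x \<and> g x \<le> (h x::real)"
    and bd: "\<And>f x. f \<in> F \<Longrightarrow> 0 \<le> f x" "\<And>f x. f \<in> F \<Longrightarrow> f x \<le> M"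
    and D: "compact D" "\<And>f x. f \<in> F \<Longrightarrow> f x \<noteq> 0 \<Longrightarrow> x \<in> D"
  shows "(\<integral>\<^sup>+x. (SUP f\<in>F. ennreal (f x)) \<partial>m) = (SUP f\<in>F. \<integral>\<^sup>+x. ennreal (f x) \<partial>m)"
proof (rule antisym)
  let ?S = "SUP f\<in>F. \<integral>\<^sup>+x. ennreal (f x) \<partial>m"
  have sm: "sets m = sets borel" using radon_sets[OF r] .
  have op: "open {x. t < f x}" if "f \<in> F" for f t
    by (intro open_Collect_less continuous_intros c that)
  have mD: "emeasure m D < \<infinity>" using radon_compact_finite[OF r D(1)] .
  have DD: "D \<in> sets m" using borel_compact[OF D(1)] sm by simp
  have key: "(\<integral>\<^sup>+x. (SUP f\<in>F. ennreal (f x)) \<partial>m) \<le> ennreal e * emeasure m D + ?S" if e: "0 < e" for e :: real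
  proof -
    obtain N :: nat where N: "M \<le> real N * e" using e by (metis reals_Archimedean3 less_imp_le)
    let ?O = "\<lambda>k. \<Union>f\<in>F. {x. real k * e < f x}"
    have opO: "open (?O k)" for k using op by blast
    \<comment> \<open>Off \<open>D\<close> every \<open>f\<close> vanishes. On \<open>D\<close> the
      layers of \<open>f\<close> miss at most \<open>e\<close>, and each level set of
      \<open>f\<close> lies in the corresponding level set of the whole family.\<close>
    have pw: "(SUP f\<in>F. ennreal (f x)) \<le> ennreal e * indicator D x + (\<Sum>k=1..N. ennreal e * indicator (?O k) x)" for x
    proof (rule SUP_least)
      fix f assume f: "f \<in> F"
      show "ennreal (f x) \<le> ennreal e * indicator D x + (\<Sum>k=1..N. ennreal e * indicator (?O k) x)"
      proof (cases "x \<in> D")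
        case False
        then have "f x = 0" using D(2) f by blast
        then show ?thesis by simp
      next
        case True
        have "f x \<le> e + (\<Sum>k=1..N. e * (if real k * e < f x then 1 else 0))"
          using layer_sum(2)[of "f x" e N] bd f e N by (smt (verit))
        also have "\<dots> \<le> e + (\<Sum>k=1..N. e * indicator (?O k) x)"
          using e f by (intro add_left_mono sum_mono) (auto simp: indicator_def)
        finally have "ennreal (f x) \<le> ennreal (e + (\<Sum>k=1..N. e * indicator (?O k) x))"
          by (rule ennreal_leI)
        also have "\<dots> = ennreal e + (\<Sum>k=1..N. ennreal (e * indicator (?O k) x))"
          using e by (subst ennreal_plus) (auto intro!: sum_nonneg simp: sum_ennreal)
        also have "\<dots> = ennreal e * indicator D x + (\<Sum>k=1..N. ennreal e * indicator (?O k) x)"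
          using e True by (auto simp: ennreal_mult' ennreal_indicator)
        finally show ?thesis .
      qed
    qed
    have "(\<integral>\<^sup>+x. (SUP f\<in>F. ennreal (f x)) \<partial>m) \<le>
        (\<integral>\<^sup>+x. ennreal e * indicator D x + (\<Sum>k=1..N. ennreal e * indicator (?O k) x) \<partial>m)"
      by (rule nn_integral_mono) (rule pw)
    also have "\<dots> = ennreal e * emeasure m D + (\<Sum>k=1..N. ennreal e * emeasure m (?O k))"
    proof -
      have O: "?O k \<in> sets m" for k using borel_open[OF opO] sm by metis
      have m1: "(\<lambda>x. ennreal e * indicator A x) \<in> borel_measurable m" if "A \<in> sets m" for A
        using that by measurable
      show ?thesis
        by (simp only: nn_integral_add[OF m1[OF DD] borel_measurable_sum[OF m1[OF O]]]
            nn_integral_sum[OF m1[OF O]] nn_integral_cmult_indicator DD O)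
    qed
    also have "(\<Sum>k=1..N. ennreal e * emeasure m (?O k)) =
        (\<Sum>k=1..N. SUP f\<in>F. ennreal e * emeasure m {x. real k * e < f x})"
      by (intro sum.cong refl) (simp add: radon_SUP_directed_levels[OF r ne c dir] SUP_mult_left_ennreal)
    also have "\<dots> = (SUP f\<in>F. \<Sum>k=1..N. ennreal e * emeasure m {x. real k * e < f x})"
    proof (rule SUP_sum_directed_ennreal[OF ne])
      fix f g assume fg: "f \<in> F" "g \<in> F"
      then obtain h where h: "h \<in> F" "\<forall>x. f x \<le> h x \<and> g x \<le> h x" using dir by blast
      have "emeasure m {x. t < f x} \<le> emeasure m {x. t < h x}" "emeasure m {x. t < g x} \<le> emeasure m {x. t < h x}" for t
        using h(2) op[OF h(1)] sm by (intro emeasure_mono; force intro: less_le_trans)+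
      then show "\<exists>h\<in>F. \<forall>k\<in>{1..N}. ennreal e * emeasure m {x. real k * e < f x} \<le> ennreal e * emeasure m {x. real k * e < h x} \<and>
          ennreal e * emeasure m {x. real k * e < g x} \<le> ennreal e * emeasure m {x. real k * e < h x}"
        using h(1) by (intro bexI[of _ h] ballI conjI mult_left_mono) auto
    qed auto
    also have "\<dots> \<le> ?S"
    proof (rule SUP_mono)
      fix f assume f: "f \<in> F"
      have "(\<Sum>k=1..N. ennreal e * emeasure m {x. real k * e < f x}) =
          (\<integral>\<^sup>+x. (\<Sum>k=1..N. ennreal e * indicator {x. real k * e < f x} x) \<partial>m)"
      proof -
        have O: "{x. t < f x} \<in> sets m" for t using borel_open[OF op[OF f]] sm by metis
        then have "(\<lambda>x. ennreal e * indicator {x. t < f x} x) \<in> borel_measurable m" for t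
          by measurable
        then show ?thesis by (simp only: nn_integral_sum nn_integral_cmult_indicator[OF O])
      qed
      also have "\<dots> \<le> (\<integral>\<^sup>+x. ennreal (f x) \<partial>m)"
      proof (rule nn_integral_mono)
        fix x
        have "(\<Sum>k=1..N. ennreal e * indicator {x. real k * e < f x} x) =
            ennreal (\<Sum>k=1..N. e * (if real k * e < f x then 1 else 0))"
          using e by (subst sum_ennreal[symmetric], simp) (intro sum.cong refl, simp add: indicator_def)
        also have "\<dots> \<le> ennreal (f x)"
          using layer_sum(1)[of "f x" e N] bd f e by (intro ennreal_leI) auto
        finally show "(\<Sum>k=1..N. ennreal e * indicator {x. real k * e < f x} x) \<le> ennreal (f x)" .
      qed
      finally show "\<exists>g\<in>F. (\<Sum>k=1..N. ennreal e * emeasure m {x. real k * e < f x}) \<le> (\<integral>\<^sup>+x. ennreal (g x) \<partial>m)"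
        using f by blast
    qed
    finally show ?thesis by (simp add: add_left_mono)
  qed
  show "(\<integral>\<^sup>+x. (SUP f\<in>F. ennreal (f x)) \<partial>m) \<le> ?S"
  proof (rule ennreal_le_epsilon)
    fix e :: real assume e: "0 < e"
    \<comment> \<open>Layers of height \<open>e / (d + 1)\<close> cost at most \<open>e\<close> in
      total; the \<open>+ 1\<close> covers \<open>d = 0\<close>.\<close>
    obtain d where d: "emeasure m D = ennreal d" "0 \<le> d" using mD by (cases "emeasure m D") auto
    have "(\<integral>\<^sup>+x. (SUP f\<in>F. ennreal (f x)) \<partial>m) \<le> ennreal (e / (d + 1)) * ennreal d + ?S"
      using key[of "e / (d + 1)"] e d by auto
    also have "ennreal (e / (d + 1)) * ennreal d \<le> ennreal e"
      using e d by (subst ennreal_mult'[symmetric]) (auto intro!: ennreal_leI simp: field_simps)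
    finally show "(\<integral>\<^sup>+x. (SUP f\<in>F. ennreal (f x)) \<partial>m) \<le> ?S + ennreal e"
      by (simp add: add.commute add_right_mono)
  qed
  show "?S \<le> (\<integral>\<^sup>+x. (SUP f\<in>F. ennreal (f x)) \<partial>m)"
  proof (rule SUP_least)
    fix f assume f: "f \<in> F"
    show "(\<integral>\<^sup>+x. ennreal (f x) \<partial>m) \<le> (\<integral>\<^sup>+x. (SUP f\<in>F. ennreal (f x)) \<partial>m)"
      by (rule nn_integral_mono) (rule SUP_upper[OF f])
  qed
qed

section \<open>Continuous functions with compact support\<close>

lemma Cc_continuous: "f \<in> Cc \<Longrightarrow> continuous_on UNIV f"
  by (simp add: Cc_def)

lemma Cc_borel_measurable: "f \<in> Cc \<Longrightarrow> f \<in> borel_measurable borel"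
  by (intro borel_measurable_continuous_onI Cc_continuous)

lemma Cc_compact_supp:
  assumes "f \<in> Cc"
  obtains D where "compact D" "\<And>x. f x \<noteq> 0 \<Longrightarrow> x \<in> D"
  using assms that[of "closure {x. f x \<noteq> 0}"] closure_subset[of "{x. f x \<noteq> 0}"]
  by (auto simp: Cc_def)

lemma CcI:
  fixes f :: "'a::t2_space \<Rightarrow> complex"
  assumes "continuous_on UNIV f" "compact D" "\<And>x. f x \<noteq> 0 \<Longrightarrow> x \<in> D"
  shows "f \<in> Cc"
proof -
  have "{x. f x \<noteq> 0} \<subseteq> D" using assms(3) by auto
  then show ?thesis using assms(1) compact_closure_subset[OF assms(2)] by (simp add: Cc_def)
qed

lemma Cc_realI:
  fixes f :: "'a::t2_space \<Rightarrow> real"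
  assumes "continuous_on UNIV f" "compact D" "\<And>x. f x \<noteq> 0 \<Longrightarrow> x \<in> D"
  shows "f \<in> Cc_real"
proof -
  have "{x. f x \<noteq> 0} \<subseteq> D" using assms(3) by auto
  then show ?thesis using assms(1) compact_closure_subset[OF assms(2)] by (simp add: Cc_real_def)
qed

lemma Cc_of_real: "f \<in> Cc_real \<Longrightarrow> (\<lambda>x. complex_of_real (f x)) \<in> Cc"
  by (auto simp: Cc_def Cc_real_def intro!: continuous_intros)

lemma Cc_of_real_iff: "(\<lambda>x. complex_of_real (f x)) \<in> Cc \<longleftrightarrow> f \<in> Cc_real"
proof
  assume "(\<lambda>x. complex_of_real (f x)) \<in> Cc"
  then have "continuous_on UNIV (\<lambda>x. Re (complex_of_real (f x)))" "compact (closure {x. f x \<noteq> 0})"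
    by (auto simp: Cc_def simp del: Re_complex_of_real intro!: continuous_on_Re)
  then show "f \<in> Cc_real" by (simp add: Cc_real_def)
qed (rule Cc_of_real)

lemma Cc_bounded:
  fixes f :: "'a::t2_space \<Rightarrow> complex"
  assumes "f \<in> Cc"
  obtains B where "0 \<le> B" "\<And>x. norm (f x) \<le> B"
proof -
  obtain D where D: "compact D" "\<And>x. f x \<noteq> 0 \<Longrightarrow> x \<in> D" by (rule Cc_compact_supp[OF assms]) blast
  have "compact (f ` D)"
    using D(1) Cc_continuous[OF assms] by (meson compact_continuous_image continuous_on_subset subset_UNIV)
  then obtain B where B: "0 < B" "\<And>y. y \<in> f ` D \<Longrightarrow> norm y \<le> B"
    using compact_imp_bounded bounded_pos by metis
  have "norm (f x) \<le> B" for x using B D(2)[of x] by (cases "f x = 0") auto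
  then show thesis using that[of B] B(1) by simp
qed

lemma Cc_mult_continuous:
  fixes f g :: "'a::t2_space \<Rightarrow> complex"
  assumes "f \<in> Cc" "continuous_on UNIV g"
  shows "(\<lambda>x. g x * f x) \<in> Cc"
proof -
  obtain D where D: "compact D" "\<And>x. f x \<noteq> 0 \<Longrightarrow> x \<in> D" by (rule Cc_compact_supp[OF assms(1)]) blast
  then show ?thesis
    using assms Cc_continuous by (intro CcI[of _ D]) (auto intro!: continuous_intros)
qed

lemma Cc_add:
  fixes f g :: "'a::t2_space \<Rightarrow> complex"
  assumes "f \<in> Cc" "g \<in> Cc"
  shows "(\<lambda>x. f x + g x) \<in> Cc"
proof -
  obtain D where D: "compact D" "\<And>x. f x \<noteq> 0 \<Longrightarrow> x \<in> D" by (rule Cc_compact_supp[OF assms(1)]) blast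
  obtain E where E: "compact E" "\<And>x. g x \<noteq> 0 \<Longrightarrow> x \<in> E" by (rule Cc_compact_supp[OF assms(2)]) blast
  have "x \<in> D \<union> E" if "f x + g x \<noteq> 0" for x using that D(2)[of x] E(2)[of x] by fastforce
  then show ?thesis
    using assms Cc_continuous compact_Un[OF D(1) E(1)]
    by (intro CcI[of _ "D \<union> E"]) (auto intro!: continuous_intros)
qed

lemma Cc_cmult:
  fixes f :: "'a::t2_space \<Rightarrow> complex"
  shows "f \<in> Cc \<Longrightarrow> (\<lambda>x. c * f x) \<in> Cc"
  by (rule Cc_mult_continuous) simp_all

lemma Cc_diff:
  fixes f g :: "'a::t2_space \<Rightarrow> complex"
  assumes "f \<in> Cc" "g \<in> Cc"
  shows "(\<lambda>x. f x - g x) \<in> Cc"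
  using Cc_add[OF assms(1) Cc_cmult[OF assms(2), of "-1"]] by simp

lemma integrable_bounded_borel:
  fixes f :: "'a::topological_space \<Rightarrow> complex"
  assumes "finite_measure \<mu>" "sets \<mu> = sets borel" "f \<in> borel_measurable borel" "\<And>x. norm (f x) \<le> B"
  shows "integrable \<mu> f"
proof -
  interpret finite_measure \<mu> by fact
  show ?thesis using assms(2-)
    by (intro integrable_const_bound[of _ B]) (auto simp: measurable_def sets_eq_imp_space_eq[OF assms(2)])
qed

text \<open>The set where \<open>g\<close> is positive is an open neighbourhood of a support point,
  so it is not null.\<close>

lemma integral_continuous_pos:
  fixes g :: "'a::t2_space \<Rightarrow> real"
  assumes "continuous_on UNIV g" "\<And>x. 0 \<le> g x" "integrable \<mu> g" "sets \<mu> = sets borel"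
    and "0 < g t" "t \<in> msupp \<mu>"
  shows "0 < (LINT x|\<mu>. g x)"
proof -
  have op: "open {x. 0 < g x}" by (intro open_Collect_less continuous_intros assms)
  have "(LINT x|\<mu>. g x) \<noteq> 0"
  proof
    assume "(LINT x|\<mu>. g x) = 0"
    then have "AE x in \<mu>. g x = 0" using integral_nonneg_eq_0_iff_AE assms by blast
    moreover have "{x. 0 < g x} \<in> sets \<mu>" using op assms(4) by simp
    moreover have "AE x in \<mu>. x \<notin> {x. 0 < g x}" using calculation(1) by eventually_elim simp
    ultimately have "emeasure \<mu> {x. 0 < g x} = 0"
      using AE_iff_null_sets[of "{x. 0 < g x}" \<mu>] by (simp add: null_setsD1)
    then show False using assms(5,6) op by (auto simp: msupp_def)
  qed
  then show ?thesis using integral_nonneg_AE[of g \<mu>] assms(2) by (simp add: less_le)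
qed

section \<open>Supports of convolutions and the identity element\<close>

context hypergroup
begin

lemma sets_conv: "sets (\<omega> x y) = sets borel"
  using radon_sets[OF conv_radon] .

lemma space_conv: "space (\<omega> x y) = UNIV"
  using radon_space[OF conv_radon] .

lemma finite_conv: "finite_measure (\<omega> x y)"
  using conv_prob prob_space_def by blast

lemma integrable_conv:
  fixes f :: "'a \<Rightarrow> complex"
  assumes "f \<in> borel_measurable borel" "\<And>x. norm (f x) \<le> B"
  shows "integrable (\<omega> x y) f"
  using integrable_bounded_borel[OF finite_conv sets_conv assms] .

lemma integrable_conv_Cc: "f \<in> Cc \<Longrightarrow> integrable (\<omega> x y) f"
  using integrable_conv Cc_borel_measurable Cc_bounded by metis

lemma AE_conv_msupp: "AE t in \<omega> x y. t \<in> msupp (\<omega> x y)"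
  using radon_AE_msupp[OF conv_radon] .

text \<open>A Radon measure is carried by its support. This turns a nonvanishing integral into a
  relation between supports, from which the support of a translate is located.\<close>

lemma conv_integral_nonzero:
  fixes f :: "'a \<Rightarrow> 'b::{banach, second_countable_topology}"
  assumes "(LINT t|\<omega> x y. f t) \<noteq> 0"
  shows "\<exists>t\<in>msupp (\<omega> x y). f t \<noteq> 0"
proof (rule ccontr)
  assume "\<not> ?thesis"
  then have "AE t in \<omega> x y. f t = 0" using AE_conv_msupp[of x y] by (auto elim!: eventually_mono)
  then show False using integral_eq_zero_AE assms by blast
qed

lemma msupp_conv_nonempty: "msupp (\<omega> x y) \<noteq> {}"
proof
  assume "msupp (\<omega> x y) = {}"
  then have "AE t in \<omega> x y. False" using AE_conv_msupp[of x y] by simp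
  then show False using prob_space.AE_False[OF conv_prob] by blast
qed

lemma norm_conv_diff_le:
  fixes f g :: "'a \<Rightarrow> complex"
  assumes "integrable (\<omega> x y) f" "integrable (\<omega> x y) g"
    and "\<And>t. t \<in> msupp (\<omega> x y) \<Longrightarrow> norm (f t - g t) \<le> c"
  shows "norm ((LINT t|\<omega> x y. f t) - (LINT t|\<omega> x y. g t)) \<le> c"
proof -
  interpret prob_space "\<omega> x y" by (rule conv_prob)
  have "norm ((LINT t|\<omega> x y. f t) - (LINT t|\<omega> x y. g t)) = norm (LINT t|\<omega> x y. f t - g t)"
    using assms by simp
  also have "\<dots> \<le> (LINT t|\<omega> x y. norm (f t - g t))" by (rule integral_norm_bound)
  also have "\<dots> \<le> (LINT t|\<omega> x y. c)"
    using AE_conv_msupp[of x y] assms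
    by (intro integral_mono_AE integrable_norm Bochner_Integration.integrable_diff) (auto elim!: eventually_mono)
  finally show ?thesis by (simp add: prob_space)
qed

lemma norm_conv_le:
  fixes f :: "'a \<Rightarrow> complex"
  assumes "integrable (\<omega> x y) f" "\<And>t. t \<in> msupp (\<omega> x y) \<Longrightarrow> norm (f t) \<le> c"
  shows "norm (LINT t|\<omega> x y. f t) \<le> c"
  using norm_conv_diff_le[OF assms(1), of "\<lambda>_. 0" c] assms(2) by simp

text \<open>This is upper semicontinuity of the support map: the Michael subbasic set with
  \<open>U = UNIV\<close> imposes only \<open>C \<subseteq> V\<close>.\<close>

lemma msupp_conv_upper:
  assumes "open V" "msupp (\<omega> x y) \<subseteq> V"
  obtains M N where "open M" "open N" "x \<in> M" "y \<in> N"
    "\<And>x' y'. x' \<in> M \<Longrightarrow> y' \<in> N \<Longrightarrow> msupp (\<omega> x' y') \<subseteq> V"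
proof -
  let ?W = "{C. compact C \<and> C \<noteq> {} \<and> C \<inter> UNIV \<noteq> {} \<and> C \<subseteq> V}"
  have "openin michael_topology ?W"
    unfolding michael_topology_def using assms(1) open_UNIV
    by (intro topology_generated_by_Basis) blast
  then have "openin euclidean {p \<in> topspace euclidean. (case p of (x, y) \<Rightarrow> msupp (\<omega> x y)) \<in> ?W}"
    using supp_continuous unfolding continuous_map_def by blast
  moreover have "{p \<in> topspace euclidean. (case p of (x, y) \<Rightarrow> msupp (\<omega> x y)) \<in> ?W} =
      {p. msupp (\<omega> (fst p) (snd p)) \<subseteq> V}"
    using supp_compact msupp_conv_nonempty by (auto simp: split_beta)
  ultimately have "open {p. msupp (\<omega> (fst p) (snd p)) \<subseteq> V}" by (metis open_openin)
  moreover have "(x, y) \<in> {p. msupp (\<omega> (fst p) (snd p)) \<subseteq> V}" using assms(2) by simp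
  ultimately obtain M N where "open M" "open N" "(x, y) \<in> M \<times> N" "M \<times> N \<subseteq> {p. msupp (\<omega> (fst p) (snd p)) \<subseteq> V}"
    by (rule open_prod_elim)
  then show thesis by (intro that[of M N]) force+
qed

text \<open>Upper semicontinuity does the work: a finite subcover of the support at \<open>p\<close>
  still covers the supports at all pairs near \<open>p\<close>, and finitely many such
  neighbourhoods cover \<open>P\<close>.\<close>

lemma compact_Union_msupp:
  assumes "compact P"
  shows "compact (\<Union>p\<in>P. msupp (\<omega> (fst p) (snd p)))"
  unfolding compact_eq_Heine_Borel
proof (intro allI impI, elim conjE)
  fix \<C> assume C: "\<forall>B\<in>\<C>. open B" "(\<Union>p\<in>P. msupp (\<omega> (fst p) (snd p))) \<subseteq> \<Union>\<C>"
  have "\<exists>W F. open W \<and> p \<in> W \<and> F \<subseteq> \<C> \<and> finite F \<and> (\<forall>q\<in>W. msupp (\<omega> (fst q) (snd q)) \<subseteq> \<Union>F)" if p: "p \<in> P" for p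
  proof -
    obtain F where F: "F \<subseteq> \<C>" "finite F" "msupp (\<omega> (fst p) (snd p)) \<subseteq> \<Union>F"
    proof (rule compactE[OF supp_compact, of "fst p" "snd p" \<C>])
      show "msupp (\<omega> (fst p) (snd p)) \<subseteq> \<Union>\<C>" using C(2) p by blast
    qed (use C(1) in blast)+
    have "open (\<Union>F)" using F(1) C(1) by blast
    then obtain M N where "open M" "open N" "fst p \<in> M" "snd p \<in> N"
      "\<And>x' y'. x' \<in> M \<Longrightarrow> y' \<in> N \<Longrightarrow> msupp (\<omega> x' y') \<subseteq> \<Union>F"
      by (rule msupp_conv_upper[OF _ F(3)]) blast+
    then show ?thesis using F(1,2)
      by (intro exI[of _ "M \<times> N"] exI[of _ F]) (auto simp: open_Times mem_Times_iff)
  qed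
  then obtain W F where WF: "\<And>p. p \<in> P \<Longrightarrow> open (W p) \<and> p \<in> W p \<and> F p \<subseteq> \<C> \<and> finite (F p) \<and>
      (\<forall>q\<in>W p. msupp (\<omega> (fst q) (snd q)) \<subseteq> \<Union>(F p))" by metis
  obtain Q where Q: "Q \<subseteq> P" "finite Q" "P \<subseteq> (\<Union>p\<in>Q. W p)"
    using compactE_image[OF assms, of P W] WF by blast
  show "\<exists>D\<subseteq>\<C>. finite D \<and> (\<Union>p\<in>P. msupp (\<omega> (fst p) (snd p))) \<subseteq> \<Union>D"
  proof (intro exI conjI)
    show "(\<Union>p\<in>Q. F p) \<subseteq> \<C>" using Q(1) WF by blast
    show "finite (\<Union>p\<in>Q. F p)" using Q(1,2) WF by blast
    show "(\<Union>p\<in>P. msupp (\<omega> (fst p) (snd p))) \<subseteq> \<Union>(\<Union>p\<in>Q. F p)"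
    proof
      fix t assume "t \<in> (\<Union>p\<in>P. msupp (\<omega> (fst p) (snd p)))"
      then obtain p where p: "p \<in> P" "t \<in> msupp (\<omega> (fst p) (snd p))" by blast
      then obtain q where "q \<in> Q" "p \<in> W q" using Q by blast
      then have "t \<in> \<Union>(F q)" using WF p Q(1) by blast
      then show "t \<in> \<Union>(\<Union>p\<in>Q. F p)" using \<open>q \<in> Q\<close> by blast
    qed
  qed
qed

definition unit :: 'a where
  "unit = (SOME e. (\<forall>x. \<omega> e x = return borel x \<and> \<omega> x e = return borel x) \<and>
           (\<forall>x y. e \<in> msupp (\<omega> x (invol y)) \<longleftrightarrow> x = y))"

lemma unit_right: "\<omega> x unit = return borel x"
  and unit_mem_msupp: "unit \<in> msupp (\<omega> x (invol y)) \<longleftrightarrow> x = y"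
  using someI_ex[OF identity] unfolding unit_def[symmetric] by auto

lemma msupp_unit: "msupp (\<omega> x unit) = {x}"
proof -
  have "t \<notin> msupp (\<omega> x unit)" if "t \<noteq> x" for t
  proof -
    have "emeasure (\<omega> x unit) (- {x}) = 0" by (simp add: unit_right borel_open)
    then show ?thesis using that by (auto simp: msupp_def intro!: exI[of _ "- {x}"])
  qed
  then have "msupp (\<omega> x unit) \<subseteq> {x}" by auto
  then show ?thesis using msupp_conv_nonempty[of x unit] by (metis subset_singletonD)
qed

lemma invol_unit: "invol unit = unit"
proof -
  \<comment> \<open>The left factor and the twice reflected unit convolve to a point mass at
    \<open>unit\<close>. The support axiom with \<open>x = unit\<close> and
    \<open>y = invol unit\<close> then identifies the two.\<close>
  have "unit \<in> msupp (\<omega> unit (invol (invol unit)))"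
    by (simp add: invol_invol msupp_unit)
  then show ?thesis using unit_mem_msupp by simp
qed

lemma msupp_invol:
  assumes "s \<in> msupp (\<omega> x y)"
  shows "invol s \<in> msupp (\<omega> (invol y) (invol x))"
  unfolding msupp_def
proof (intro CollectI allI impI)
  fix U assume U: "open U \<and> invol s \<in> U"
  have op: "open (invol -` U)" using U invol_continuous by (simp add: open_vimage)
  have m: "invol \<in> measurable (\<omega> x y) borel"
    using borel_measurable_continuous_onI[OF invol_continuous] sets_conv by (simp cong: measurable_cong_sets)
  have "emeasure (\<omega> (invol y) (invol x)) U = emeasure (\<omega> x y) (invol -` U)"
    using U by (subst invol_conv[symmetric], subst emeasure_distr[OF m]) (auto simp: space_conv)
  then show "emeasure (\<omega> (invol y) (invol x)) U \<noteq> 0"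
    using assms op U by (auto simp: msupp_def)
qed

lemma continuous_conv_Cc:
  assumes "f \<in> Cc" "continuous_on S a" "continuous_on S b"
  shows "continuous_on S (\<lambda>z. LINT t|\<omega> (a z) (b z). f t)"
  using continuous_on_compose2[OF conv_continuous[OF assms(1)] continuous_on_Pair[OF assms(2,3)]] by simp

lemma continuous_conv_Cc_real:
  fixes f :: "'a \<Rightarrow> real"
  assumes "f \<in> Cc_real" "continuous_on S a" "continuous_on S b"
  shows "continuous_on S (\<lambda>z. LINT t|\<omega> (a z) (b z). f t)"
  using continuous_on_Re[OF continuous_conv_Cc[OF Cc_of_real[OF assms(1)] assms(2,3)]] by simp

lemma integrable_conv_Cc_real: "f \<in> Cc_real \<Longrightarrow> integrable (\<omega> x y) f"
  using integrable_Re[OF integrable_conv_Cc[OF Cc_of_real]] by simp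

text \<open>Both sides say that the unit lies in the support of \<open>\<epsilon>\<^sub>x * \<epsilon>\<^sub>y * \<epsilon>\<close> at \<open>invol t\<close>, bracketed
  in the two possible ways.\<close>

lemma msupp_swap:
  assumes t: "t \<in> msupp (\<omega> x y)"
  shows "x \<in> msupp (\<omega> t (invol y))"
proof (rule ccontr)
  assume x: "x \<notin> msupp (\<omega> t (invol y))"
  let ?P = "{x} \<times> msupp (\<omega> y (invol t))"
  \<comment> \<open>All points that the bracketing of x with the product of y and
    \<open>invol t\<close> can reach.\<close>
  let ?A = "\<Union>p\<in>?P. msupp (\<omega> (fst p) (snd p))"
  have cA: "compact ?A" by (intro compact_Union_msupp compact_Times supp_compact) simp
  \<comment> \<open>The unit lies in the support of \<open>\<omega> x s\<close> only if
    \<open>s\<close> is the reflection of \<open>x\<close>; reflecting \<open>s\<close> back would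
    put \<open>x\<close> into the support of \<open>\<omega> t (invol t')\<close> with
    \<open>t' = invol (invol y)\<close>, that is, into the set excluded by assumption once double
    reflections are cancelled.\<close>
  have "unit \<notin> msupp (\<omega> x s)" if s: "s \<in> msupp (\<omega> y (invol t))" for s
  proof
    assume "unit \<in> msupp (\<omega> x s)"
    then have "invol s = x" using unit_mem_msupp[of x "invol s"] by (simp add: invol_invol)
    then show False using msupp_invol[OF s] x by (simp add: invol_invol)
  qed
  then have u: "{unit} \<subseteq> - ?A" by auto
  obtain f where f: "f \<in> Cc_real" "\<And>x. 0 \<le> f x" "\<And>x. f x \<le> 1" "\<And>x. x \<in> {unit} \<Longrightarrow> f x = 1"
      "\<And>x. f x \<noteq> 0 \<Longrightarrow> x \<in> - ?A"
    by (rule Urysohn_Cc[OF locally_compact compact_sing[of unit] _ u]) (use cA compact_imp_closed in blast)+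
  let ?F = "\<lambda>x. complex_of_real (f x)"
  let ?g = "\<lambda>s. LINT r|\<omega> s (invol t). f r"
  have cg: "continuous_on UNIV ?g" by (intro continuous_conv_Cc_real f(1) continuous_intros)
  have g0: "0 \<le> ?g s" for s using f(2) by (simp add: integral_nonneg_AE)
  have g1: "norm (?g s) \<le> 1" for s
    using norm_conv_le[OF integrable_conv_Cc[OF Cc_of_real[OF f(1)]], of s "invol t" 1] f(2,3) by simp
  have ig: "integrable (\<omega> x y) ?g"
    using integrable_Re[OF integrable_conv[of "\<lambda>s. complex_of_real (?g s)" 1 x y]] g1 cg
    by (simp add: borel_measurable_continuous_onI continuous_on_of_real)
  have "0 < f unit" using f(4) by simp
  \<comment> \<open>The support axiom puts \<open>unit\<close> into the support of
    \<open>\<omega> t (invol t)\<close>, and \<open>f\<close> is positive there. As \<open>t\<close>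
    itself is a support point of \<open>\<omega> x y\<close>, the outer integral is positive
    too.\<close>
  then have "0 < ?g t"
    using f(1,2) by (intro integral_continuous_pos[of f _ unit])
      (auto simp: Cc_real_def sets_conv integrable_conv_Cc_real unit_mem_msupp)
  then have pos: "0 < (LINT s|\<omega> x y. ?g s)"
    by (intro integral_continuous_pos[OF cg g0 ig sets_conv _ t])
  have "(LINT s|\<omega> y (invol t). LINT r|\<omega> x s. ?F r) = 0"
  proof (rule ccontr)
    assume "\<not> ?thesis"
    then obtain s where s: "s \<in> msupp (\<omega> y (invol t))" "(LINT r|\<omega> x s. ?F r) \<noteq> 0"
      using conv_integral_nonzero by blast
    then obtain r where "r \<in> msupp (\<omega> x s)" "?F r \<noteq> 0" using conv_integral_nonzero by blast
    then show False using f(5)[of r] s(1) by force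
  qed
  moreover have "(LINT s|\<omega> x y. LINT r|\<omega> s (invol t). ?F r) = complex_of_real (LINT s|\<omega> x y. ?g s)"
    by simp
  ultimately show False using conv_assoc[OF Cc_of_real[OF f(1)], of y "invol t" x] pos by simp
qed

end

context commutative_hypergroup
begin

text \<open>Both directions are \<open>msupp_swap\<close> after exchanging the factors; reflecting
  twice restores \<open>y\<close>.\<close>

lemma msupp_swap_left: "t \<in> msupp (\<omega> (invol y) z) \<longleftrightarrow> z \<in> msupp (\<omega> y t)"
  by (metis conv_commute invol_invol msupp_swap)

lemma translate_supp_compact:
  assumes "compact A" "compact D"
  obtains E where "compact E"
    "\<And>x y f. x \<in> A \<Longrightarrow> (\<And>t. f t \<noteq> 0 \<Longrightarrow> t \<in> D) \<Longrightarrow> translate \<omega> x f y \<noteq> 0 \<Longrightarrow> y \<in> E"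
proof -
  let ?P = "invol ` A \<times> D"
  let ?E = "\<Union>p\<in>?P. msupp (\<omega> (fst p) (snd p))"
  have "compact (invol ` A)"
    using assms(1) invol_continuous by (meson compact_continuous_image continuous_on_subset subset_UNIV)
  then have "compact ?E" by (intro compact_Union_msupp compact_Times assms)
  moreover have "y \<in> ?E" if xy: "x \<in> A" "\<And>t. f t \<noteq> 0 \<Longrightarrow> t \<in> D" "translate \<omega> x f y \<noteq> 0" for x y f
  proof -
    obtain t where t: "t \<in> msupp (\<omega> x y)" "f t \<noteq> 0"
      using xy(3) conv_integral_nonzero unfolding translate_def by blast
    then have "y \<in> msupp (\<omega> (invol x) t)"
      using msupp_swap_left[of t "invol x" y] by (simp add: invol_invol)
    then show ?thesis using xy(1,2) t by force
  qed
  ultimately show thesis using that by blast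
qed

lemma continuous_translate: "f \<in> Cc \<Longrightarrow> continuous_on UNIV (translate \<omega> x f)"
  unfolding translate_def by (intro continuous_conv_Cc continuous_intros)

lemma translate_Cc:
  assumes f: "f \<in> Cc"
  shows "translate \<omega> x f \<in> Cc"
proof -
  obtain D where D: "compact D" "\<And>x. f x \<noteq> 0 \<Longrightarrow> x \<in> D" by (rule Cc_compact_supp[OF f]) blast
  obtain E where "compact E"
    "\<And>x' y f. x' \<in> {x} \<Longrightarrow> (\<And>t. f t \<noteq> 0 \<Longrightarrow> t \<in> D) \<Longrightarrow> translate \<omega> x' f y \<noteq> 0 \<Longrightarrow> y \<in> E"
    by (rule translate_supp_compact[OF compact_sing[of x] D(1)]) blast
  then show ?thesis using continuous_translate[OF f] D(2) by (intro CcI[of _ E]) auto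
qed

end

section \<open>A Fubini theorem on compact rectangles\<close>

lemma continuous_on_UNIV_metricI:
  fixes f :: "'a::topological_space \<Rightarrow> 'b::metric_space"
  assumes "\<And>x e. 0 < e \<Longrightarrow> \<exists>N. open N \<and> x \<in> N \<and> (\<forall>y\<in>N. dist (f y) (f x) \<le> e)"
  shows "continuous_on UNIV f"
  unfolding continuous_on_def
proof (intro ballI tendstoI)
  fix x and e :: real assume "0 < e"
  then obtain N where N: "open N" "x \<in> N" "\<forall>y\<in>N. dist (f y) (f x) \<le> e / 2"
    using assms[of "e / 2" x] by auto
  then have "\<forall>y\<in>N. dist (f y) (f x) < e" using \<open>0 < e\<close> by fastforce
  then show "\<forall>\<^sub>F y in at x. dist (f y) (f x) < e"
    unfolding eventually_at_topological using N(1,2) by blast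
qed

text \<open>Finitely many tubes cover \<open>A\<close>, and on each of them \<open>F\<close> is
  uniformly close to one slice \<open>F q\<close>, a function of the second variable alone. Gluing
  the slices gives product measurable functions converging uniformly to \<open>F\<close>.\<close>

lemma borel_measurable_pair_uniform_approx:
  fixes F :: "'a::topological_space \<Rightarrow> 'b::topological_space \<Rightarrow> complex"
  assumes A: "compact A" "A \<in> sets borel" and z: "\<And>y z. y \<notin> A \<Longrightarrow> F y z = 0"
    and m: "\<And>y. F y \<in> borel_measurable borel"
    and tube: "\<And>y e. y \<in> A \<Longrightarrow> 0 < e \<Longrightarrow>
      \<exists>N. open N \<and> y \<in> N \<and> (\<forall>y'\<in>N \<inter> A. \<forall>z. norm (F y' z - F y z) \<le> e)"
  shows "(\<lambda>p. F (fst p) (snd p)) \<in> borel_measurable (borel \<Otimes>\<^sub>M borel)"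
proof -
  have approx: "\<exists>G \<in> borel_measurable (borel \<Otimes>\<^sub>M borel). \<forall>p. norm (G p - F (fst p) (snd p)) \<le> e"
    if e: "0 < e" for e :: real
  proof -
    obtain N where N: "\<And>y. y \<in> A \<Longrightarrow> open (N y) \<and> y \<in> N y \<and> (\<forall>y'\<in>N y \<inter> A. \<forall>z. norm (F y' z - F y z) \<le> e)"
      using tube[OF _ e] by metis
    obtain Q where Q: "Q \<subseteq> A" "finite Q" "A \<subseteq> (\<Union>y\<in>Q. N y)"
      using compactE_image[OF A(1), of A N] N by blast
    have "\<exists>G \<in> borel_measurable (borel \<Otimes>\<^sub>M borel).
        \<forall>p. fst p \<in> A \<inter> (\<Union>y\<in>Q. N y) \<longrightarrow> norm (G p - F (fst p) (snd p)) \<le> e"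
      using Q(2,1)
    proof (induction Q rule: finite_induct)
      case empty
      then show ?case by (intro bexI[of _ "\<lambda>_. 0"]) auto
    next
      case (insert q Q)
      then obtain G where G[measurable]: "G \<in> borel_measurable (borel \<Otimes>\<^sub>M borel)"
        and G2: "\<forall>p. fst p \<in> A \<inter> (\<Union>y\<in>Q. N y) \<longrightarrow> norm (G p - F (fst p) (snd p)) \<le> e" by auto
      have q: "q \<in> A" using insert.prems by blast
      have [measurable]: "F q \<in> borel_measurable borel" by (rule m)
      have [measurable]: "N q \<in> sets borel" using N[OF q] borel_open by simp
      \<comment> \<open>Where tubes overlap the newest slice is used; every slice whose tube
        contains \<open>fst p\<close> is within \<open>e\<close>.\<close>
      let ?G = "\<lambda>p. if fst p \<in> N q then F q (snd p) else G p"
      have "?G \<in> borel_measurable (borel \<Otimes>\<^sub>M borel)" by measurable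
      moreover have "norm (?G p - F (fst p) (snd p)) \<le> e" if "fst p \<in> A \<inter> (\<Union>y\<in>insert q Q. N y)" for p
      proof (cases "fst p \<in> N q")
        case True
        then have "norm (F (fst p) (snd p) - F q (snd p)) \<le> e" using that N[OF q] by blast
        then show ?thesis using True by (simp add: norm_minus_commute)
      next
        case False
        then have "fst p \<in> A \<inter> (\<Union>y\<in>Q. N y)" using that by auto
        then have "norm (G p - F (fst p) (snd p)) \<le> e" by (rule G2[rule_format])
        then show ?thesis using False by simp
      qed
      ultimately show ?case by (intro bexI[of _ ?G] allI impI) fast+
    qed
    then obtain G where G[measurable]: "G \<in> borel_measurable (borel \<Otimes>\<^sub>M borel)"
      and G2: "\<And>p. fst p \<in> A \<Longrightarrow> norm (G p - F (fst p) (snd p)) \<le> e" using Q(3) by blast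
    let ?G = "\<lambda>p. if fst p \<in> A then G p else 0"
    have [measurable]: "A \<in> sets borel" by (rule A(2))
    have "?G \<in> borel_measurable (borel \<Otimes>\<^sub>M borel)" by measurable
    moreover have "norm (?G p - F (fst p) (snd p)) \<le> e" for p using G2[of p] z e by auto
    ultimately show ?thesis by (intro bexI[of _ ?G] allI) fast+
  qed
  obtain G where G: "\<And>n. G n \<in> borel_measurable (borel \<Otimes>\<^sub>M borel)"
      "\<And>n p. norm (G n p - F (fst p) (snd p)) \<le> inverse (real (Suc n))"
  proof -
    have "\<forall>n. \<exists>G \<in> borel_measurable (borel \<Otimes>\<^sub>M borel). \<forall>p. norm (G p - F (fst p) (snd p)) \<le> inverse (real (Suc n))"
      using approx by simp
    from choice[OF this[unfolded Bex_def]] show thesis using that by blast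
  qed
  show ?thesis
  proof (rule borel_measurable_LIMSEQ_metric[OF G(1)])
    fix p
    show "(\<lambda>n. G n p) \<longlonglongrightarrow> F (fst p) (snd p)"
      by (rule LIM_zero_cancel, rule tendsto_0_le[OF LIMSEQ_inverse_real_of_nat, where K=1])
        (use G(2) in \<open>auto simp del: of_nat_Suc\<close>)
  qed
qed

text \<open>Continuous functions on a product need not be measurable for the product of the Borel
  \<open>\<sigma>\<close>-algebras, and the measures need not be \<open>\<sigma>\<close>-finite; hence the restriction to
  compact rectangles.\<close>

lemma Fubini_compact:
  fixes F :: "'a::topological_space \<Rightarrow> 'b::topological_space \<Rightarrow> complex"
  assumes s: "sets \<mu> = sets borel" "sets \<nu> = sets borel"
    and A: "compact A" "A \<in> sets borel" "emeasure \<mu> A < \<infinity>" and B: "B \<in> sets borel" "emeasure \<nu> B < \<infinity>"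
    and zA: "\<And>y z. y \<notin> A \<Longrightarrow> F y z = 0" and zB: "\<And>y z. z \<notin> B \<Longrightarrow> F y z = 0"
    and bd: "\<And>y z. norm (F y z) \<le> M"
    and m: "\<And>y. F y \<in> borel_measurable borel"
    and tube: "\<And>y e. y \<in> A \<Longrightarrow> 0 < e \<Longrightarrow>
      \<exists>N. open N \<and> y \<in> N \<and> (\<forall>y'\<in>N \<inter> A. \<forall>z. norm (F y' z - F y z) \<le> e)"
  shows "(LINT y|\<mu>. LINT z|\<nu>. F y z) = (LINT z|\<nu>. LINT y|\<mu>. F y z)"
proof -
  \<comment> \<open>The restricted measures are finite, so the classical theorem applies; the
    integrals are unchanged because \<open>F\<close> vanishes off \<open>A\<close> and
    \<open>B\<close>.\<close>
  let ?\<mu> = "restrict_space \<mu> A" and ?\<nu> = "restrict_space \<nu> B"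
  have sp: "space \<mu> = UNIV" "space \<nu> = UNIV" using sets_eq_imp_space_eq[OF s(1)] sets_eq_imp_space_eq[OF s(2)] by auto
  have AB: "A \<in> sets \<mu>" "B \<in> sets \<nu>" using A B s by auto
  interpret a: finite_measure ?\<mu>
    by (rule finite_measureI) (use A AB sp in \<open>auto simp: emeasure_restrict_space space_restrict_space\<close>)
  interpret b: finite_measure ?\<nu>
    by (rule finite_measureI) (use B AB sp in \<open>auto simp: emeasure_restrict_space space_restrict_space\<close>)
  interpret ab: pair_sigma_finite ?\<mu> ?\<nu> ..
  interpret p: finite_measure "?\<mu> \<Otimes>\<^sub>M ?\<nu>"
    by (rule finite_measure_pair_measure) unfold_locales
  have Fm: "(\<lambda>p. F (fst p) (snd p)) \<in> borel_measurable (borel \<Otimes>\<^sub>M borel)"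
    by (rule borel_measurable_pair_uniform_approx[OF A(1,2) zA m tube])
  have i: "(\<lambda>y. y) \<in> measurable ?\<mu> borel" "(\<lambda>y. y) \<in> measurable ?\<nu> borel"
    using s by (intro measurable_restrict_space1; simp add: measurable_def sp)+
  have "(\<lambda>p. (fst p, snd p)) \<in> measurable (?\<mu> \<Otimes>\<^sub>M ?\<nu>) (borel \<Otimes>\<^sub>M borel)"
    by (intro measurable_Pair measurable_compose[OF measurable_fst i(1)] measurable_compose[OF measurable_snd i(2)])
  from measurable_compose[OF this Fm] have "(\<lambda>(y, z). F y z) \<in> borel_measurable (?\<mu> \<Otimes>\<^sub>M ?\<nu>)"
    by (simp add: split_beta)
  then have int: "integrable (?\<mu> \<Otimes>\<^sub>M ?\<nu>) (\<lambda>(y, z). F y z)"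
    using bd by (intro p.integrable_const_bound[of _ M]) auto
  have e1: "(LINT z|?\<nu>. f z) = (LINT z|\<nu>. f z)" if "\<And>z. z \<notin> B \<Longrightarrow> f z = 0" for f :: "'b \<Rightarrow> complex"
    using that AB(2) sp by (subst integral_restrict_space) (auto intro!: Bochner_Integration.integral_cong simp: indicator_def)
  have e2: "(LINT z|?\<mu>. f z) = (LINT z|\<mu>. f z)" if "\<And>z. z \<notin> A \<Longrightarrow> f z = 0" for f :: "'a \<Rightarrow> complex"
    using that AB(1) sp by (subst integral_restrict_space) (auto intro!: Bochner_Integration.integral_cong simp: indicator_def)
  have "(LINT y|\<mu>. LINT z|\<nu>. F y z) = (LINT y|?\<mu>. LINT z|?\<nu>. F y z)"
    using e1[OF zB] e2[of "\<lambda>y. LINT z|\<nu>. F y z"] zA by simp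
  also have "\<dots> = (LINT z|?\<nu>. LINT y|?\<mu>. F y z)"
    using ab.Fubini_integral[OF int] by simp
  also have "\<dots> = (LINT z|\<nu>. LINT y|\<mu>. F y z)"
    using e2[OF zA] e1[of "\<lambda>z. LINT y|\<mu>. F y z"] zB by simp
  finally show ?thesis .
qed

section \<open>Haar measure and the convolution kernel\<close>

locale haar_hypergroup = commutative_hypergroup \<omega> invol
  for \<omega> :: "'a::t2_space \<Rightarrow> 'a \<Rightarrow> 'a measure" and invol +
  fixes m :: "'a measure"
  assumes haar: "haar_measure \<omega> m"
begin

lemma haar_radon: "radon_measure m"
  using haar by (simp add: haar_measure_def)

lemma sets_haar: "sets m = sets borel"
  using radon_sets[OF haar_radon] .

lemma space_haar: "space m = UNIV"
  using radon_space[OF haar_radon] .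

lemma haar_translate: "f \<in> Cc \<Longrightarrow> (LINT y|m. translate \<omega> x f y) = (LINT y|m. f y)"
  using haar by (simp add: haar_measure_def)

lemma integrable_haar_compact_supp:
  fixes f :: "'a \<Rightarrow> complex"
  assumes "f \<in> borel_measurable borel" "\<And>x. norm (f x) \<le> B" "compact D" "\<And>x. f x \<noteq> 0 \<Longrightarrow> x \<in> D"
  shows "integrable m f"
proof -
  have D: "D \<in> sets m" using borel_compact[OF assms(3)] sets_haar by simp
  have "integrable m (\<lambda>x. B * indicator D x :: real)"
    using radon_compact_finite[OF haar_radon assms(3)] D by (auto intro!: integrable_real_mult_indicator simp: integrable_indicator_iff)
  moreover have "f \<in> borel_measurable m" using assms(1) sets_haar by (simp cong: measurable_cong_sets)
  moreover have "norm (f x) \<le> norm (B * indicator D x :: real)" for x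
    using assms(2)[of x] assms(4)[of x] by (cases "x \<in> D") auto
  ultimately show ?thesis
    using Bochner_Integration.integrable_bound[of m "\<lambda>x. B * indicator D x :: real" f] by blast
qed

lemma integrable_haar_Cc:
  assumes "f \<in> Cc"
  shows "integrable m f"
proof -
  obtain D where "compact D" "\<And>x. f x \<noteq> 0 \<Longrightarrow> x \<in> D" by (rule Cc_compact_supp[OF assms]) blast
  moreover obtain B where "\<And>x. norm (f x) \<le> B" by (rule Cc_bounded[OF assms]) blast
  ultimately show ?thesis using integrable_haar_compact_supp Cc_borel_measurable[OF assms] by blast
qed

lemma integrable_haar_Cc_real: "f \<in> Cc_real \<Longrightarrow> integrable m f"
  using integrable_Re[OF integrable_haar_Cc[OF Cc_of_real]] by simp

lemma translate_of_real: "translate \<omega> x (\<lambda>t. complex_of_real (f t)) = (\<lambda>y. complex_of_real (LINT t|\<omega> x y. f t))"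
  by (simp add: translate_def)

text \<open>A bump inside a null open set has integral 0, and by invariance so have all its
  translates. Some translate is positive at any prescribed \<open>y\<close>, so every point would
  have a null neighbourhood and \<open>m\<close> would vanish.\<close>

lemma haar_open_pos:
  assumes U: "open U" "p \<in> U"
  shows "emeasure m U \<noteq> 0"
proof
  assume U0: "emeasure m U = 0"
  obtain u where u: "u \<in> Cc_real" "\<And>x. 0 \<le> u x" "\<And>x. u x \<le> 1" "\<And>x. x \<in> {p} \<Longrightarrow> u x = 1"
      "\<And>x. u x \<noteq> 0 \<Longrightarrow> x \<in> U"
    by (rule Urysohn_Cc[OF locally_compact compact_sing[of p] U(1)]) (use U(2) in blast)+
  let ?u = "\<lambda>x. complex_of_real (u x)"
  have uc: "?u \<in> Cc" by (rule Cc_of_real[OF u(1)])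
  have "AE x in m. x \<notin> U" using U0 U(1) sets_haar by (intro AE_not_in) auto
  then have "AE x in m. ?u x = 0" by eventually_elim (use u(5) in auto)
  then have int0: "(LINT x|m. ?u x) = 0" by (rule integral_eq_zero_AE)
  have null: "\<exists>V. open V \<and> y \<in> V \<and> emeasure m V = 0" for y
  proof -
    \<comment> \<open>The translating point is found by solving for it: any \<open>x\<close> in the
      support of \<open>\<omega> p (invol y)\<close> has \<open>p\<close> in the support of
      \<open>\<omega> x y\<close>.\<close>
    obtain x where "x \<in> msupp (\<omega> p (invol y))" using msupp_conv_nonempty by blast
    then have px: "p \<in> msupp (\<omega> x y)" using msupp_swap[of x p "invol y"] by (simp add: invol_invol)
    let ?g = "\<lambda>y. LINT t|\<omega> x y. u t"
    have cg: "continuous_on UNIV ?g" by (intro continuous_conv_Cc_real u(1) continuous_intros)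
    have "0 < u p" using u(4) by simp
    then have gy: "0 < ?g y"
      using u(1,2) px by (intro integral_continuous_pos[of u _ p])
        (auto simp: Cc_real_def sets_conv integrable_conv_Cc_real)
    have g0: "0 \<le> ?g z" for z using u(2) by (simp add: integral_nonneg_AE)
    have gc: "(\<lambda>y. complex_of_real (?g y)) \<in> Cc" using translate_Cc[OF uc, of x] translate_of_real[of x u] by simp
    then have ig: "integrable m ?g" by (intro integrable_haar_Cc_real) (simp only: Cc_of_real_iff)
    have "complex_of_real (LINT y|m. ?g y) = 0"
      using haar_translate[OF uc, of x] int0 translate_of_real[of x u] by simp
    then have "(LINT y|m. ?g y) = 0" by simp
    then have "\<not> y \<in> msupp m" using integral_continuous_pos[OF cg g0 ig sets_haar gy] by auto
    then show ?thesis by (auto simp: msupp_def)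
  qed
  have "emeasure m UNIV = 0" by (rule radon_null_open[OF haar_radon open_UNIV null])
  then show False using haar by (simp add: haar_measure_def)
qed

lemma haar_integral_pos:
  assumes "u \<in> Cc_real" "\<And>x. 0 \<le> u x" "0 < u p"
  shows "0 < (LINT x|m. u x)"
  using assms haar_open_pos
  by (intro integral_continuous_pos[of u m p]) (auto simp: Cc_real_def sets_haar integrable_haar_Cc_real msupp_def)

lemma conv_integral_invol:
  fixes g :: "'a \<Rightarrow> complex"
  assumes "g \<in> borel_measurable borel"
  shows "(LINT t|\<omega> x y. g (invol t)) = (LINT t|\<omega> (invol y) (invol x). g t)"
proof -
  have "invol \<in> measurable (\<omega> x y) borel"
    using borel_measurable_continuous_onI[OF invol_continuous] sets_conv by (simp cong: measurable_cong_sets)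
  then show ?thesis by (subst invol_conv[symmetric]) (rule integral_distr[symmetric, OF _ assms])
qed

text \<open>For an approximate unit \<open>u\<close>, integration against \<open>kernel u\<close> is the convolution with \<open>u\<close>;
  translation on one variable of the kernel can be moved to the other one.\<close>

definition kernel :: "('a \<Rightarrow> complex) \<Rightarrow> 'a \<Rightarrow> 'a \<Rightarrow> complex" where
  "kernel u y z = (LINT t|\<omega> (invol y) z. u t)"

lemma kernel_eq_translate: "kernel u y = translate \<omega> (invol y) u"
  by (simp add: kernel_def translate_def fun_eq_iff)

lemma continuous_kernel:
  assumes "u \<in> Cc" "continuous_on S a" "continuous_on S b"
  shows "continuous_on S (\<lambda>p. kernel u (a p) (b p))"
proof -
  have "continuous_on S (\<lambda>p. invol (a p))"
    using continuous_on_compose2[OF invol_continuous assms(2)] by simp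
  then show ?thesis unfolding kernel_def by (intro continuous_conv_Cc assms)
qed

text \<open>The involution carries \<open>\<omega> (invol y) z\<close> to
  \<open>\<omega> (invol z) y\<close>, and \<open>u\<close> does not notice it.\<close>

lemma kernel_sym:
  assumes "u \<in> Cc" "\<And>x. u (invol x) = u x"
  shows "kernel u y z = kernel u z y"
  unfolding kernel_def
  using conv_integral_invol[OF Cc_borel_measurable[OF assms(1)], of "invol y" z] assms(2)
  by (simp add: invol_invol)

text \<open>The involution turns \<open>\<omega> x y\<close> into
  \<open>\<omega> (invol y) (invol x)\<close>; associativity then regroups \<open>invol x\<close>
  with \<open>z\<close> instead of \<open>invol y\<close>. This moves the translation between the
  variables.\<close>

lemma kernel_conv:
  assumes u: "u \<in> Cc"
  shows "(LINT t|\<omega> x y. kernel u t z) = (LINT s|\<omega> (invol x) z. kernel u y s)"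
proof -
  have "continuous_on UNIV (\<lambda>t. LINT r|\<omega> t z. u r)"
    by (intro continuous_conv_Cc u continuous_intros)
  then have "(LINT t|\<omega> x y. kernel u t z) = (LINT t|\<omega> (invol y) (invol x). LINT r|\<omega> t z. u r)"
    unfolding kernel_def using conv_integral_invol[of "\<lambda>t. LINT r|\<omega> t z. u r" x y]
    by (simp add: borel_measurable_continuous_onI)
  also have "\<dots> = (LINT s|\<omega> (invol x) z. LINT r|\<omega> (invol y) s. u r)"
    using conv_assoc[OF u, of "invol x" z "invol y"] by simp
  finally show ?thesis by (simp add: kernel_def)
qed

lemma kernel_uniform:
  assumes "u \<in> Cc" "compact B" "0 < e"
  obtains N where "open N" "y \<in> N" "\<And>y' z. y' \<in> N \<Longrightarrow> z \<in> B \<Longrightarrow> norm (kernel u y' z - kernel u y z) \<le> e"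
proof -
  have c: "continuous_on (UNIV \<times> B) (\<lambda>p. kernel u (fst p) (snd p))"
    by (intro continuous_kernel assms continuous_intros)
  show thesis
    by (rule continuous_on_prod_compactE[OF c assms(2) UNIV_I assms(3), of y]) (auto simp: dist_norm intro: that)
qed

end

text \<open>Dividing a tolerance by \<open>a + 1\<close> rather than \<open>a\<close> avoids a case
  distinction at \<open>a = 0\<close>.\<close>

lemma mult_divide_plus1_le:
  fixes a e :: real
  assumes "0 \<le> a" "0 \<le> e"
  shows "a * (e / (a + 1)) \<le> e"
  using assms by (simp add: field_simps)

section \<open>Smoothing operators\<close>

context haar_hypergroup
begin

text \<open>One operator with two uses: for a symmetric bump \<open>u\<close> at the unit it is the
  approximate identity, and for \<open>u = h\<close> it is the map \<open>F_f\<close> of the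
  overview, since \<open>kernel u y\<close> is the translate of \<open>u\<close> by
  \<open>invol y\<close>.\<close>

definition kernel_op :: "('a \<Rightarrow> complex) \<Rightarrow> ('a \<Rightarrow> complex) \<Rightarrow> 'a \<Rightarrow> complex" where
  "kernel_op u f y = (LINT z|m. f z * kernel u y z)"

lemma kernel_bounded:
  assumes "u \<in> Cc"
  obtains M where "0 \<le> M" "\<And>y z. norm (kernel u y z) \<le> M"
proof -
  obtain M where "0 \<le> M" "\<And>x. norm (u x) \<le> M" by (rule Cc_bounded[OF assms]) blast
  then show thesis using that[of M] norm_conv_le[OF integrable_conv_Cc[OF assms]] unfolding kernel_def by blast
qed

lemma kernel_Cc: "u \<in> Cc \<Longrightarrow> kernel u y \<in> Cc"
  by (simp add: kernel_eq_translate translate_Cc)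

lemma mult_kernel_Cc: "f \<in> Cc \<Longrightarrow> u \<in> Cc \<Longrightarrow> (\<lambda>z. f z * kernel u y z) \<in> Cc"
  using Cc_mult_continuous[of "kernel u y" f] by (simp add: kernel_Cc Cc_continuous)

text \<open>Pointwise, |T_x h| is at most T_x |h|, and invariance applies to |h|, which again has
  compact support.\<close>

lemma norm_translate_L1:
  assumes h: "h \<in> Cc"
  shows "(LINT y|m. norm (translate \<omega> x h y)) \<le> (LINT y|m. norm (h y))"
proof -
  have "continuous_on UNIV (\<lambda>y. norm (h y))" using Cc_continuous[OF h] by (intro continuous_intros)
  moreover obtain D where D: "compact D" "\<And>x. h x \<noteq> 0 \<Longrightarrow> x \<in> D" by (rule Cc_compact_supp[OF h]) blast
  ultimately have n: "(\<lambda>y. norm (h y)) \<in> Cc_real" by (intro Cc_realI[of _ D]) auto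
  have t: "(\<lambda>y. complex_of_real (LINT t|\<omega> x y. norm (h t))) \<in> Cc"
    using translate_Cc[OF Cc_of_real[OF n], of x] by (simp only: translate_of_real)
  then have ti: "integrable m (\<lambda>y. LINT t|\<omega> x y. norm (h t))"
    by (intro integrable_haar_Cc_real) (simp only: Cc_of_real_iff)
  have "(LINT y|m. norm (translate \<omega> x h y)) \<le> (LINT y|m. LINT t|\<omega> x y. norm (h t))"
    by (rule integral_mono[OF integrable_norm[OF integrable_haar_Cc[OF translate_Cc[OF h]]] ti])
      (simp add: translate_def integral_norm_bound)
  also have "complex_of_real \<dots> = complex_of_real (LINT y|m. norm (h y))"
    using haar_translate[OF Cc_of_real[OF n], of x] by (simp add: translate_of_real)
  then have "(LINT y|m. LINT t|\<omega> x y. norm (h t)) = (LINT y|m. norm (h y))" by (simp only: of_real_eq_iff)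
  finally show ?thesis .
qed

lemma compact_nbhd:
  obtains N C where "open N" "(y::'a) \<in> N" "N \<subseteq> C" "compact C"
proof -
  obtain f where f: "f \<in> Cc_real" "\<And>x. 0 \<le> f x" "\<And>x. f x \<le> 1" "\<And>x. x \<in> {y} \<Longrightarrow> f x = 1"
      "\<And>x. f x \<noteq> 0 \<Longrightarrow> x \<in> UNIV"
    by (rule Urysohn_Cc[OF locally_compact compact_sing[of y] open_UNIV subset_UNIV]) blast
  show thesis
  proof (rule that)
    show "open {x. f x \<noteq> 0}" using f(1) by (intro open_Collect_neq continuous_intros) (auto simp: Cc_real_def)
    show "y \<in> {x. f x \<noteq> 0}" using f(4)[of y] by simp
    show "compact (closure {x. f x \<noteq> 0})" using f(1) by (simp add: Cc_real_def)
  qed (rule closure_subset)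
qed

lemma kernel_supp_compact:
  assumes "u \<in> Cc" "compact C"
  obtains E where "compact E" "\<And>y z. y \<in> C \<Longrightarrow> kernel u y z \<noteq> 0 \<Longrightarrow> z \<in> E"
proof -
  obtain D where D: "compact D" "\<And>x. u x \<noteq> 0 \<Longrightarrow> x \<in> D" by (rule Cc_compact_supp[OF assms(1)]) blast
  have "compact (invol ` C)"
    using assms(2) invol_continuous by (meson compact_continuous_image continuous_on_subset subset_UNIV)
  then obtain E where E: "compact E"
    "\<And>x y f. x \<in> invol ` C \<Longrightarrow> (\<And>t. f t \<noteq> 0 \<Longrightarrow> t \<in> D) \<Longrightarrow> translate \<omega> x f y \<noteq> 0 \<Longrightarrow> y \<in> E"
    by (rule translate_supp_compact[OF _ D(1)]) blast
  show thesis by (rule that[OF E(1)]) (use E(2) D(2) in \<open>auto simp: kernel_eq_translate\<close>)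
qed

text \<open>For \<open>y\<close> in a compact neighbourhood of \<open>y0\<close> all kernels vanish
  off one compact \<open>E\<close> of finite measure, so uniform closeness on \<open>E\<close> gives
  closeness in L1.\<close>

lemma kernel_L1_continuous:
  assumes u: "u \<in> Cc" and e: "0 < e"
  obtains N where "open N" "y0 \<in> N" "\<And>y. y \<in> N \<Longrightarrow> (LINT z|m. norm (kernel u y z - kernel u y0 z)) \<le> e"
proof -
  obtain N0 C where C: "open N0" "y0 \<in> N0" "N0 \<subseteq> C" "compact C" by (rule compact_nbhd) blast
  obtain E where E: "compact E" "\<And>y z. y \<in> C \<Longrightarrow> kernel u y z \<noteq> 0 \<Longrightarrow> z \<in> E"
    by (rule kernel_supp_compact[OF u C(4)]) blast
  let ?I = "measure m E"
  have I0: "0 \<le> ?I" by simp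
  have e': "0 < e / (?I + 1)" using e I0 by (simp add: add_nonneg_pos)
  obtain N where N: "open N" "y0 \<in> N" "\<And>y' z. y' \<in> N \<Longrightarrow> z \<in> E \<Longrightarrow> norm (kernel u y' z - kernel u y0 z) \<le> e / (?I + 1)"
    by (rule kernel_uniform[OF u E(1) e', of y0]) blast
  have iE: "integrable m (indicator E :: 'a \<Rightarrow> real)"
    using radon_compact_finite[OF haar_radon E(1)] borel_compact[OF E(1)] sets_haar by (simp add: integrable_indicator_iff)
  show thesis
  proof (rule that[of "N \<inter> N0"])
    fix y assume y: "y \<in> N \<inter> N0"
    have "(LINT z|m. norm (kernel u y z - kernel u y0 z)) \<le> (LINT z|m. e / (?I + 1) * indicator E z)"
    proof (rule integral_mono)
      show "integrable m (\<lambda>z. norm (kernel u y z - kernel u y0 z))"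
        by (intro integrable_norm integrable_haar_Cc Cc_diff kernel_Cc u)
      show "integrable m (\<lambda>z. e / (?I + 1) * indicator E z)" by (rule integrable_mult_right[OF iE])
      fix z
      show "norm (kernel u y z - kernel u y0 z) \<le> e / (?I + 1) * indicator E z"
      proof (cases "z \<in> E")
        case True
        then show ?thesis using N(3)[of y z] y by simp
      next
        case False
        then have "kernel u y z = 0" "kernel u y0 z = 0" using E(2) C y by blast+
        then show ?thesis using False by simp
      qed
    qed
    also have "\<dots> = ?I * (e / (?I + 1))" using borel_compact[OF E(1)] by (simp add: sets_haar space_haar)
    also have "\<dots> \<le> e" using mult_divide_plus1_le[OF I0] e by simp
    finally show "(LINT z|m. norm (kernel u y z - kernel u y0 z)) \<le> e" .
  qed (use N C in auto)
qed

lemma integrable_bounded_mult_Cc: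
  assumes f: "f \<in> borel_measurable borel" "\<And>x. norm (f x) \<le> B" and h: "h \<in> Cc"
  shows "integrable m (\<lambda>z. f z * h z)"
proof -
  obtain D where D: "compact D" "\<And>x. h x \<noteq> 0 \<Longrightarrow> x \<in> D" by (rule Cc_compact_supp[OF h]) blast
  obtain M where M: "0 \<le> M" "\<And>x. norm (h x) \<le> M" by (rule Cc_bounded[OF h]) blast
  show ?thesis
  proof (rule integrable_haar_compact_supp[OF _ _ D(1)])
    show "(\<lambda>z. f z * h z) \<in> borel_measurable borel" using f(1) Cc_borel_measurable[OF h] by measurable
    \<comment> \<open>Any point of the type would do; \<open>undefined\<close> only witnesses that
      there is one.\<close>
    have "0 \<le> B" using f(2)[of undefined] norm_ge_zero order_trans by blast
    then show "norm (f z * h z) \<le> B * M" for z unfolding norm_mult using f(2) M by (intro mult_mono) auto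
  qed (use D(2) in auto)
qed

lemma norm_integral_bounded_mult_Cc:
  assumes f: "f \<in> borel_measurable borel" "\<And>x. norm (f x) \<le> B" and h: "h \<in> Cc"
  shows "norm (LINT z|m. f z * h z) \<le> B * (LINT z|m. norm (h z))"
proof -
  have "norm (LINT z|m. f z * h z) \<le> (LINT z|m. norm (f z * h z))" by (rule integral_norm_bound)
  also have "\<dots> \<le> (LINT z|m. B * norm (h z))"
  proof (rule integral_mono)
    show "integrable m (\<lambda>z. norm (f z * h z))" by (intro integrable_norm integrable_bounded_mult_Cc[OF f h])
    show "integrable m (\<lambda>z. B * norm (h z))" by (intro integrable_mult_right integrable_norm integrable_haar_Cc h)
    show "norm (f z * h z) \<le> B * norm (h z)" for z unfolding norm_mult using f(2) by (intro mult_right_mono) auto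
  qed
  finally show ?thesis by simp
qed

lemma norm_kernel_op_le:
  assumes f: "f \<in> borel_measurable borel" "\<And>x. norm (f x) \<le> B" and u: "u \<in> Cc"
  shows "norm (kernel_op u f y) \<le> B * (LINT z|m. norm (u z))"
proof -
  have "0 \<le> B" using f(2)[of undefined] norm_ge_zero order_trans by blast
  then have "B * (LINT z|m. norm (kernel u y z)) \<le> B * (LINT z|m. norm (u z))"
    using norm_translate_L1[OF u] by (intro mult_left_mono) (simp_all add: kernel_eq_translate)
  then show ?thesis
    using norm_integral_bounded_mult_Cc[OF f kernel_Cc[OF u], of y] unfolding kernel_op_def by linarith
qed

lemma continuous_kernel_op:
  assumes f: "f \<in> borel_measurable borel" "\<And>x. norm (f x) \<le> B" and u: "u \<in> Cc"
  shows "continuous_on UNIV (kernel_op u f)"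
proof (rule continuous_on_UNIV_metricI)
  fix y0 and e :: real assume e: "0 < e"
  have B: "0 \<le> B" using f(2)[of undefined] norm_ge_zero order_trans by blast
  have e': "0 < e / (B + 1)" using e B by simp
  obtain N where N: "open N" "y0 \<in> N" "\<And>y. y \<in> N \<Longrightarrow> (LINT z|m. norm (kernel u y z - kernel u y0 z)) \<le> e / (B + 1)"
    by (rule kernel_L1_continuous[OF u e', of y0]) blast
  have "dist (kernel_op u f y) (kernel_op u f y0) \<le> e" if y: "y \<in> N" for y
  proof -
    have "dist (kernel_op u f y) (kernel_op u f y0) = norm (LINT z|m. f z * (kernel u y z - kernel u y0 z))"
      unfolding kernel_op_def dist_norm right_diff_distrib
      by (subst Bochner_Integration.integral_diff) (auto intro!: integrable_bounded_mult_Cc[OF f] kernel_Cc u)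
    also have "\<dots> \<le> B * (LINT z|m. norm (kernel u y z - kernel u y0 z))"
      by (rule norm_integral_bounded_mult_Cc[OF f Cc_diff[OF kernel_Cc[OF u] kernel_Cc[OF u]]])
    also have "\<dots> \<le> B * (e / (B + 1))" by (rule mult_left_mono[OF N(3)[OF y] B])
    also have "\<dots> \<le> e" using mult_divide_plus1_le[OF B] e by simp
    finally show ?thesis .
  qed
  then show "\<exists>N. open N \<and> y0 \<in> N \<and> (\<forall>y\<in>N. dist (kernel_op u f y) (kernel_op u f y0) \<le> e)"
    using N(1,2) by blast
qed

text \<open>By symmetry \<open>y\<close> must lie in the support of \<open>kernel u z\<close> for
  some \<open>z\<close> in the support of \<open>f\<close>; these supports share a compact
  set.\<close>

lemma kernel_op_Cc:
  assumes f: "f \<in> Cc" and u: "u \<in> Cc" "\<And>x. u (invol x) = u x"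
  shows "kernel_op u f \<in> Cc"
proof -
  obtain D where D: "compact D" "\<And>x. f x \<noteq> 0 \<Longrightarrow> x \<in> D" by (rule Cc_compact_supp[OF f]) blast
  obtain B where B: "\<And>x. norm (f x) \<le> B" by (rule Cc_bounded[OF f]) blast
  obtain E where E: "compact E" "\<And>y z. y \<in> D \<Longrightarrow> kernel u y z \<noteq> 0 \<Longrightarrow> z \<in> E"
    by (rule kernel_supp_compact[OF u(1) D(1)]) blast
  have "y \<in> E" if y: "kernel_op u f y \<noteq> 0" for y
  proof -
    have "\<exists>z. f z * kernel u y z \<noteq> 0"
    proof (rule ccontr)
      assume "\<not> ?thesis"
      then have "(\<lambda>z. f z * kernel u y z) = (\<lambda>_. 0)" by auto
      then show False using y unfolding kernel_op_def by simp
    qed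
    then obtain z where "f z \<noteq> 0" "kernel u z y \<noteq> 0" using kernel_sym[OF u, of y] by auto
    then show ?thesis using E(2) D(2) by blast
  qed
  then show ?thesis
    using CcI[OF continuous_kernel_op[OF Cc_borel_measurable[OF f] B u(1)] E(1)] by blast
qed

text \<open>An interchange of \<open>\<omega> x y\<close> with \<open>m\<close>. It is possible
  because \<open>t\<close> may be confined to the compact support of \<open>\<omega> x y\<close>,
  for which all kernels share one compact set in \<open>z\<close>.\<close>

lemma translate_kernel_op:
  assumes f: "f \<in> borel_measurable borel" "\<And>x. norm (f x) \<le> Mf" and u: "u \<in> Cc"
  shows "translate \<omega> x (kernel_op u f) y = (LINT z|m. f z * (LINT t|\<omega> x y. kernel u t z))"
proof -
  have Mf: "0 \<le> Mf" using f(2)[of undefined] norm_ge_zero order_trans by blast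
  obtain Mu where Mu: "0 \<le> Mu" "\<And>y z. norm (kernel u y z) \<le> Mu" by (rule kernel_bounded[OF u]) blast
  let ?A = "msupp (\<omega> x y)"
  \<comment> \<open>The indicator changes nothing almost everywhere for \<open>\<omega> x y\<close>,
    but makes the integrand vanish off a compact rectangle.\<close>
  let ?F = "\<lambda>t z. indicator ?A t * (f z * kernel u t z)"
  have A: "compact ?A" "?A \<in> sets borel" using supp_compact borel_compact by auto
  obtain D where D: "compact D" "\<And>t z. t \<in> ?A \<Longrightarrow> kernel u t z \<noteq> 0 \<Longrightarrow> z \<in> D"
    by (rule kernel_supp_compact[OF u A(1)]) blast
  have k1: "(\<lambda>t. kernel u t z) \<in> borel_measurable borel" for z
    by (intro borel_measurable_continuous_onI continuous_kernel u continuous_intros)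
  have cA: "(LINT t|\<omega> x y. indicator ?A t * g t) = (LINT t|\<omega> x y. g t)" if "g \<in> borel_measurable borel" for g :: "'a \<Rightarrow> complex"
  proof (rule integral_cong_AE)
    show "g \<in> borel_measurable (\<omega> x y)" using that sets_conv by (simp cong: measurable_cong_sets)
    show "(\<lambda>t. indicator ?A t * g t) \<in> borel_measurable (\<omega> x y)"
      using that sets_conv A(2) by (simp cong: measurable_cong_sets)
    show "AE t in \<omega> x y. indicator ?A t * g t = g t"
      using AE_conv_msupp[of x y] by eventually_elim simp
  qed
  have "translate \<omega> x (kernel_op u f) y = (LINT t|\<omega> x y. LINT z|m. ?F t z)"
    unfolding translate_def
    using cA[OF borel_measurable_continuous_onI[OF continuous_kernel_op[OF f u]]] by (simp add: kernel_op_def[abs_def])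
  also have "\<dots> = (LINT z|m. LINT t|\<omega> x y. ?F t z)"
  proof (rule Fubini_compact[where A = ?A and B = D and M = "Mf * Mu"])
    show "emeasure (\<omega> x y) ?A < \<infinity>" using radon_compact_finite[OF conv_radon A(1)] .
    show "emeasure m D < \<infinity>" using radon_compact_finite[OF haar_radon D(1)] .
    show "?F t z = 0" if "z \<notin> D" for t z using that D(2)[of t z] by (auto simp: indicator_def)
    show "norm (?F t z) \<le> Mf * Mu" for t z
      using mult_mono[OF f(2)[of z] Mu(2)[of t z]] Mf Mu(1) by (auto simp: norm_mult indicator_def)
    show "?F t \<in> borel_measurable borel" for t
      using f(1) Cc_borel_measurable[OF kernel_Cc[OF u, of t]] by measurable
    fix t and e :: real assume t: "t \<in> ?A" and e: "0 < e"
    have e': "0 < e / (Mf + 1)" using e Mf by simp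
    obtain N where N: "open N" "t \<in> N" "\<And>y' z. y' \<in> N \<Longrightarrow> z \<in> D \<Longrightarrow> norm (kernel u y' z - kernel u t z) \<le> e / (Mf + 1)"
      by (rule kernel_uniform[OF u D(1) e', of t]) blast
    have "norm (?F t' z - ?F t z) \<le> e" if t': "t' \<in> N \<inter> ?A" for t' z
    proof (cases "z \<in> D")
      case False
      then have "kernel u t' z = 0" "kernel u t z = 0" using D(2) t t' by blast+
      then show ?thesis using e by simp
    next
      case True
      have "norm (?F t' z - ?F t z) = norm (f z) * norm (kernel u t' z - kernel u t z)"
        using t t' by (simp add: norm_mult[symmetric] right_diff_distrib)
      also have "\<dots> \<le> Mf * (e / (Mf + 1))"
        using N(3)[of t' z] t' True Mf f(2) by (intro mult_mono) auto
      also have "\<dots> \<le> e" using e Mf by (simp add: field_simps)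
      finally show ?thesis .
    qed
    then show "\<exists>N. open N \<and> t \<in> N \<and> (\<forall>y'\<in>N \<inter> ?A. \<forall>z. norm (?F y' z - ?F t z) \<le> e)"
      using N(1,2) by blast
  qed (use sets_conv sets_haar A borel_compact[OF D(1)] in auto)
  also have "\<dots> = (LINT z|m. f z * (LINT t|\<omega> x y. kernel u t z))"
  proof (rule Bochner_Integration.integral_cong[OF refl])
    fix z
    have "(\<lambda>t. f z * kernel u t z) \<in> borel_measurable borel" using k1 by measurable
    from cA[OF this] show "(LINT t|\<omega> x y. ?F t z) = f z * (LINT t|\<omega> x y. kernel u t z)" by simp
  qed
  finally show ?thesis .
qed

text \<open>Both sides are the same double integral of \<open>g y * f z\<close> against a translated
  kernel: \<open>kernel_conv\<close> moves the translation from \<open>y\<close> to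
  \<open>z\<close>, Fubini exchanges the order, and symmetry of the kernel recovers
  \<open>kernel_op u g\<close>.\<close>

lemma kernel_op_adjoint:
  assumes f: "f \<in> Cc" and g: "g \<in> Cc" and u: "u \<in> Cc" "\<And>x. u (invol x) = u x"
  shows "(LINT y|m. g y * translate \<omega> x (kernel_op u f) y) =
    (LINT z|m. f z * translate \<omega> (invol x) (kernel_op u g) z)"
proof -
  obtain D where D: "compact D" "\<And>x. f x \<noteq> 0 \<Longrightarrow> x \<in> D" by (rule Cc_compact_supp[OF f]) blast
  obtain G where G: "compact G" "\<And>x. g x \<noteq> 0 \<Longrightarrow> x \<in> G" by (rule Cc_compact_supp[OF g]) blast
  obtain Mf where Mf: "0 \<le> Mf" "\<And>x. norm (f x) \<le> Mf" by (rule Cc_bounded[OF f]) blast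
  obtain Mg where Mg: "0 \<le> Mg" "\<And>x. norm (g x) \<le> Mg" by (rule Cc_bounded[OF g]) blast
  obtain Mu where Mu: "0 \<le> Mu" "\<And>y z. norm (kernel u y z) \<le> Mu" by (rule kernel_bounded[OF u(1)]) blast
  let ?K = "\<lambda>y z. LINT s|\<omega> (invol x) z. kernel u y s"
  let ?F = "\<lambda>y z. g y * (f z * ?K y z)"
  have K: "(LINT t|\<omega> x y. kernel u t z) = ?K y z" for y z by (rule kernel_conv[OF u(1)])
  have K': "(LINT t|\<omega> (invol x) z. kernel u t y) = ?K y z" for y z using kernel_sym[OF u, of _ y] by simp
  have KM: "norm (?K y z) \<le> Mu" for y z using Mu(2) by (intro norm_conv_le integrable_conv_Cc kernel_Cc u)
  have "(LINT y|m. g y * translate \<omega> x (kernel_op u f) y) = (LINT y|m. LINT z|m. ?F y z)"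
    by (simp add: translate_kernel_op[OF Cc_borel_measurable[OF f] Mf(2) u(1)] K)
  also have "\<dots> = (LINT z|m. LINT y|m. ?F y z)"
  proof (rule Fubini_compact[where A = G and B = D and M = "Mg * (Mf * Mu)"])
    show "emeasure m G < \<infinity>" "emeasure m D < \<infinity>" using radon_compact_finite[OF haar_radon] D(1) G(1) by auto
    show "?F y z = 0" if "y \<notin> G" for y z using that G(2)[of y] by auto
    show "?F y z = 0" if "z \<notin> D" for y z using that D(2)[of z] by auto
    show "norm (?F y z) \<le> Mg * (Mf * Mu)" for y z
      unfolding norm_mult using Mf Mg Mu(1) KM by (intro mult_mono mult_nonneg_nonneg) auto
    have "continuous_on UNIV (?K y)" for y by (intro continuous_conv_Cc kernel_Cc u continuous_intros)
    then have "continuous_on UNIV (?F y)" for y using Cc_continuous[OF f] by (intro continuous_intros)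
    then show "?F y \<in> borel_measurable borel" for y by (rule borel_measurable_continuous_onI)
    fix y and e :: real assume y: "y \<in> G" and e: "0 < e"
    \<comment> \<open>Varying \<open>g\<close> and the kernel separately costs
      \<open>Mf * Mu + Mf * Mg\<close> times \<open>?e1\<close>. The denominator exceeds this factor
      and is positive even if the bounds are 0.\<close>
    let ?e1 = "e / (2 * Mf * Mu + 2 * Mf * Mg + 1)"
    have den: "0 < 2 * Mf * Mu + 2 * Mf * Mg + 1" using Mf(1) Mu(1) Mg(1) by (simp add: add_nonneg_pos)
    have e1: "0 < ?e1" using e den by simp
    \<comment> \<open>For \<open>z\<close> in \<open>D\<close>, the inner integral
      \<open>?K y z\<close> evaluates \<open>kernel u y\<close> only on the compact set
      \<open>?E\<close>, so uniform control on \<open>?E\<close> suffices.\<close>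
    let ?P = "{invol x} \<times> D"
    let ?E = "\<Union>p\<in>?P. msupp (\<omega> (fst p) (snd p))"
    have cE: "compact ?E" by (intro compact_Union_msupp compact_Times D(1)) simp
    obtain N where N: "open N" "y \<in> N" "\<And>y' z. y' \<in> N \<Longrightarrow> z \<in> ?E \<Longrightarrow> norm (kernel u y' z - kernel u y z) \<le> ?e1"
      by (rule kernel_uniform[OF u(1) cE e1, of y]) blast
    let ?N' = "{y'. norm (g y' - g y) < ?e1}"
    have N': "open ?N'" "y \<in> ?N'"
      using Cc_continuous[OF g] e1 by (auto intro!: open_Collect_less continuous_intros)
    have "norm (?F y' z - ?F y z) \<le> e" if y': "y' \<in> (N \<inter> ?N') \<inter> G" for y' z
    proof (cases "z \<in> D")
      case False
      then have "f z = 0" using D(2) by blast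
      then show ?thesis using e by simp
    next
      case True
      have dK: "norm (?K y' z - ?K y z) \<le> ?e1"
      proof (rule norm_conv_diff_le)
        fix t assume t: "t \<in> msupp (\<omega> (invol x) z)"
        then have "t \<in> ?E" using True by force
        then show "norm (kernel u y' t - kernel u y t) \<le> ?e1" using N(3) y' by blast
      qed (intro integrable_conv_Cc kernel_Cc u)+
      have "?F y' z - ?F y z = f z * ((g y' - g y) * ?K y' z + g y * (?K y' z - ?K y z))"
        by (simp add: algebra_simps)
      then have "norm (?F y' z - ?F y z) = norm (f z) * norm ((g y' - g y) * ?K y' z + g y * (?K y' z - ?K y z))"
        by (simp only: norm_mult)
      also have "\<dots> \<le> Mf * (?e1 * Mu + Mg * ?e1)"
      proof (rule mult_mono[OF Mf(2) _ Mf(1) norm_ge_zero])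
        have "norm (g y' - g y) \<le> ?e1" using y' by simp
        then have "norm ((g y' - g y) * ?K y' z) \<le> ?e1 * Mu" "norm (g y * (?K y' z - ?K y z)) \<le> Mg * ?e1"
          unfolding norm_mult using KM dK e1 Mg by (intro mult_mono; simp)+
        then show "norm ((g y' - g y) * ?K y' z + g y * (?K y' z - ?K y z)) \<le> ?e1 * Mu + Mg * ?e1"
          by (rule norm_triangle_mono)
      qed
      also have "\<dots> = e * ((Mf * Mu + Mf * Mg) / (2 * Mf * Mu + 2 * Mf * Mg + 1))" by (simp add: algebra_simps add_divide_distrib)
      also have "\<dots> \<le> e * 1"
      proof (rule mult_left_mono)
        have "0 \<le> Mf * Mu + Mf * Mg" using Mf(1) Mu(1) Mg(1) by simp
        then show "(Mf * Mu + Mf * Mg) / (2 * Mf * Mu + 2 * Mf * Mg + 1) \<le> 1" using den by (simp add: divide_le_eq)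
      qed (use e in simp)
      finally show ?thesis by simp
    qed
    then show "\<exists>N. open N \<and> y \<in> N \<and> (\<forall>y'\<in>N \<inter> G. \<forall>z. norm (?F y' z - ?F y z) \<le> e)"
      using N(1,2) N' by (intro exI[of _ "N \<inter> ?N'"]) auto
  qed (use sets_haar G(1) borel_compact[OF D(1)] borel_compact[OF G(1)] in auto)
  also have "\<dots> = (LINT z|m. f z * (LINT y|m. g y * ?K y z))"
    by (simp add: mult.left_commute[of "g _"])
  also have "\<dots> = (LINT z|m. f z * translate \<omega> (invol x) (kernel_op u g) z)"
    by (simp add: translate_kernel_op[OF Cc_borel_measurable[OF g] Mg(2) u(1)] K')
  finally show ?thesis .
qed

section \<open>Approximate units and the adjoint formula on \<open>Cc\<close>\<close>

text \<open>As \<open>t\<close> tends to the unit, the support of \<open>\<omega> y t\<close>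
  shrinks to the point \<open>y\<close> by upper semicontinuity; compactness of \<open>A\<close>
  makes the neighbourhood independent of \<open>y\<close>.\<close>

lemma unit_nbhd_uniform:
  fixes f :: "'a \<Rightarrow> complex"
  assumes A: "compact A" and f: "continuous_on UNIV f" and e: "0 < e"
  obtains W where "open W" "unit \<in> W"
    "\<And>y t z. y \<in> A \<Longrightarrow> t \<in> W \<Longrightarrow> z \<in> msupp (\<omega> y t) \<Longrightarrow> norm (f z - f y) \<le> e"
proof -
  have "\<exists>M N. open M \<and> open N \<and> y \<in> M \<and> unit \<in> N \<and>
      (\<forall>y'\<in>M. \<forall>t\<in>N. \<forall>z\<in>msupp (\<omega> y' t). norm (f z - f y') \<le> e)" for y
  proof -
    \<comment> \<open>Half of \<open>e\<close> is spent twice: \<open>z\<close> is compared with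
      \<open>y\<close>, and \<open>y\<close> with \<open>y'\<close>. For the second comparison
      \<open>M\<close> is intersected with \<open>?V\<close>.\<close>
    let ?V = "{z. norm (f z - f y) < e / 2}"
    have V: "open ?V" using f by (intro open_Collect_less continuous_intros)
    have "msupp (\<omega> y unit) \<subseteq> ?V" using e by (simp add: msupp_unit)
    then obtain M N where MN: "open M" "open N" "y \<in> M" "unit \<in> N"
      "\<And>x' y'. x' \<in> M \<Longrightarrow> y' \<in> N \<Longrightarrow> msupp (\<omega> x' y') \<subseteq> ?V" by (rule msupp_conv_upper[OF V]) blast
    have "norm (f z - f y') \<le> e" if "y' \<in> M \<inter> ?V" "t \<in> N" "z \<in> msupp (\<omega> y' t)" for y' t z
    proof -
      have "norm (f z - f y) < e / 2" "norm (f y' - f y) < e / 2" using MN(5) that by blast+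
      then show ?thesis using norm_triangle_ineq4[of "f z - f y" "f y' - f y"] by simp
    qed
    then show ?thesis using MN V e by (intro exI[of _ "M \<inter> ?V"] exI[of _ N]) auto
  qed
  then obtain M N where MN: "\<And>y. open (M y) \<and> open (N y) \<and> y \<in> M y \<and> unit \<in> N y \<and>
      (\<forall>y'\<in>M y. \<forall>t\<in>N y. \<forall>z\<in>msupp (\<omega> y' t). norm (f z - f y') \<le> e)" by metis
  obtain Q where Q: "Q \<subseteq> A" "finite Q" "A \<subseteq> (\<Union>y\<in>Q. M y)"
    using compactE_image[OF A, of A M] MN by blast
  show thesis
  proof (rule that[of "\<Inter>y\<in>Q. N y"])
    show "open (\<Inter>y\<in>Q. N y)" using Q(2) MN by (intro open_INT) auto
    show "unit \<in> (\<Inter>y\<in>Q. N y)" using MN by blast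
    fix y t z assume "y \<in> A" "t \<in> (\<Inter>y\<in>Q. N y)" "z \<in> msupp (\<omega> y t)"
    then show "norm (f z - f y) \<le> e" using Q(3) MN by blast
  qed
qed

text \<open>Multiplying by the reflected bump symmetrises without enlarging the support; the value
  at the unit stays positive because the involution fixes the unit.\<close>

lemma symmetric_bump:
  assumes "open W" "unit \<in> W"
  obtains u where "u \<in> Cc_real" "\<And>x. 0 \<le> u x" "\<And>x. u (invol x) = u x" "\<And>x. u x \<noteq> 0 \<Longrightarrow> x \<in> W" "0 < u unit"
proof -
  obtain v where v: "v \<in> Cc_real" "\<And>x. 0 \<le> v x" "\<And>x. v x \<le> 1" "\<And>x. x \<in> {unit} \<Longrightarrow> v x = 1"
      "\<And>x. v x \<noteq> 0 \<Longrightarrow> x \<in> W"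
    by (rule Urysohn_Cc[OF locally_compact compact_sing[of unit] assms(1)]) (use assms(2) in blast)+
  let ?u = "\<lambda>x. v x * v (invol x)"
  have c: "continuous_on UNIV v" "compact (closure {x. v x \<noteq> 0})" using v(1) by (auto simp: Cc_real_def)
  have "continuous_on UNIV ?u"
    using continuous_on_compose2[OF c(1) invol_continuous] c(1) by (intro continuous_intros) auto
  moreover have "x \<in> closure {x. v x \<noteq> 0}" if "?u x \<noteq> 0" for x
    using that closure_subset[of "{x. v x \<noteq> 0}"] by auto
  ultimately have "?u \<in> Cc_real" using c(2) Cc_realI by blast
  then show thesis using v
    by (intro that[of ?u]) (auto simp: invol_invol invol_unit)
qed

text \<open>The bump is not normalised: by invariance each \<open>kernel u y\<close> has total mass
  equal to the integral of \<open>u\<close>. Where it is nonzero, \<open>z\<close> lies in the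
  support of \<open>\<omega> y t\<close> for some \<open>t\<close> with
  \<open>u t \<noteq> 0\<close>, so \<open>f z\<close> is close to \<open>f y\<close>.\<close>

lemma kernel_op_approx:
  assumes f: "f \<in> Cc" and u: "u \<in> Cc_real" "\<And>x. 0 \<le> u x"
    and W: "\<And>t z. u t \<noteq> 0 \<Longrightarrow> z \<in> msupp (\<omega> y t) \<Longrightarrow> norm (f z - f y) \<le> e"
  shows "norm (kernel_op (\<lambda>x. complex_of_real (u x)) f y - of_real (LINT x|m. u x) * f y) \<le> e * (LINT x|m. u x)"
proof -
  let ?u = "\<lambda>x. complex_of_real (u x)"
  let ?k = "\<lambda>z. LINT t|\<omega> (invol y) z. u t"
  have uc: "?u \<in> Cc" by (rule Cc_of_real[OF u(1)])
  have kk: "kernel ?u y z = of_real (?k z)" for z by (simp add: kernel_def)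
  have k0: "0 \<le> ?k z" for z using u(2) by (simp add: integral_nonneg_AE)
  have kc: "(\<lambda>z. complex_of_real (?k z)) \<in> Cc" using kernel_Cc[OF uc, of y] by (simp add: kk[symmetric])
  then have ki: "integrable m ?k" by (intro integrable_haar_Cc_real) (simp only: Cc_of_real_iff)
  have "complex_of_real (LINT z|m. ?k z) = (LINT z|m. kernel ?u y z)" by (simp add: kk)
  also have "\<dots> = complex_of_real (LINT x|m. u x)"
    using haar_translate[OF uc, of "invol y"] by (simp add: kernel_eq_translate)
  finally have U: "(LINT z|m. ?k z) = (LINT x|m. u x)" by simp
  have i1: "integrable m (\<lambda>z. f z * kernel ?u y z)" by (intro integrable_haar_Cc mult_kernel_Cc f uc)
  have i2: "integrable m (\<lambda>z. f y * kernel ?u y z)" by (intro integrable_haar_Cc Cc_cmult kernel_Cc uc)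
  have "of_real (LINT x|m. u x) * f y = (LINT z|m. f y * kernel ?u y z)"
    by (simp add: kk U[symmetric])
  then have "kernel_op ?u f y - of_real (LINT x|m. u x) * f y = (LINT z|m. f z * kernel ?u y z - f y * kernel ?u y z)"
    using i1 i2 by (simp add: kernel_op_def)
  then have "norm (kernel_op ?u f y - of_real (LINT x|m. u x) * f y) \<le> (LINT z|m. norm (f z * kernel ?u y z - f y * kernel ?u y z))"
    by (simp add: integral_norm_bound)
  also have "\<dots> \<le> (LINT z|m. e * ?k z)"
  proof (rule integral_mono)
    show "integrable m (\<lambda>z. norm (f z * kernel ?u y z - f y * kernel ?u y z))"
      by (intro integrable_norm Bochner_Integration.integrable_diff i1 i2)
    show "integrable m (\<lambda>z. e * ?k z)" using ki by simp
    fix z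
    show "norm (f z * kernel ?u y z - f y * kernel ?u y z) \<le> e * ?k z"
    proof (cases "?k z = 0")
      case False
      then obtain t where "t \<in> msupp (\<omega> (invol y) z)" "u t \<noteq> 0" using conv_integral_nonzero by blast
      then have "norm (f z - f y) \<le> e" using W msupp_swap_left by blast
      then show ?thesis using k0[of z]
        by (simp only: left_diff_distrib[symmetric] norm_mult kk norm_of_real) (simp add: mult_right_mono)
    qed (simp add: kk)
  qed
  also have "\<dots> = e * (LINT x|m. u x)" by (simp add: U)
  finally show ?thesis .
qed

text \<open>The approximation is needed only at points that T_x evaluates over the support of
  \<open>g\<close>. These form a relatively compact set, which is what makes a uniform
  \<open>e\<close> attainable; \<open>c\<close> will be the mass of \<open>u\<close>.\<close>

lemma translate_kernel_op_approx:
  assumes f: "f \<in> Cc" and g: "g \<in> Cc" and u: "u \<in> Cc" "\<And>x. u (invol x) = u x" and e: "0 \<le> e"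
    and app: "\<And>y t. g y \<noteq> 0 \<Longrightarrow> t \<in> msupp (\<omega> x y) \<Longrightarrow> norm (kernel_op u f t - c * f t) \<le> e"
  shows "norm ((LINT y|m. g y * translate \<omega> x (kernel_op u f) y) - c * (LINT y|m. g y * translate \<omega> x f y))
    \<le> e * (LINT y|m. norm (g y))"
proof -
  have P: "kernel_op u f \<in> Cc" by (rule kernel_op_Cc[OF f u])
  have cf: "(\<lambda>t. c * f t) \<in> Cc" by (rule Cc_cmult[OF f])
  have i1: "integrable m (\<lambda>y. g y * translate \<omega> x h y)" if "h \<in> Cc" for h
    using Cc_mult_continuous[OF translate_Cc[OF that] Cc_continuous[OF g]] by (rule integrable_haar_Cc)
  have eq: "(LINT y|m. g y * translate \<omega> x (kernel_op u f) y) - c * (LINT y|m. g y * translate \<omega> x f y) =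
      (LINT y|m. g y * translate \<omega> x (kernel_op u f) y - c * (g y * translate \<omega> x f y))"
    using i1[OF P] i1[OF f] by simp
  have "norm ((LINT y|m. g y * translate \<omega> x (kernel_op u f) y) - c * (LINT y|m. g y * translate \<omega> x f y)) \<le> (LINT y|m. norm (g y * translate \<omega> x (kernel_op u f) y - c * (g y * translate \<omega> x f y)))"
    unfolding eq by (rule integral_norm_bound)
  also have "\<dots> \<le> (LINT y|m. e * norm (g y))"
  proof (rule integral_mono)
    show "integrable m (\<lambda>y. norm (g y * translate \<omega> x (kernel_op u f) y - c * (g y * translate \<omega> x f y)))"
      by (rule integrable_norm[OF Bochner_Integration.integrable_diff[OF i1[OF P] integrable_mult_right[OF i1[OF f]]]])
    show "integrable m (\<lambda>y. e * norm (g y))" by (rule integrable_mult_right[OF integrable_norm[OF integrable_haar_Cc[OF g]]])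
    fix y
    show "norm (g y * translate \<omega> x (kernel_op u f) y - c * (g y * translate \<omega> x f y)) \<le> e * norm (g y)"
    proof (cases "g y = 0")
      case False
      have "norm (translate \<omega> x (kernel_op u f) y - c * translate \<omega> x f y) \<le> e"
        using norm_conv_diff_le[OF integrable_conv_Cc[OF P] integrable_conv_Cc[OF cf] app[OF False]]
        by (simp add: translate_def)
      moreover have "g y * translate \<omega> x (kernel_op u f) y - c * (g y * translate \<omega> x f y) =
          (translate \<omega> x (kernel_op u f) y - c * translate \<omega> x f y) * g y" by (simp add: algebra_simps)
      ultimately show ?thesis by (simp only: norm_mult) (rule mult_right_mono, auto)
    qed simp
  qed
  finally show ?thesis by simp
qed

text \<open>The smoothed formula is exact. Each side, multiplied by the mass \<open>?U\<close> of
  the bump, differs from it by at most a constant times \<open>e * ?U\<close>; the positive factor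
  \<open>?U\<close> cancels, and \<open>e\<close> is arbitrary.\<close>

lemma adjoint_Cc:
  assumes f: "f \<in> Cc" and g: "g \<in> Cc"
  shows "(LINT y|m. g y * translate \<omega> x f y) = (LINT z|m. f z * translate \<omega> (invol x) g z)"
proof -
  let ?l = "LINT y|m. g y * translate \<omega> x f y" and ?r = "LINT z|m. f z * translate \<omega> (invol x) g z"
  let ?I = "(LINT y|m. norm (g y)) + (LINT z|m. norm (f z))"
  obtain D where D: "compact D" "\<And>x. f x \<noteq> 0 \<Longrightarrow> x \<in> D" by (rule Cc_compact_supp[OF f]) blast
  obtain G where G: "compact G" "\<And>x. g x \<noteq> 0 \<Longrightarrow> x \<in> G" by (rule Cc_compact_supp[OF g]) blast
  let ?P1 = "{x} \<times> G" and ?P2 = "{invol x} \<times> D"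
  \<comment> \<open>The points at which \<open>f\<close>, respectively \<open>g\<close>, is
    evaluated by the two sides; compactness permits one neighbourhood of the unit for each.\<close>
  let ?E1 = "\<Union>p\<in>?P1. msupp (\<omega> (fst p) (snd p))" and ?E2 = "\<Union>p\<in>?P2. msupp (\<omega> (fst p) (snd p))"
  have cE: "compact ?E1" "compact ?E2" by (intro compact_Union_msupp compact_Times D(1) G(1), simp)+
  have key: "norm (?l - ?r) \<le> e * ?I" if e: "0 < e" for e
  proof -
    obtain W1 where W1: "open W1" "unit \<in> W1"
      "\<And>y t z. y \<in> ?E1 \<Longrightarrow> t \<in> W1 \<Longrightarrow> z \<in> msupp (\<omega> y t) \<Longrightarrow> norm (f z - f y) \<le> e"
      by (rule unit_nbhd_uniform[OF cE(1) Cc_continuous[OF f] e]) blast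
    obtain W2 where W2: "open W2" "unit \<in> W2"
      "\<And>y t z. y \<in> ?E2 \<Longrightarrow> t \<in> W2 \<Longrightarrow> z \<in> msupp (\<omega> y t) \<Longrightarrow> norm (g z - g y) \<le> e"
      by (rule unit_nbhd_uniform[OF cE(2) Cc_continuous[OF g] e]) blast
    have W: "open (W1 \<inter> W2)" "unit \<in> W1 \<inter> W2" using W1 W2 by auto
    obtain u where u: "u \<in> Cc_real" "\<And>x. 0 \<le> u x" "\<And>x. u (invol x) = u x"
      "\<And>x. u x \<noteq> 0 \<Longrightarrow> x \<in> W1 \<inter> W2" "0 < u unit" by (rule symmetric_bump[OF W]) blast
    let ?u = "\<lambda>x. complex_of_real (u x)"
    have uc: "?u \<in> Cc" "\<And>x. ?u (invol x) = ?u x" using Cc_of_real[OF u(1)] u(3) by simp_all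
    let ?U = "LINT x|m. u x"
    have U: "0 < ?U" by (rule haar_integral_pos[of u unit]) (use u in auto)
    have eU: "0 \<le> e * ?U" using e U by simp
    let ?Pl = "LINT y|m. g y * translate \<omega> x (kernel_op ?u f) y"
    have a1: "norm (?Pl - of_real ?U * ?l) \<le> e * ?U * (LINT y|m. norm (g y))"
    proof (rule translate_kernel_op_approx[OF f g uc eU])
      fix y t assume "g y \<noteq> 0" "t \<in> msupp (\<omega> x y)"
      then have t: "t \<in> ?E1" using G(2)[of y] by force
      show "norm (kernel_op ?u f t - of_real ?U * f t) \<le> e * ?U"
        by (rule kernel_op_approx[OF f u(1,2)]) (use W1(3)[OF t] u(4) in blast)
    qed
    have "norm ((LINT z|m. f z * translate \<omega> (invol x) (kernel_op ?u g) z) - of_real ?U * ?r)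
        \<le> e * ?U * (LINT z|m. norm (f z))"
    proof (rule translate_kernel_op_approx[OF g f uc eU])
      fix y t assume "f y \<noteq> 0" "t \<in> msupp (\<omega> (invol x) y)"
      then have t: "t \<in> ?E2" using D(2)[of y] by force
      show "norm (kernel_op ?u g t - of_real ?U * g t) \<le> e * ?U"
        by (rule kernel_op_approx[OF g u(1,2)]) (use W2(3)[OF t] u(4) in blast)
    qed
    then have a2: "norm (?Pl - of_real ?U * ?r) \<le> e * ?U * (LINT z|m. norm (f z))"
      by (simp only: kernel_op_adjoint[OF f g uc])
    have "?U * norm (?l - ?r) = norm (of_real ?U * (?l - ?r))" using U by (simp add: norm_mult)
    also have "of_real ?U * (?l - ?r) = (?Pl - of_real ?U * ?r) - (?Pl - of_real ?U * ?l)"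
      by (simp add: right_diff_distrib)
    also have "norm \<dots> \<le> norm (?Pl - of_real ?U * ?r) + norm (?Pl - of_real ?U * ?l)"
      by (rule norm_triangle_ineq4)
    also have "\<dots> \<le> e * ?U * (LINT z|m. norm (f z)) + e * ?U * (LINT y|m. norm (g y))"
      by (rule add_mono[OF a2 a1])
    also have "\<dots> = ?U * (e * ?I)" by (simp add: algebra_simps)
    finally show ?thesis using U by simp
  qed
  have I0: "0 \<le> ?I" by simp
  have "norm (?l - ?r) \<le> 0"
  proof (rule field_le_epsilon)
    fix e :: real assume e: "0 < e"
    have "norm (?l - ?r) \<le> e / (?I + 1) * ?I"
      by (rule key) (use e I0 in \<open>simp add: add_nonneg_pos\<close>)
    also have "\<dots> \<le> e" using mult_divide_plus1_le[OF I0, of e] e by (simp only: mult.commute)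
    finally show "norm (?l - ?r) \<le> 0 + e" by simp
  qed
  then show ?thesis by simp
qed

section \<open>From compactly supported to bounded Borel functions\<close>

lemma adjoint_Cc_real:
  assumes f: "f \<in> Cc_real" and g: "g \<in> Cc_real"
  shows "(LINT y|m. g y * (LINT t|\<omega> x y. f t)) = (LINT z|m. f z * (LINT t|\<omega> (invol x) z. g t))"
proof -
  have "complex_of_real (LINT y|m. g y * (LINT t|\<omega> x y. f t)) = complex_of_real (LINT z|m. f z * (LINT t|\<omega> (invol x) z. g t))"
    using adjoint_Cc[OF Cc_of_real[OF f] Cc_of_real[OF g], of x]
    by (simp add: translate_of_real of_real_mult[symmetric] del: of_real_mult)
  then show ?thesis by (simp only: of_real_eq_iff)
qed

lemma translate_Cc_real:
  assumes "f \<in> Cc_real"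
  shows "(\<lambda>y. LINT t|\<omega> x y. f t) \<in> Cc_real"
  using translate_Cc[OF Cc_of_real[OF assms], of x] by (simp only: translate_of_real Cc_of_real_iff)

lemma Cc_real_supp_bound:
  fixes f :: "'a \<Rightarrow> real"
  assumes "f \<in> Cc_real"
  obtains D M where "compact D" "\<And>x. f x \<noteq> 0 \<Longrightarrow> x \<in> D" "0 \<le> M" "\<And>x. f x \<le> M"
proof -
  obtain D where D: "compact D" "\<And>x. complex_of_real (f x) \<noteq> 0 \<Longrightarrow> x \<in> D"
    by (rule Cc_compact_supp[OF Cc_of_real[OF assms]]) blast
  obtain M where M: "0 \<le> M" "\<And>x. norm (complex_of_real (f x)) \<le> M"
    by (rule Cc_bounded[OF Cc_of_real[OF assms]]) blast
  show thesis using that[OF D(1) _ M(1)] D(2) M(2) by (metis abs_le_D1 norm_of_real of_real_eq_0_iff)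
qed

lemma Cc_real_mult:
  fixes f g :: "'a \<Rightarrow> real"
  assumes "f \<in> Cc_real" "g \<in> Cc_real"
  shows "(\<lambda>x. f x * g x) \<in> Cc_real"
  using Cc_mult_continuous[OF Cc_of_real[OF assms(2)] Cc_continuous[OF Cc_of_real[OF assms(1)]]]
  by (simp only: of_real_mult[symmetric] Cc_of_real_iff)

text \<open>A directed family increasing to the indicator of an open \<open>U\<close>; it takes the
  place of an approximating sequence.\<close>

abbreviation subordinate :: "'a set \<Rightarrow> ('a \<Rightarrow> real) set" where
  "subordinate U \<equiv> {f :: 'a \<Rightarrow> real. f \<in> Cc_real \<and> (\<forall>x. 0 \<le> f x \<and> f x \<le> 1 \<and> (f x \<noteq> 0 \<longrightarrow> x \<in> U))}"

lemma subordinate_directed: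
  assumes "f \<in> subordinate U" "g \<in> subordinate U"
  shows "\<exists>h\<in>subordinate U. \<forall>x. f x \<le> h x \<and> g x \<le> h x"
proof -
  let ?h = "\<lambda>x. max (f x) (g x)"
  have f: "f \<in> Cc_real" and g: "g \<in> Cc_real" using assms by auto
  obtain D M where D: "compact D" "\<And>x. f x \<noteq> 0 \<Longrightarrow> x \<in> D" "0 \<le> M" "\<And>x. f x \<le> M" by (rule Cc_real_supp_bound[OF f]) blast
  obtain E M' where E: "compact E" "\<And>x. g x \<noteq> 0 \<Longrightarrow> x \<in> E" "0 \<le> M'" "\<And>x. g x \<le> M'" by (rule Cc_real_supp_bound[OF g]) blast
  have "?h \<in> Cc_real"
  proof (rule Cc_realI)
    show "continuous_on UNIV ?h" using f g by (auto simp: Cc_real_def intro!: continuous_intros)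
    show "compact (D \<union> E)" using D(1) E(1) by (rule compact_Un)
    show "x \<in> D \<union> E" if "?h x \<noteq> 0" for x using that D(2)[of x] E(2)[of x] by (auto simp: max_def split: if_splits)
  qed
  moreover have "0 \<le> ?h x \<and> ?h x \<le> 1 \<and> (?h x \<noteq> 0 \<longrightarrow> x \<in> U)" for x
    using assms by (auto simp: max_def)
  ultimately show ?thesis by (intro bexI[of _ ?h]) auto
qed

lemma zero_subordinate: "(\<lambda>_. 0) \<in> subordinate U"
  by (auto simp: Cc_real_def)

lemma SUP_subordinate:
  assumes U: "open U"
  shows "(SUP f\<in>subordinate U. ennreal (f x)) = indicator U x"
proof (cases "x \<in> U")
  case True
  have s: "{x} \<subseteq> U" using True by simp
  obtain f where f: "f \<in> Cc_real" "\<And>x. 0 \<le> f x" "\<And>x. f x \<le> 1" "\<And>y. y \<in> {x} \<Longrightarrow> f y = 1"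
      "\<And>x. f x \<noteq> 0 \<Longrightarrow> x \<in> U"
    by (rule Urysohn_Cc[OF locally_compact compact_sing U s]) blast
  have fs: "f \<in> subordinate U" using f by blast
  have "ennreal (f x) \<le> (SUP f\<in>subordinate U. ennreal (f x))" by (rule SUP_upper[OF fs])
  moreover have "(SUP f\<in>subordinate U. ennreal (f x)) \<le> 1"
    by (rule SUP_least) auto
  ultimately show ?thesis using True f(4)[of x] by simp
next
  case False
  then have "(SUP f\<in>subordinate U. ennreal (f x)) \<le> 0" by (intro SUP_least) auto
  then show ?thesis using False by simp
qed

lemma emeasure_conv_open:
  assumes U: "open U"
  shows "emeasure (\<omega> x y) U = (SUP f\<in>subordinate U. ennreal (LINT t|\<omega> x y. f t))"
  unfolding emeasure_open_eq_SUP_Cc[OF locally_compact conv_radon U]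
  by (intro SUP_cong refl nn_integral_eq_integral) (auto simp: integrable_conv_Cc_real)

text \<open>On an open set, \<open>y \<mapsto> \<omega> x y\<close> is a supremum of continuous
  functions, and open sets are an intersection-stable generator. As a measurable kernel,
  \<open>\<omega> x\<close> can be mixed with \<open>bind\<close>.\<close>

lemma measurable_conv: "\<omega> x \<in> measurable borel (subprob_algebra borel)"
proof (rule measurable_subprob_algebra_generated[where G = "Collect open" and \<Omega> = UNIV])
  show "sets (borel :: 'a measure) = sigma_sets UNIV (Collect open)" by (simp add: borel_def)
  show "Int_stable (Collect (open :: 'a set \<Rightarrow> bool))" by (auto simp: Int_stable_def)
  show "subprob_space (\<omega> x a)" for a by (intro prob_space_imp_subprob_space conv_prob)
  show "sets (\<omega> x a) = sets borel" for a by (rule sets_conv)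
  show m: "(\<lambda>a. emeasure (\<omega> x a) A) \<in> borel_measurable borel" if "A \<in> Collect open" for A
  proof -
    let ?F = "(\<lambda>f y. LINT t|\<omega> x y. f t) ` subordinate A"
    have "(\<lambda>y. SUP h\<in>?F. ennreal (h y)) \<in> borel_measurable borel"
      by (rule borel_measurable_SUP_continuous) (auto intro!: continuous_conv_Cc_real continuous_intros)
    then show ?thesis using that by (simp add: emeasure_conv_open image_image)
  qed
  show "(\<lambda>a. emeasure (\<omega> x a) UNIV) \<in> borel_measurable borel" by (rule m) simp
qed simp

end

lemma borel_measurable_Cc_real: "f \<in> Cc_real \<Longrightarrow> f \<in> borel_measurable borel"
  by (intro borel_measurable_continuous_onI) (simp add: Cc_real_def)

context haar_hypergroup
begin

text \<open>Tau-additivity for a monotone image of the family. The single majorant \<open>k\<close>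
  provides the common bound and the common compact support. It is applied to both sides of the
  adjoint formula.\<close>

lemma nn_integral_SUP_subordinate:
  assumes \<Phi>: "\<And>f. f \<in> subordinate U \<Longrightarrow> \<Phi> f \<in> Cc_real"
    and mono: "\<And>f h y. f \<in> subordinate U \<Longrightarrow> h \<in> subordinate U \<Longrightarrow> (\<And>x. f x \<le> h x) \<Longrightarrow> \<Phi> f y \<le> \<Phi> h y"
    and bd: "\<And>f y. f \<in> subordinate U \<Longrightarrow> 0 \<le> \<Phi> f y" "\<And>f y. f \<in> subordinate U \<Longrightarrow> \<Phi> f y \<le> k y"
    and k: "k \<in> Cc_real"
  shows "(\<integral>\<^sup>+y. (SUP f\<in>subordinate U. ennreal (\<Phi> f y)) \<partial>m) = (SUP f\<in>subordinate U. ennreal (LINT y|m. \<Phi> f y))"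
proof -
  obtain D M where D: "compact D" "\<And>x. k x \<noteq> 0 \<Longrightarrow> x \<in> D" "0 \<le> M" "\<And>x. k x \<le> M" by (rule Cc_real_supp_bound[OF k]) blast
  have "(\<integral>\<^sup>+y. (SUP h\<in>\<Phi> ` subordinate U. ennreal (h y)) \<partial>m) = (SUP h\<in>\<Phi> ` subordinate U. \<integral>\<^sup>+y. ennreal (h y) \<partial>m)"
  proof (rule nn_integral_SUP_directed[OF haar_radon, where D = D and M = M])
    show "\<Phi> ` subordinate U \<noteq> {}" using zero_subordinate by blast
    show "continuous_on UNIV h" if "h \<in> \<Phi> ` subordinate U" for h using that \<Phi> by (auto simp: Cc_real_def)
    show "0 \<le> h y" if "h \<in> \<Phi> ` subordinate U" for h y using that bd(1) by blast
    show "h y \<le> M" if "h \<in> \<Phi> ` subordinate U" for h y using that bd(2) D(4) by (blast intro: order_trans)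
    show "compact D" by (rule D(1))
    show "y \<in> D" if h: "h \<in> \<Phi> ` subordinate U" "h y \<noteq> 0" for h y
    proof -
      obtain f where "f \<in> subordinate U" "h = \<Phi> f" using h(1) by blast
      then have "0 \<le> h y" "h y \<le> k y" using bd by auto
      then show ?thesis using h(2) D(2)[of y] by linarith
    qed
    fix h h' assume "h \<in> \<Phi> ` subordinate U" "h' \<in> \<Phi> ` subordinate U"
    then obtain f f' where f: "f \<in> subordinate U" "f' \<in> subordinate U" "h = \<Phi> f" "h' = \<Phi> f'" by blast
    obtain q where q: "q \<in> subordinate U" "\<forall>x. f x \<le> q x \<and> f' x \<le> q x"
      using subordinate_directed[OF f(1,2)] by blast
    have "\<forall>x. h x \<le> \<Phi> q x \<and> h' x \<le> \<Phi> q x"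
      unfolding f(3,4) using mono[OF f(1) q(1)] mono[OF f(2) q(1)] q(2) by blast
    then show "\<exists>q\<in>\<Phi> ` subordinate U. \<forall>x. h x \<le> q x \<and> h' x \<le> q x" using q(1) by blast
  qed
  also have "\<dots> = (SUP f\<in>subordinate U. \<integral>\<^sup>+y. ennreal (\<Phi> f y) \<partial>m)" by (simp only: image_image)
  also have "\<dots> = (SUP f\<in>subordinate U. ennreal (LINT y|m. \<Phi> f y))"
  proof (rule SUP_cong[OF refl])
    fix f assume f: "f \<in> subordinate U"
    show "(\<integral>\<^sup>+y. ennreal (\<Phi> f y) \<partial>m) = ennreal (LINT y|m. \<Phi> f y)"
      by (rule nn_integral_eq_integral[OF integrable_haar_Cc_real[OF \<Phi>[OF f]]]) (simp add: bd(1)[OF f])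
  qed
  finally show ?thesis by (simp only: image_image)
qed

text \<open>The adjoint formula as an identity of measures: mixing \<open>\<omega> x y\<close> with
  weight \<open>g\<close> gives the density T of \<open>g\<close> translated by
  \<open>invol x\<close>. On an open set both sides are suprema of the two sides of
  \<open>adjoint_Cc_real\<close>, and finite measures agreeing on open sets coincide.\<close>

lemma bind_conv_eq_density:
  assumes g: "g \<in> Cc_real" "\<And>x. 0 \<le> g x"
  shows "bind (density m (\<lambda>y. ennreal (g y))) (\<omega> x) =
    density m (\<lambda>z. ennreal (LINT t|\<omega> (invol x) z. g t))" (is "bind ?M _ = density m (\<lambda>z. ennreal (?k z))")
proof (rule measure_eqI_generator_eq[where E = "Collect open" and \<Omega> = UNIV and A = "\<lambda>_. UNIV"])
  have k: "?k \<in> Cc_real" by (rule translate_Cc_real[OF g(1)])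
  have k0: "0 \<le> ?k z" for z using g(2) by (simp add: integral_nonneg_AE)
  have [measurable_cong]: "sets m = sets borel" by (rule sets_haar)
  have [measurable]: "g \<in> borel_measurable borel" "?k \<in> borel_measurable borel"
    using borel_measurable_Cc_real g(1) k by auto
  have M: "\<omega> x \<in> measurable ?M (subprob_algebra borel)"
    using measurable_conv[of x] sets_haar by (simp cong: measurable_cong_sets)
  have sM: "space ?M \<noteq> {}" by (simp add: space_haar)
  show "Int_stable (Collect (open :: 'a set \<Rightarrow> bool))" by (auto simp: Int_stable_def)
  have b: "sets (borel :: 'a measure) = sigma_sets UNIV (Collect open)" by (simp add: borel_def)
  show "sets (bind ?M (\<omega> x)) = sigma_sets UNIV (Collect open)"
    using sets_bind[OF sets_conv sM] b by simp
  show "sets (density m (\<lambda>z. ennreal (?k z))) = sigma_sets UNIV (Collect open)"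
    using b sets_haar by simp
  show eq: "emeasure (bind ?M (\<omega> x)) U = emeasure (density m (\<lambda>z. ennreal (?k z))) U" if "U \<in> Collect open" for U
  proof -
    have U: "open U" using that by simp
    have [measurable]: "U \<in> sets borel" using U by simp
    have [measurable]: "(\<lambda>y. emeasure (\<omega> x y) U) \<in> borel_measurable borel"
      by (rule measurable_compose[OF measurable_conv measurable_emeasure_subprob_algebra]) measurable
    have T0: "0 \<le> (LINT t|\<omega> x y. f t)" if "f \<in> subordinate U" for f y
      using that by (simp add: integral_nonneg_AE)
    have Tmono: "(LINT t|\<omega> x y. f t) \<le> (LINT t|\<omega> x y. h t)" if "f \<in> Cc_real" "h \<in> Cc_real" "\<And>x. f x \<le> h x" for f h y
      by (intro integral_mono integrable_conv_Cc_real that)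
    have T1: "(LINT t|\<omega> x y. f t) \<le> 1" if "f \<in> subordinate U" for f y
    proof -
      interpret prob_space "\<omega> x y" by (rule conv_prob)
      have "(LINT t|\<omega> x y. f t) \<le> (LINT t|\<omega> x y. 1)"
        using that by (intro integral_mono[OF integrable_conv_Cc_real integrable_const]) auto
      then show ?thesis by (simp add: prob_space)
    qed
    have "emeasure (bind ?M (\<omega> x)) U = (\<integral>\<^sup>+y. emeasure (\<omega> x y) U \<partial>?M)"
      by (rule emeasure_bind[OF sM M]) measurable
    also have "\<dots> = (\<integral>\<^sup>+y. ennreal (g y) * emeasure (\<omega> x y) U \<partial>m)"
      by (rule nn_integral_density) measurable
    also have "\<dots> = (\<integral>\<^sup>+y. (SUP f\<in>subordinate U. ennreal (g y * (LINT t|\<omega> x y. f t))) \<partial>m)"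
      by (simp only: emeasure_conv_open[OF U] SUP_mult_left_ennreal ennreal_mult'[OF g(2)])
    also have "\<dots> = (SUP f\<in>subordinate U. ennreal (LINT y|m. g y * (LINT t|\<omega> x y. f t)))"
    proof (rule nn_integral_SUP_subordinate[OF _ _ _ _ g(1)])
      fix f assume f: "f \<in> subordinate U"
      show "(\<lambda>y. g y * (LINT t|\<omega> x y. f t)) \<in> Cc_real"
        using f by (intro Cc_real_mult g(1) translate_Cc_real) simp
      show "0 \<le> g y * (LINT t|\<omega> x y. f t)" for y using g(2) T0[OF f] by simp
      show "g y * (LINT t|\<omega> x y. f t) \<le> g y" for y using mult_left_mono[OF T1[OF f] g(2)] by simp
    next
      fix f h y assume "f \<in> subordinate U" "h \<in> subordinate U" "\<And>x. f x \<le> h x"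
      then show "g y * (LINT t|\<omega> x y. f t) \<le> g y * (LINT t|\<omega> x y. h t)"
        by (intro mult_left_mono Tmono g(2)) simp_all
    qed
    also have "\<dots> = (SUP f\<in>subordinate U. ennreal (LINT z|m. f z * ?k z))"
    proof (rule SUP_cong[OF refl])
      fix f assume "f \<in> subordinate U"
      then have "f \<in> Cc_real" by simp
      from adjoint_Cc_real[OF this g(1), of x]
      show "ennreal (LINT y|m. g y * (LINT t|\<omega> x y. f t)) = ennreal (LINT z|m. f z * ?k z)" by (rule arg_cong)
    qed
    also have "\<dots> = (\<integral>\<^sup>+z. (SUP f\<in>subordinate U. ennreal (f z * ?k z)) \<partial>m)"
    proof (rule nn_integral_SUP_subordinate[OF _ _ _ _ k, symmetric])
      fix f assume f: "f \<in> subordinate U"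
      show "(\<lambda>y. f y * ?k y) \<in> Cc_real" using f by (intro Cc_real_mult k) simp
      show "0 \<le> f y * ?k y" for y using f k0 by simp
      show "f y * ?k y \<le> ?k y" for y using f k0[of y] mult_right_mono[of "f y" 1 "?k y"] by simp
    next
      fix f h y assume "f \<in> subordinate U" "h \<in> subordinate U" "\<And>x. f x \<le> h x"
      then show "f y * ?k y \<le> h y * ?k y" by (intro mult_right_mono k0)
    qed
    also have "\<dots> = (\<integral>\<^sup>+z. ennreal (?k z) * indicator U z \<partial>m)"
      by (simp only: ennreal_mult''[OF k0] SUP_mult_right_ennreal[symmetric] SUP_subordinate[OF U] mult.commute)
    also have "\<dots> = emeasure (density m (\<lambda>z. ennreal (?k z))) U"
      by (rule emeasure_density[symmetric]) measurable
    finally show ?thesis .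
  qed
  \<comment> \<open>Uniqueness requires finite mass, here the integral of a function in
    \<open>Cc_real\<close>.\<close>
  have "emeasure (density m (\<lambda>z. ennreal (?k z))) UNIV = (\<integral>\<^sup>+z. ennreal (?k z) \<partial>m)"
    by (subst emeasure_density) (auto simp: space_haar)
  also have "\<dots> = ennreal (LINT z|m. ?k z)"
    by (rule nn_integral_eq_integral[OF integrable_haar_Cc_real[OF k]]) (simp add: k0)
  finally show "emeasure (bind ?M (\<omega> x)) UNIV \<noteq> \<infinity>" using eq[of UNIV] by simp
qed auto

lemma finite_measure_density_Cc_real:
  assumes "g \<in> Cc_real" "\<And>x. 0 \<le> g x"
  shows "finite_measure (density m (\<lambda>y. ennreal (g y)))"
proof (rule finite_measureI)
  have [measurable_cong]: "sets m = sets borel" by (rule sets_haar)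
  have [measurable]: "g \<in> borel_measurable borel" by (rule borel_measurable_Cc_real[OF assms(1)])
  have "emeasure (density m (\<lambda>y. ennreal (g y))) (space m) = (\<integral>\<^sup>+z. ennreal (g z) \<partial>m)"
    by (subst emeasure_density) (auto simp: space_haar)
  also have "\<dots> = ennreal (LINT z|m. g z)"
    by (rule nn_integral_eq_integral[OF integrable_haar_Cc_real[OF assms(1)]]) (simp add: assms(2))
  finally show "emeasure (density m (\<lambda>y. ennreal (g y))) (space (density m (\<lambda>y. ennreal (g y)))) \<noteq> \<infinity>" by simp
qed

lemma borel_measurable_translate:
  fixes f :: "'a \<Rightarrow> complex"
  assumes "f \<in> borel_measurable borel"
  shows "translate \<omega> x f \<in> borel_measurable borel"
  unfolding translate_def
  using measurable_compose[OF measurable_conv integral_measurable_subprob_algebra[OF assms]] .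

text \<open>The two sides integrate \<open>f\<close> against the two descriptions of one finite
  measure in \<open>bind_conv_eq_density\<close>.\<close>

lemma adjoint_bounded_real:
  fixes f :: "'a \<Rightarrow> real"
  assumes f: "f \<in> borel_measurable borel" "\<And>x. \<bar>f x\<bar> \<le> B" and g: "g \<in> Cc_real" "\<And>x. 0 \<le> g x"
  shows "(LINT y|m. g y * (LINT t|\<omega> x y. f t)) = (LINT z|m. (LINT t|\<omega> (invol x) z. g t) * f z)"
proof -
  let ?M = "density m (\<lambda>y. ennreal (g y))" and ?k = "\<lambda>z. LINT t|\<omega> (invol x) z. g t"
  have k: "?k \<in> Cc_real" by (rule translate_Cc_real[OF g(1)])
  have k0: "0 \<le> ?k z" for z using g(2) by (simp add: integral_nonneg_AE)
  have [measurable_cong]: "sets m = sets borel" by (rule sets_haar)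
  have [measurable]: "g \<in> borel_measurable borel" "?k \<in> borel_measurable borel"
    using borel_measurable_Cc_real g(1) k by auto
  have M: "\<omega> x \<in> measurable ?M (subprob_algebra borel)"
    using measurable_conv[of x] sets_haar by (simp cong: measurable_cong_sets)
  note [measurable] = f(1)
  have Tf: "(\<lambda>y. LINT t|\<omega> x y. f t) \<in> borel_measurable borel"
    using measurable_compose[OF measurable_conv integral_measurable_subprob_algebra[OF f(1)]] .
  have "(LINT y|m. g y * (LINT t|\<omega> x y. f t)) = (LINT y|?M. LINT t|\<omega> x y. f t)"
    using Tf g(2) by (subst integral_density) auto
  also have "\<dots> = (LINT t|bind ?M (\<omega> x). f t)"
  proof (rule integral_bind[symmetric, OF f(1) _ M])
    show "AE y in ?M. emeasure (\<omega> x y) (space (\<omega> x y)) \<le> ennreal 1"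
      using prob_space.emeasure_space_1[OF conv_prob] by simp
  qed (use f(2) finite_measure_density_Cc_real[OF g] in auto)
  also have "\<dots> = (LINT z|m. ?k z * f z)"
    using k0 by (subst bind_conv_eq_density[OF g], subst integral_density) auto
  finally show ?thesis .
qed

lemma adjoint_bounded:
  fixes f :: "'a \<Rightarrow> complex"
  assumes f: "f \<in> borel_measurable borel" "\<And>x. norm (f x) \<le> B" and g: "g \<in> Cc_real" "\<And>x. 0 \<le> g x"
  shows "(LINT y|m. of_real (g y) * translate \<omega> x f y) = (LINT z|m. of_real (LINT t|\<omega> (invol x) z. g t) * f z)"
proof -
  let ?k = "\<lambda>z. LINT t|\<omega> (invol x) z. g t"
  have k: "?k \<in> Cc_real" by (rule translate_Cc_real[OF g(1)])
  have T: "Re (translate \<omega> x f y) = (LINT t|\<omega> x y. Re (f t))" "Im (translate \<omega> x f y) = (LINT t|\<omega> x y. Im (f t))" for y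
    unfolding translate_def using integrable_conv[OF f, of x y] by simp_all
  have Tb: "norm (translate \<omega> x f y) \<le> B" for y
    unfolding translate_def by (rule norm_conv_le[OF integrable_conv[OF f]]) (rule f(2))
  have i: "integrable m (\<lambda>y. of_real (h y) * q y)"
    if h: "h \<in> Cc_real" and q: "q \<in> borel_measurable borel" "\<And>y. norm (q y) \<le> B" for h and q :: "'a \<Rightarrow> complex"
  proof -
    obtain D where D: "compact D" "\<And>x. complex_of_real (h x) \<noteq> 0 \<Longrightarrow> x \<in> D"
      by (rule Cc_compact_supp[OF Cc_of_real[OF h]]) blast
    obtain M where M: "0 \<le> M" "\<And>x. norm (complex_of_real (h x)) \<le> M"
      by (rule Cc_bounded[OF Cc_of_real[OF h]]) blast
    show ?thesis
    proof (rule integrable_haar_compact_supp[OF _ _ D(1)])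
      show "(\<lambda>y. of_real (h y) * q y) \<in> borel_measurable borel"
        using borel_measurable_Cc_real[OF h] q(1) by measurable
      show "norm (of_real (h y) * q y) \<le> M * B" for y
        using M(2)[of y] q(2)[of y] M(1) unfolding norm_mult by (intro mult_mono) auto
      show "x \<in> D" if "of_real (h x) * q x \<noteq> 0" for x using that D(2)[of x] by auto
    qed
  qed
  have i1: "integrable m (\<lambda>y. of_real (g y) * translate \<omega> x f y)"
    by (rule i[OF g(1) borel_measurable_translate[OF f(1)] Tb])
  have i2: "integrable m (\<lambda>z. of_real (?k z) * f z)" by (rule i[OF k f])
  have b: "\<bar>Re (f x)\<bar> \<le> B" "\<bar>Im (f x)\<bar> \<le> B" for x
    using abs_Re_le_cmod[of "f x"] abs_Im_le_cmod[of "f x"] f(2)[of x] by linarith+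
  have mf: "(\<lambda>x. Re (f x)) \<in> borel_measurable borel" "(\<lambda>x. Im (f x)) \<in> borel_measurable borel"
    using f(1) by measurable
  show ?thesis
  proof (rule complex_eqI)
    have "Re (LINT y|m. of_real (g y) * translate \<omega> x f y) = (LINT y|m. g y * Re (translate \<omega> x f y))"
      using integral_Re[OF i1] by simp
    moreover have "Re (LINT z|m. of_real (?k z) * f z) = (LINT z|m. ?k z * Re (f z))"
      using integral_Re[OF i2] by simp
    ultimately show "Re (LINT y|m. of_real (g y) * translate \<omega> x f y) = Re (LINT z|m. of_real (?k z) * f z)"
      using adjoint_bounded_real[OF mf(1) b(1) g, of x] by (simp only: T)
    have "Im (LINT y|m. of_real (g y) * translate \<omega> x f y) = (LINT y|m. g y * Im (translate \<omega> x f y))"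
      using integral_Im[OF i1] by simp
    moreover have "Im (LINT z|m. of_real (?k z) * f z) = (LINT z|m. ?k z * Im (f z))"
      using integral_Im[OF i2] by simp
    ultimately show "Im (LINT y|m. of_real (g y) * translate \<omega> x f y) = Im (LINT z|m. of_real (?k z) * f z)"
      using adjoint_bounded_real[OF mf(2) b(2) g, of x] by (simp only: T)
  qed
qed

end

section \<open>Truncation of essentially bounded functions\<close>

text \<open>If \<open>c\<close> is an essential bound of \<open>f\<close>, this is a representative
  of the same class that is bounded everywhere, hence integrable for every
  \<open>\<omega> x y\<close>.\<close>

definition cutoff :: "real \<Rightarrow> ('a \<Rightarrow> complex) \<Rightarrow> 'a \<Rightarrow> complex" where
  "cutoff c f x = (if norm (f x) \<le> c then f x else 0)"

lemma norm_cutoff_le: "0 \<le> c \<Longrightarrow> norm (cutoff c f x) \<le> c"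
  by (simp add: cutoff_def)

lemma borel_measurable_cutoff:
  fixes f :: "'a::topological_space \<Rightarrow> complex"
  assumes [measurable]: "f \<in> borel_measurable borel"
  shows "cutoff c f \<in> borel_measurable borel"
  unfolding cutoff_def[abs_def] by measurable

text \<open>Positive and negative parts of the real and imaginary parts. The nested shape
  \<open>a + d * b\<close> lets a linearity step be applied three times in
  \<open>adjoint_bounded_Cc\<close>.\<close>

lemma Cc_decompose:
  fixes h :: "'a::t2_space \<Rightarrow> complex"
  assumes h: "h \<in> Cc"
  obtains p q r s where "p \<in> Cc_real" "q \<in> Cc_real" "r \<in> Cc_real" "s \<in> Cc_real"
    "\<And>x. 0 \<le> p x" "\<And>x. 0 \<le> q x" "\<And>x. 0 \<le> r x" "\<And>x. 0 \<le> s x"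
    "h = (\<lambda>x. ((of_real (p x) + (-1) * of_real (q x)) + \<i> * of_real (r x)) + (-\<i>) * of_real (s x))"
proof -
  obtain D where D: "compact D" "\<And>x. h x \<noteq> 0 \<Longrightarrow> x \<in> D" by (rule Cc_compact_supp[OF h]) blast
  have c: "continuous_on UNIV h" by (rule Cc_continuous[OF h])
  have 1: "(\<lambda>x. max (Re (h x)) 0) \<in> Cc_real" "(\<lambda>x. max (- Re (h x)) 0) \<in> Cc_real"
    "(\<lambda>x. max (Im (h x)) 0) \<in> Cc_real" "(\<lambda>x. max (- Im (h x)) 0) \<in> Cc_real"
    using c D(2) by (intro Cc_realI[OF _ D(1)] continuous_intros; force)+
  show thesis
    by (rule that[OF 1]) (auto simp: fun_eq_iff complex_eq_iff max_def)
qed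

context haar_hypergroup
begin

lemma AE_not_locally_null:
  assumes N: "locally_null m N" "N \<in> sets borel" and D: "compact D"
  shows "AE x in m. x \<in> D \<longrightarrow> x \<notin> N"
proof -
  have "N \<inter> D \<in> null_sets m"
    using N D borel_compact[OF D] sets_haar by (auto simp: locally_null_def null_sets_def)
  from AE_not_in[OF this] show ?thesis by eventually_elim auto
qed

lemma Linf_measurable: "f \<in> Linf m \<Longrightarrow> f \<in> borel_measurable borel"
  by (simp add: Linf_def)

lemma large_values_borel:
  fixes f :: "'a \<Rightarrow> complex"
  assumes [measurable]: "f \<in> borel_measurable borel"
  shows "{x. c < norm (f x)} \<in> sets borel"
  using assms by measurable

lemma Linf_bound:
  assumes "f \<in> Linf m"
  obtains c where "0 \<le> c" "locally_null m {x. c < norm (f x)}"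
proof -
  obtain c where c: "locally_null m {x. c < norm (f x)}" using assms by (auto simp: Linf_def)
  have "locally_null m {x. max c 0 < norm (f x)}"
    unfolding locally_null_def
  proof (intro allI impI)
    fix C :: "'a set" assume C: "compact C"
    have "emeasure m ({x. max c 0 < norm (f x)} \<inter> C) \<le> emeasure m ({x. c < norm (f x)} \<inter> C)"
      using large_values_borel[OF Linf_measurable[OF assms]] borel_compact[OF C] sets_haar
      by (intro emeasure_mono) auto
    then show "emeasure m ({x. max c 0 < norm (f x)} \<inter> C) = 0" using c C by (auto simp: locally_null_def)
  qed
  then show thesis using that[of "max c 0"] by simp
qed

text \<open>Only the compact support of \<open>h\<close> matters, and there a locally null set is
  null.\<close>

lemma integral_cutoff:
  assumes f: "f \<in> borel_measurable borel" and c: "locally_null m {x. c < norm (f x)}" and h: "h \<in> Cc"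
  shows "(LINT z|m. f z * h z) = (LINT z|m. cutoff c f z * h z)"
proof (rule integral_cong_AE)
  have [measurable_cong]: "sets m = sets borel" by (rule sets_haar)
  have [measurable]: "h \<in> borel_measurable borel" "f \<in> borel_measurable borel" "cutoff c f \<in> borel_measurable borel"
    using Cc_borel_measurable[OF h] f borel_measurable_cutoff by auto
  show "(\<lambda>z. f z * h z) \<in> borel_measurable m" "(\<lambda>z. cutoff c f z * h z) \<in> borel_measurable m" by measurable
  obtain D where D: "compact D" "\<And>x. h x \<noteq> 0 \<Longrightarrow> x \<in> D" by (rule Cc_compact_supp[OF h]) blast
  from AE_not_locally_null[OF c large_values_borel[OF f] D(1)]
  show "AE z in m. f z * h z = cutoff c f z * h z"
  proof eventually_elim
    case (elim z)
    then show ?case using D(2)[of z] by (cases "h z = 0") (auto simp: cutoff_def)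
  qed
qed

text \<open>A locally null set is null for \<open>\<omega> x y\<close> for locally almost all \<open>y\<close>.\<close>

lemma AE_translate_cutoff:
  assumes f: "f \<in> borel_measurable borel" and c: "locally_null m {x. c < norm (f x)}"
    and g: "g \<in> Cc_real" "\<And>x. 0 \<le> g x"
  shows "AE y in m. 0 < g y \<longrightarrow> translate \<omega> x f y = translate \<omega> x (cutoff c f) y"
proof -
  let ?N = "{x. c < norm (f x)}" and ?M = "density m (\<lambda>y. ennreal (g y))"
  let ?k = "\<lambda>z. LINT t|\<omega> (invol x) z. g t"
  have N[measurable]: "?N \<in> sets borel" by (rule large_values_borel[OF f])
  have k: "?k \<in> Cc_real" by (rule translate_Cc_real[OF g(1)])
  have [measurable_cong]: "sets m = sets borel" by (rule sets_haar)
  have [measurable]: "g \<in> borel_measurable borel" "?k \<in> borel_measurable borel"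
    using borel_measurable_Cc_real g(1) k by auto
  have M: "\<omega> x \<in> measurable ?M (subprob_algebra borel)"
    using measurable_conv[of x] sets_haar by (simp cong: measurable_cong_sets)
  obtain D B where D: "compact D" "\<And>x. ?k x \<noteq> 0 \<Longrightarrow> x \<in> D" "0 \<le> B" "\<And>x. ?k x \<le> B"
    by (rule Cc_real_supp_bound[OF k]) blast
  \<comment> \<open>The weight \<open>?k\<close> vanishes off the compact \<open>D\<close>, so a
    locally null set is null for this density.\<close>
  have "AE z in density m (\<lambda>z. ennreal (?k z)). z \<notin> ?N"
  proof (subst AE_density)
    from AE_not_locally_null[OF c N D(1)]
    show "AE z in m. 0 < ennreal (?k z) \<longrightarrow> z \<notin> ?N"
    proof eventually_elim
      case (elim z)
      have "z \<in> D" if "0 < ennreal (?k z)" using that D(2)[of z] by (cases "?k z = 0") auto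
      then show ?case using elim by blast
    qed
  qed measurable
  \<comment> \<open>The same measure is a mixture of the \<open>\<omega> x y\<close>; a set null for
    the mixture is null for almost every component of positive weight.\<close>
  then have "AE t in bind ?M (\<omega> x). t \<notin> ?N" by (simp only: bind_conv_eq_density[OF g])
  moreover have "Measurable.pred borel (\<lambda>t. t \<notin> ?N)" using N by measurable
  ultimately have "AE y in ?M. AE t in \<omega> x y. t \<notin> ?N" using AE_bind[OF M] by blast
  then have "AE y in m. 0 < ennreal (g y) \<longrightarrow> (AE t in \<omega> x y. t \<notin> ?N)"
    by (subst (asm) AE_density) measurable
  then show ?thesis
  proof eventually_elim
    case (elim y)
    show ?case
    proof
      assume "0 < g y"
      then have "AE t in \<omega> x y. t \<notin> ?N" using elim by simp
      then have "AE t in \<omega> x y. f t = cutoff c f t" by eventually_elim (simp add: cutoff_def)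
      then show "translate \<omega> x f y = translate \<omega> x (cutoff c f) y"
        unfolding translate_def using f borel_measurable_cutoff[OF f] sets_conv
        by (intro integral_cong_AE) (simp_all cong: measurable_cong_sets)
    qed
  qed
qed

lemma adjoint_bounded_Cc:
  assumes f: "f \<in> borel_measurable borel" "\<And>x. norm (f x) \<le> B" and h: "h \<in> Cc"
  shows "(LINT y|m. translate \<omega> x f y * h y) = (LINT z|m. f z * translate \<omega> (invol x) h z)"
proof -
  let ?Q = "\<lambda>h. (LINT y|m. translate \<omega> x f y * h y) = (LINT z|m. f z * translate \<omega> (invol x) h z)"
  have Tb: "norm (translate \<omega> x f y) \<le> B" for y
    unfolding translate_def by (rule norm_conv_le[OF integrable_conv[OF f]]) (rule f(2))
  have lin: "?Q (\<lambda>y. a y + d * b y)" if a: "a \<in> Cc" "?Q a" and b: "b \<in> Cc" "?Q b" for a b d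
  proof -
    have "translate \<omega> (invol x) (\<lambda>y. a y + d * b y) z = translate \<omega> (invol x) a z + d * translate \<omega> (invol x) b z" for z
      using integrable_conv_Cc[OF a(1)] integrable_conv_Cc[OF b(1)] by (simp add: translate_def)
    then have "(LINT z|m. f z * translate \<omega> (invol x) (\<lambda>y. a y + d * b y) z) =
        (LINT z|m. f z * translate \<omega> (invol x) a z + d * (f z * translate \<omega> (invol x) b z))"
      by (simp add: algebra_simps)
    also have "\<dots> = (LINT z|m. f z * translate \<omega> (invol x) a z) + d * (LINT z|m. f z * translate \<omega> (invol x) b z)"
      using integrable_bounded_mult_Cc[OF f translate_Cc[OF a(1)]] integrable_bounded_mult_Cc[OF f translate_Cc[OF b(1)]]
      by simp
    also have "\<dots> = (LINT y|m. translate \<omega> x f y * a y) + d * (LINT y|m. translate \<omega> x f y * b y)"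
      using a(2) b(2) by simp
    also have "\<dots> = (LINT y|m. translate \<omega> x f y * a y + d * (translate \<omega> x f y * b y))"
      using integrable_bounded_mult_Cc[OF borel_measurable_translate[OF f(1)] Tb a(1)]
        integrable_bounded_mult_Cc[OF borel_measurable_translate[OF f(1)] Tb b(1)] by simp
    also have "\<dots> = (LINT y|m. translate \<omega> x f y * (a y + d * b y))" by (simp add: algebra_simps)
    finally show ?thesis ..
  qed
  have pos: "?Q (\<lambda>y. of_real (g y))" if "g \<in> Cc_real" "\<And>x. 0 \<le> g x" for g
    using adjoint_bounded[OF f that, of x] by (simp add: translate_of_real mult.commute)
  obtain p q r s where d: "p \<in> Cc_real" "q \<in> Cc_real" "r \<in> Cc_real" "s \<in> Cc_real"
    "\<And>x. 0 \<le> p x" "\<And>x. 0 \<le> q x" "\<And>x. 0 \<le> r x" "\<And>x. 0 \<le> s x"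
    "h = (\<lambda>x. ((of_real (p x) + (-1) * of_real (q x)) + \<i> * of_real (r x)) + (-\<i>) * of_real (s x))"
    by (rule Cc_decompose[OF h]) blast
  note c = Cc_of_real[OF d(1)] Cc_of_real[OF d(2)] Cc_of_real[OF d(3)] Cc_of_real[OF d(4)]
  have Q: "?Q (\<lambda>x. of_real (p x))" "?Q (\<lambda>x. of_real (q x))" "?Q (\<lambda>x. of_real (r x))" "?Q (\<lambda>x. of_real (s x))"
    by (rule pos; fact d)+
  have c1: "(\<lambda>x. complex_of_real (p x) + (-1) * of_real (q x)) \<in> Cc" by (rule Cc_add[OF c(1) Cc_cmult[OF c(2)]])
  have c2: "(\<lambda>x. (complex_of_real (p x) + (-1) * of_real (q x)) + \<i> * of_real (r x)) \<in> Cc"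
    by (rule Cc_add[OF c1 Cc_cmult[OF c(3)]])
  show ?thesis unfolding d(9)
    by (rule lin[OF c2 lin[OF c1 lin[OF c(1) Q(1) c(2) Q(2)] c(3) Q(3)] c(4) Q(4)])
qed

lemma adjoint_Linf:
  assumes f: "f \<in> Linf m" and h: "h \<in> Cc"
  shows "(LINT y|m. translate \<omega> x f y * h y) = (LINT z|m. f z * translate \<omega> (invol x) h z)"
proof -
  obtain c where c: "0 \<le> c" "locally_null m {x. c < norm (f x)}" by (rule Linf_bound[OF f]) blast
  note fm = Linf_measurable[OF f]
  have cm: "cutoff c f \<in> borel_measurable borel" by (rule borel_measurable_cutoff[OF fm])
  have "continuous_on UNIV (\<lambda>y. norm (h y))" using Cc_continuous[OF h] by (intro continuous_intros)
  moreover obtain D where D: "compact D" "\<And>x. h x \<noteq> 0 \<Longrightarrow> x \<in> D" by (rule Cc_compact_supp[OF h]) blast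
  ultimately have n: "(\<lambda>y. norm (h y)) \<in> Cc_real" by (intro Cc_realI[of _ D]) auto
  have [measurable_cong]: "sets m = sets borel" by (rule sets_haar)
  have [measurable]: "h \<in> borel_measurable borel" "translate \<omega> x f \<in> borel_measurable borel"
    "translate \<omega> x (cutoff c f) \<in> borel_measurable borel"
    using Cc_borel_measurable[OF h] borel_measurable_translate fm cm by auto
  \<comment> \<open>With weight \<open>norm (h y)\<close> the translates agree almost everywhere
    that \<open>h\<close> is nonzero; elsewhere both products are 0.\<close>
  have "AE y in m. translate \<omega> x f y * h y = translate \<omega> x (cutoff c f) y * h y"
    using AE_translate_cutoff[OF fm c(2) n norm_ge_zero, of x] by eventually_elim auto
  then have "(LINT y|m. translate \<omega> x f y * h y) = (LINT y|m. translate \<omega> x (cutoff c f) y * h y)"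
    by (intro integral_cong_AE) measurable
  also have "\<dots> = (LINT z|m. cutoff c f z * translate \<omega> (invol x) h z)"
    by (rule adjoint_bounded_Cc[OF cm norm_cutoff_le[OF c(1)] h])
  also have "\<dots> = (LINT z|m. f z * translate \<omega> (invol x) h z)"
    by (rule integral_cutoff[OF fm c(2) translate_Cc[OF h], symmetric])
  finally show ?thesis .
qed

lemma kernel_op_cutoff:
  assumes "f \<in> borel_measurable borel" "locally_null m {x. c < norm (f x)}" "h \<in> Cc"
  shows "kernel_op h f = kernel_op h (cutoff c f)"
  unfolding kernel_op_def fun_eq_iff using integral_cutoff[OF assms(1,2) kernel_Cc[OF assms(3)]] by simp

lemma integrable_Linf_mult_Cc:
  assumes f: "f \<in> Linf m" and h: "h \<in> Cc"
  shows "integrable m (\<lambda>z. f z * h z)"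
proof -
  obtain c where c: "0 \<le> c" "locally_null m {x. c < norm (f x)}" by (rule Linf_bound[OF f]) blast
  note fm = Linf_measurable[OF f]
  have [measurable_cong]: "sets m = sets borel" by (rule sets_haar)
  have [measurable]: "h \<in> borel_measurable borel" "f \<in> borel_measurable borel" "cutoff c f \<in> borel_measurable borel"
    using Cc_borel_measurable[OF h] fm borel_measurable_cutoff by auto
  obtain D where D: "compact D" "\<And>x. h x \<noteq> 0 \<Longrightarrow> x \<in> D" by (rule Cc_compact_supp[OF h]) blast
  from AE_not_locally_null[OF c(2) large_values_borel[OF fm] D(1)]
  have "AE z in m. cutoff c f z * h z = f z * h z"
  proof eventually_elim
    case (elim z)
    then show ?case using D(2)[of z] by (cases "h z = 0") (auto simp: cutoff_def)
  qed
  moreover have "(\<lambda>z. f z * h z) \<in> borel_measurable m" by measurable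
  ultimately show ?thesis
    using integrable_bounded_mult_Cc[OF borel_measurable_cutoff[OF fm] norm_cutoff_le[OF c(1)] h]
    by (blast intro: integrable_cong_AE_imp)
qed

section \<open>Smoothing maps into \<open>UC\<close>\<close>

lemma translate_kernel_op_Linf:
  assumes f: "f \<in> Linf m" and h: "h \<in> Cc"
  shows "translate \<omega> x (kernel_op h f) y = (LINT z|m. f z * translate \<omega> (invol x) (kernel h y) z)"
proof -
  obtain c where c: "0 \<le> c" "locally_null m {x. c < norm (f x)}" by (rule Linf_bound[OF f]) blast
  note fm = Linf_measurable[OF f]
  have "translate \<omega> x (kernel_op h f) y = (LINT z|m. cutoff c f z * (LINT t|\<omega> x y. kernel h t z))"
    unfolding kernel_op_cutoff[OF fm c(2) h]
    by (rule translate_kernel_op[OF borel_measurable_cutoff[OF fm] norm_cutoff_le[OF c(1)] h])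
  also have "\<dots> = (LINT z|m. cutoff c f z * translate \<omega> (invol x) (kernel h y) z)"
    by (simp add: kernel_conv[OF h] translate_def)
  also have "\<dots> = (LINT z|m. f z * translate \<omega> (invol x) (kernel h y) z)"
    by (rule integral_cutoff[OF fm c(2) translate_Cc[OF kernel_Cc[OF h]], symmetric])
  finally show ?thesis .
qed

text \<open>At \<open>y\<close> both sides integrate \<open>f\<close> against
  \<open>kernel h y\<close> translated by \<open>invol x\<close>: one by the adjoint formula, the
  other by \<open>kernel_conv\<close>.\<close>

lemma kernel_op_translate:
  assumes f: "f \<in> Linf m" and h: "h \<in> Cc"
  shows "kernel_op h (translate \<omega> x f) = translate \<omega> x (kernel_op h f)"
  by (rule ext) (simp add: translate_kernel_op_Linf[OF f h] kernel_op_def adjoint_Linf[OF f kernel_Cc[OF h]])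

text \<open>Translations by \<open>invol x\<close> and \<open>invol y\<close> commute on
  \<open>h\<close>. Translating the smoothed function therefore only replaces \<open>h\<close> by
  \<open>kernel h x\<close>, and the dependence on \<open>x\<close> sits entirely in that
  kernel.\<close>

lemma translate_kernel_eq_kernel_op:
  assumes f: "f \<in> Linf m" and h: "h \<in> Cc"
  shows "translate \<omega> x (kernel_op h f) = kernel_op (kernel h x) f"
proof
  fix y
  have "translate \<omega> (invol x) (kernel h y) z = kernel (kernel h x) y z" for z
    using conv_assoc[OF h, of "invol x" z "invol y"] conv_assoc[OF h, of "invol y" z "invol x"]
      conv_commute[of "invol x" "invol y"]
    by (simp add: translate_def kernel_def)
  then show "translate \<omega> x (kernel_op h f) y = kernel_op (kernel h x) f y"
    unfolding translate_kernel_op_Linf[OF f h] by (simp add: kernel_op_def)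
qed

lemma kernel_op_bcontfun:
  assumes f: "f \<in> Linf m" and h: "h \<in> Cc"
  shows "kernel_op h f \<in> bcontfun"
proof -
  obtain c where c: "0 \<le> c" "locally_null m {x. c < norm (f x)}" by (rule Linf_bound[OF f]) blast
  note fm = Linf_measurable[OF f]
  note cb = borel_measurable_cutoff[OF fm] norm_cutoff_le[OF c(1)]
  have "bounded (range (kernel_op h (cutoff c f)))"
    using norm_kernel_op_le[OF cb h] by (intro boundedI) auto
  then show ?thesis
    using continuous_kernel_op[OF cb h] by (simp add: kernel_op_cutoff[OF fm c(2) h] bcontfun_def)
qed

text \<open>The sup distance of the translates by \<open>x\<close> and \<open>x0\<close> is at most
  \<open>c\<close> times the L1 distance of \<open>kernel h x\<close> and
  \<open>kernel h x0\<close>, which is small by \<open>kernel_L1_continuous\<close>.\<close>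

lemma kernel_op_UC:
  assumes f: "f \<in> Linf m" and h: "h \<in> Cc"
  shows "kernel_op h f \<in> UC \<omega>"
  unfolding UC_def
proof (intro CollectI conjI allI)
  show "kernel_op h f \<in> bcontfun" by (rule kernel_op_bcontfun[OF f h])
  show b: "translate \<omega> x (kernel_op h f) \<in> bcontfun" for x
    unfolding translate_kernel_eq_kernel_op[OF f h] by (rule kernel_op_bcontfun[OF f kernel_Cc[OF h]])
  obtain c where c: "0 \<le> c" "locally_null m {x. c < norm (f x)}" by (rule Linf_bound[OF f]) blast
  note fm = Linf_measurable[OF f]
  note cb = borel_measurable_cutoff[OF fm] norm_cutoff_le[OF c(1)]
  show "continuous_on UNIV (\<lambda>x. Bcontfun (translate \<omega> x (kernel_op h f)))"
  proof (rule continuous_on_UNIV_metricI)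
    fix x0 and e :: real assume e: "0 < e"
    have e': "0 < e / (c + 1)" using e c(1) by simp
    obtain N where N: "open N" "x0 \<in> N" "\<And>y. y \<in> N \<Longrightarrow> (LINT z|m. norm (kernel h y z - kernel h x0 z)) \<le> e / (c + 1)"
      by (rule kernel_L1_continuous[OF h e', of x0]) blast
    have "dist (Bcontfun (translate \<omega> x (kernel_op h f))) (Bcontfun (translate \<omega> x0 (kernel_op h f))) \<le> e"
      if x: "x \<in> N" for x
    proof (rule dist_bound)
      fix y
      let ?d = "\<lambda>z. kernel h x z - kernel h x0 z"
      have d: "?d \<in> Cc" by (intro Cc_diff kernel_Cc h)
      have "kernel ?d y z = kernel (kernel h x) y z - kernel (kernel h x0) y z" for z
        unfolding kernel_def[of ?d] kernel_def[of "kernel h x"] kernel_def[of "kernel h x0"]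
        by (intro Bochner_Integration.integral_diff integrable_conv_Cc kernel_Cc h)
      then have "kernel_op ?d (cutoff c f) y = kernel_op (kernel h x) (cutoff c f) y - kernel_op (kernel h x0) (cutoff c f) y"
        unfolding kernel_op_def
        using integrable_bounded_mult_Cc[OF cb kernel_Cc[OF kernel_Cc[OF h]]] by (simp add: right_diff_distrib)
      then have "dist (translate \<omega> x (kernel_op h f) y) (translate \<omega> x0 (kernel_op h f) y) = norm (kernel_op ?d (cutoff c f) y)"
        by (simp add: translate_kernel_eq_kernel_op[OF f h] kernel_op_cutoff[OF fm c(2) kernel_Cc[OF h]] dist_norm)
      also have "\<dots> \<le> c * (LINT z|m. norm (?d z))" by (rule norm_kernel_op_le[OF cb d])
      also have "\<dots> \<le> c * (e / (c + 1))" by (rule mult_left_mono[OF N(3)[OF x] c(1)])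
      also have "\<dots> \<le> e" using mult_divide_plus1_le[OF c(1)] e by simp
      finally show "dist (apply_bcontfun (Bcontfun (translate \<omega> x (kernel_op h f))) y)
          (apply_bcontfun (Bcontfun (translate \<omega> x0 (kernel_op h f))) y) \<le> e"
        by (simp add: Bcontfun_inverse[OF b])
    qed
    then show "\<exists>N. open N \<and> x0 \<in> N \<and> (\<forall>x\<in>N. dist (Bcontfun (translate \<omega> x (kernel_op h f))) (Bcontfun (translate \<omega> x0 (kernel_op h f))) \<le> e)"
      using N(1,2) by blast
  qed
qed

lemma Linf_norm_le:
  assumes "0 \<le> b" "\<And>x. norm (f x) \<le> b"
  shows "Linf_norm m f \<le> b"
proof -
  have "{x. b < norm (f x)} = {}" using assms(2) by (auto simp: not_less)
  then have "b \<in> {c. 0 \<le> c \<and> locally_null m {x. c < norm (f x)}}" using assms(1) by (simp add: locally_null_def)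
  then show ?thesis unfolding Linf_norm_def by (rule cInf_lower) (auto intro!: bdd_belowI[of _ 0])
qed

lemma bcontfun_Linf:
  assumes "f \<in> bcontfun"
  shows "f \<in> Linf m"
proof -
  have "continuous_on UNIV f" "bounded (range f)" using assms by (auto simp: bcontfun_def)
  moreover obtain b where "\<And>x. norm (f x) \<le> b" using calculation(2) by (auto simp: bounded_iff)
  then have "{x. b < norm (f x)} = {}" by (auto simp: not_less)
  ultimately show ?thesis
    by (auto simp: Linf_def locally_null_def intro!: borel_measurable_continuous_onI exI[of _ b])
qed

lemma Linf_norm_greatest:
  assumes "f \<in> Linf m" "\<And>c. 0 \<le> c \<Longrightarrow> locally_null m {x. c < norm (f x)} \<Longrightarrow> b \<le> c"
  shows "b \<le> Linf_norm m f"
  unfolding Linf_norm_def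
proof (rule cInf_greatest)
  show "{c. 0 \<le> c \<and> locally_null m {x. c < norm (f x)}} \<noteq> {}" using Linf_bound[OF assms(1)] by blast
qed (use assms(2) in blast)

text \<open>Every essential bound \<open>c\<close> of \<open>f\<close> gives a bound for the
  smoothed function; the infimum is taken over \<open>c\<close>. The \<open>+ 1\<close> permits
  division even if \<open>h\<close> is 0.\<close>

lemma Linf_norm_kernel_op_le:
  assumes f: "f \<in> Linf m" and h: "h \<in> Cc"
  shows "Linf_norm m (kernel_op h f) \<le> Linf_norm m f * ((LINT z|m. norm (h z)) + 1)"
proof -
  let ?I = "LINT z|m. norm (h z)"
  have I: "0 < ?I + 1" by (simp add: add_nonneg_pos)
  have "Linf_norm m (kernel_op h f) / (?I + 1) \<le> Linf_norm m f"
  proof (rule Linf_norm_greatest[OF f])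
    fix c :: real assume c: "0 \<le> c" "locally_null m {x. c < norm (f x)}"
    note fm = Linf_measurable[OF f]
    have "norm (kernel_op h f x) \<le> c * ?I" for x
      unfolding kernel_op_cutoff[OF fm c(2) h]
      by (rule norm_kernel_op_le[OF borel_measurable_cutoff[OF fm] norm_cutoff_le[OF c(1)] h])
    moreover have "c * ?I \<le> c * (?I + 1)" "0 \<le> c * (?I + 1)" using c(1) by (auto intro: mult_left_mono)
    ultimately have "Linf_norm m (kernel_op h f) \<le> c * (?I + 1)"
      by (intro Linf_norm_le) (blast intro: order_trans)+
    then show "Linf_norm m (kernel_op h f) / (?I + 1) \<le> c" using I by (simp add: pos_divide_le_eq)
  qed
  then show ?thesis using I by (simp add: pos_divide_le_eq)
qed

lemma kernel_op_add:
  assumes "f \<in> Linf m" "g \<in> Linf m" "h \<in> Cc"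
  shows "kernel_op h (\<lambda>x. f x + g x) = (\<lambda>x. kernel_op h f x + kernel_op h g x)"
  unfolding kernel_op_def fun_eq_iff
  using integrable_Linf_mult_Cc[OF assms(1) kernel_Cc[OF assms(3)]]
    integrable_Linf_mult_Cc[OF assms(2) kernel_Cc[OF assms(3)]]
  by (simp add: distrib_right)

lemma kernel_op_cmult: "kernel_op h (\<lambda>x. c * f x) = (\<lambda>x. c * kernel_op h f x)"
  unfolding kernel_op_def fun_eq_iff by (simp add: mult.assoc)

section \<open>Transfer of the mean\<close>

text \<open>A bump \<open>u\<close> at a point \<open>p\<close> with
  \<open>\<alpha> p \<noteq> 0\<close>, times the conjugate of \<open>\<alpha>\<close>, pairs with
  \<open>\<alpha>\<close> to the integral of \<open>(norm (\<alpha> x))\<^sup>2 * u x\<close>. This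
  is positive and can be scaled to 1.\<close>

lemma character_test_function:
  assumes \<alpha>: "\<alpha> \<in> characters \<omega> invol"
  obtains h where "h \<in> Cc" "(LINT z|m. \<alpha> z * h z) = 1"
proof -
  obtain p where p: "\<alpha> p \<noteq> 0" using \<alpha> by (auto simp: characters_def fun_eq_iff)
  have c: "continuous_on UNIV \<alpha>" using \<alpha> by (auto simp: characters_def bcontfun_def)
  obtain u where u: "u \<in> Cc_real" "\<And>x. 0 \<le> u x" "\<And>x. u x \<le> 1" "\<And>x. x \<in> {p} \<Longrightarrow> u x = 1"
      "\<And>x. u x \<noteq> 0 \<Longrightarrow> x \<in> UNIV"
    by (rule Urysohn_Cc[OF locally_compact compact_sing[of p] open_UNIV subset_UNIV]) blast
  let ?v = "\<lambda>x. (norm (\<alpha> x))\<^sup>2 * u x"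
  have ca: "continuous_on UNIV (\<lambda>x. cnj (\<alpha> x))" using c by (intro continuous_intros)
  have h: "(\<lambda>x. cnj (\<alpha> x) * of_real (u x)) \<in> Cc" by (rule Cc_mult_continuous[OF Cc_of_real[OF u(1)] ca])
  have e: "\<alpha> x * (cnj (\<alpha> x) * of_real (u x)) = of_real (?v x)" for x
    using complex_norm_square[of "\<alpha> x"] by simp
  have "(\<lambda>x. complex_of_real (?v x)) \<in> Cc"
    using Cc_mult_continuous[OF h c] by (simp only: e)
  then have v: "?v \<in> Cc_real" by (simp only: Cc_of_real_iff)
  have pos: "0 < (LINT x|m. ?v x)"
    by (rule haar_integral_pos[OF v, of p]) (use u(2) u(4)[of p] p in auto)
  show thesis
  proof (rule that)
    show "(\<lambda>x. inverse (of_real (LINT x|m. ?v x)) * (cnj (\<alpha> x) * of_real (u x))) \<in> Cc" by (rule Cc_cmult[OF h])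
    have "(LINT z|m. \<alpha> z * (inverse (of_real (LINT x|m. ?v x)) * (cnj (\<alpha> z) * of_real (u z)))) =
        (LINT z|m. inverse (of_real (LINT x|m. ?v x)) * complex_of_real (?v z))"
      by (simp only: e[symmetric] mult.left_commute)
    also have "\<dots> = inverse (of_real (LINT x|m. ?v x)) * complex_of_real (LINT z|m. ?v z)"
      by (simp del: of_real_mult of_real_power)
    also have "\<dots> = 1" using pos by simp
    finally show "(LINT z|m. \<alpha> z * (inverse (of_real (LINT x|m. ?v x)) * (cnj (\<alpha> z) * of_real (u z)))) = 1" .
  qed
qed

theorem alpha_amenable_UC_iff:
  assumes \<alpha>: "\<alpha> \<in> characters \<omega> invol"
  shows "alpha_amenable \<omega> m \<alpha> (UC \<omega>) \<longleftrightarrow> alpha_amenable \<omega> m \<alpha> (Linf m)"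
proof
  have sub: "\<And>f. f \<in> UC \<omega> \<Longrightarrow> f \<in> Linf m" using bcontfun_Linf by (simp add: UC_def)
  assume "alpha_amenable \<omega> m \<alpha> (Linf m)"
  then obtain \<phi> where "bounded_functional_on m (Linf m) \<phi>" "\<phi> \<alpha> = 1"
    and tr: "\<forall>f\<in>Linf m. \<forall>x. \<phi> (translate \<omega> x f) = \<alpha> x * \<phi> f"
    unfolding alpha_amenable_def by blast
  moreover from this(1) have "bounded_functional_on m (UC \<omega>) \<phi>"
    unfolding bounded_functional_on_def using sub by blast
  ultimately show "alpha_amenable \<omega> m \<alpha> (UC \<omega>)"
    unfolding alpha_amenable_def using sub by blast
next
  assume "alpha_amenable \<omega> m \<alpha> (UC \<omega>)"
  then obtain \<phi> B where add: "\<And>f g. f \<in> UC \<omega> \<Longrightarrow> g \<in> UC \<omega> \<Longrightarrow> \<phi> (\<lambda>x. f x + g x) = \<phi> f + \<phi> g"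
    and cm: "\<And>c f. f \<in> UC \<omega> \<Longrightarrow> \<phi> (\<lambda>x. c * f x) = c * \<phi> f"
    and bd: "\<And>f. f \<in> UC \<omega> \<Longrightarrow> norm (\<phi> f) \<le> B * Linf_norm m f"
    and one: "\<phi> \<alpha> = 1" and tr: "\<And>f x. f \<in> UC \<omega> \<Longrightarrow> \<phi> (translate \<omega> x f) = \<alpha> x * \<phi> f"
    unfolding alpha_amenable_def bounded_functional_on_def by blast
  obtain h where h: "h \<in> Cc" "(LINT z|m. \<alpha> z * h z) = 1" by (rule character_test_function[OF \<alpha>])
  note UC = kernel_op_UC[OF _ h(1)]
  have \<alpha>L: "\<alpha> \<in> Linf m" using \<alpha> bcontfun_Linf by (auto simp: characters_def)
  \<comment> \<open>The adjoint formula moves the translation from \<open>h\<close> to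
    \<open>\<alpha>\<close>, where multiplicativity of the character extracts the factor
    \<open>\<alpha> y\<close>.\<close>
  have "kernel_op h \<alpha> = \<alpha>"
  proof
    fix y
    have "kernel_op h \<alpha> y = (LINT z|m. translate \<omega> y \<alpha> z * h z)"
      by (simp add: kernel_op_def kernel_eq_translate adjoint_Linf[OF \<alpha>L h(1)])
    also have "\<dots> = (LINT z|m. \<alpha> y * (\<alpha> z * h z))"
      using \<alpha> by (simp add: characters_def translate_def mult.assoc)
    finally show "kernel_op h \<alpha> y = \<alpha> y" by (simp add: h(2))
  qed
  moreover have "norm (\<phi> (kernel_op h f)) \<le> \<bar>B\<bar> * ((LINT z|m. norm (h z)) + 1) * Linf_norm m f"
    if f: "f \<in> Linf m" for f
  proof -
    \<comment> \<open>The sign of \<open>B\<close> is unknown; nonnegativity of the norm allows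
      passing to its absolute value.\<close>
    have "0 \<le> Linf_norm m (kernel_op h f)"
      by (rule Linf_norm_greatest[OF bcontfun_Linf[OF kernel_op_bcontfun[OF f h(1)]]])
    then have "B * Linf_norm m (kernel_op h f) \<le> \<bar>B\<bar> * Linf_norm m (kernel_op h f)"
      by (intro mult_right_mono) auto
    also have "\<dots> \<le> \<bar>B\<bar> * (Linf_norm m f * ((LINT z|m. norm (h z)) + 1))"
      by (intro mult_left_mono Linf_norm_kernel_op_le f h) simp
    finally show ?thesis using bd[OF UC[OF f]] by (simp add: algebra_simps)
  qed
  moreover have "\<phi> (kernel_op h (\<lambda>x. f x + g x)) = \<phi> (kernel_op h f) + \<phi> (kernel_op h g)"
    if "f \<in> Linf m" "g \<in> Linf m" for f g
    using add[OF UC UC] that by (simp add: kernel_op_add[OF that h(1)])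
  moreover have "\<phi> (kernel_op h (\<lambda>x. c * f x)) = c * \<phi> (kernel_op h f)" if "f \<in> Linf m" for c f
    using cm[OF UC] that by (simp add: kernel_op_cmult)
  moreover have "\<phi> (kernel_op h (translate \<omega> x f)) = \<alpha> x * \<phi> (kernel_op h f)" if "f \<in> Linf m" for x f
    using tr[OF UC] that by (simp add: kernel_op_translate[OF that h(1)])
  ultimately show "alpha_amenable \<omega> m \<alpha> (Linf m)"
    unfolding alpha_amenable_def bounded_functional_on_def using one
    by (intro exI[of _ "\<lambda>f. \<phi> (kernel_op h f)"]) auto
qed

end

theorem theorem3p2:
  fixes \<omega> :: "'a::t2_space \<Rightarrow> 'a \<Rightarrow> 'a measure"
    and invol :: "'a \<Rightarrow> 'a"
    and m :: "'a measure"
    and \<alpha> :: "'a \<Rightarrow> complex"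
  assumes "commutative_hypergroup \<omega> invol"
    and "haar_measure \<omega> m"
    and "\<alpha> \<in> characters \<omega> invol"
  shows "alpha_amenable \<omega> m \<alpha> (UC \<omega>) \<longleftrightarrow> alpha_amenable \<omega> m \<alpha> (Linf m)"
proof -
  interpret commutative_hypergroup \<omega> invol by fact
  interpret haar_hypergroup \<omega> invol m by unfold_locales fact
  show ?thesis by (rule alpha_amenable_UC_iff) fact
qed

end
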